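(* Let $\Lambda$ be an artin algebra. Let $U,V$ be $\Lambda$-modules of finite length, and let $W$ and $W'$ be cokernels of monomorphisms $U\to V$. Assume that both $\operatorname{Ext}^1(W,W)=0$ and $\operatorname{Ext}^1(W',W')=0$. Then the modules $W$ and $W'$ are isomorphic. *)

theory Defs
  imports "HOL-Algebra.Module" "HOL-Algebra.Ideal" "HOL-Algebra.Elementary_Groups"
begin

text \<open>
  The library locale \<open>module\<close> requires a commutative base ring. Modules over an arbitrary unital
  ring are represented by the same record type; its fields \<open>mult\<close> and \<open>one\<close> carry no meaning
  and are left undefined in the constructions below.
\<close>

locale left_module = R?: ring R + M?: abelian_group M
  for R :: "('a, 'r) ring_scheme" (structure) and M :: "('a, 'b, 'm) module_scheme" (structure) +
  assumes smult_closed: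
      "\<lbrakk>a \<in> carrier R; x \<in> carrier M\<rbrakk> \<Longrightarrow> a \<odot>\<^bsub>M\<^esub> x \<in> carrier M"
    and smult_l_distr:
      "\<lbrakk>a \<in> carrier R; b \<in> carrier R; x \<in> carrier M\<rbrakk> \<Longrightarrow>
        (a \<oplus> b) \<odot>\<^bsub>M\<^esub> x = a \<odot>\<^bsub>M\<^esub> x \<oplus>\<^bsub>M\<^esub> b \<odot>\<^bsub>M\<^esub> x"
    and smult_r_distr:
      "\<lbrakk>a \<in> carrier R; x \<in> carrier M; y \<in> carrier M\<rbrakk> \<Longrightarrow>
        a \<odot>\<^bsub>M\<^esub> (x \<oplus>\<^bsub>M\<^esub> y) = a \<odot>\<^bsub>M\<^esub> x \<oplus>\<^bsub>M\<^esub> a \<odot>\<^bsub>M\<^esub> y"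
    and smult_assoc:
      "\<lbrakk>a \<in> carrier R; b \<in> carrier R; x \<in> carrier M\<rbrakk> \<Longrightarrow>
        (a \<otimes> b) \<odot>\<^bsub>M\<^esub> x = a \<odot>\<^bsub>M\<^esub> (b \<odot>\<^bsub>M\<^esub> x)"
    and smult_one:
      "x \<in> carrier M \<Longrightarrow> \<one> \<odot>\<^bsub>M\<^esub> x = x"


subsection \<open>Artin algebras\<close>

definition artinian_cring :: "('k, 'n) ring_scheme \<Rightarrow> bool" where
  "artinian_cring K \<longleftrightarrow> cring K \<and>
     (\<forall>I :: nat \<Rightarrow> 'k set. (\<forall>n. ideal (I n) K \<and> I (Suc n) \<subseteq> I n) \<longrightarrow>
       (\<exists>N. \<forall>n\<ge>N. I n = I N))"

definition fin_gen_module ::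
    "('k, 'n) ring_scheme \<Rightarrow> ('k, 'a, 'm) module_scheme \<Rightarrow> bool" where
  "fin_gen_module K M \<longleftrightarrow>
     (\<exists>S. finite S \<and> S \<subseteq> carrier M \<and>
       (\<forall>x \<in> carrier M. \<exists>c \<in> S \<rightarrow> carrier K. x = (\<Oplus>\<^bsub>M\<^esub>s\<in>S. c s \<odot>\<^bsub>M\<^esub> s)))"

text \<open>
  The operation \<open>\<odot>\<close> of the record \<open>\<Lambda>\<close> is the action of the commutative ring \<open>K\<close>;
  the library locale \<open>algebra\<close> does not apply because it requires \<open>\<Lambda>\<close> to be commutative.
\<close>

definition artin_algebra ::
    "('k, 'n) ring_scheme \<Rightarrow> ('k, 'a, 'm) module_scheme \<Rightarrow> bool" where
  "artin_algebra K \<Lambda> \<longleftrightarrow> artinian_cring K \<and> ring \<Lambda> \<and> module K \<Lambda> \<and>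
     (\<forall>a \<in> carrier K. \<forall>x \<in> carrier \<Lambda>. \<forall>y \<in> carrier \<Lambda>.
        (a \<odot>\<^bsub>\<Lambda>\<^esub> x) \<otimes>\<^bsub>\<Lambda>\<^esub> y = a \<odot>\<^bsub>\<Lambda>\<^esub> (x \<otimes>\<^bsub>\<Lambda>\<^esub> y) \<and>
        x \<otimes>\<^bsub>\<Lambda>\<^esub> (a \<odot>\<^bsub>\<Lambda>\<^esub> y) = a \<odot>\<^bsub>\<Lambda>\<^esub> (x \<otimes>\<^bsub>\<Lambda>\<^esub> y)) \<and>
     fin_gen_module K \<Lambda>"


subsection \<open>Homomorphisms, quotients, cokernels\<close>

text \<open>
  Homomorphisms are extensional functions, so that equality of homomorphisms is equality on the
  carrier.
\<close>

definition mod_hom ::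
    "('a, 'r) ring_scheme \<Rightarrow> ('a, 'b, 'm) module_scheme \<Rightarrow> ('a, 'c, 'n) module_scheme \<Rightarrow>
     ('b \<Rightarrow> 'c) set" where
  "mod_hom R M N = {f \<in> carrier M \<rightarrow>\<^sub>E carrier N.
     (\<forall>x \<in> carrier M. \<forall>y \<in> carrier M. f (x \<oplus>\<^bsub>M\<^esub> y) = f x \<oplus>\<^bsub>N\<^esub> f y) \<and>
     (\<forall>a \<in> carrier R. \<forall>x \<in> carrier M. f (a \<odot>\<^bsub>M\<^esub> x) = a \<odot>\<^bsub>N\<^esub> f x)}"

definition mod_mono ::
    "('a, 'r) ring_scheme \<Rightarrow> ('a, 'b, 'm) module_scheme \<Rightarrow> ('a, 'c, 'n) module_scheme \<Rightarrow>
     ('b \<Rightarrow> 'c) set" where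
  "mod_mono R M N = {f \<in> mod_hom R M N. inj_on f (carrier M)}"

definition mod_isomorphic ::
    "('a, 'r) ring_scheme \<Rightarrow> ('a, 'b, 'm) module_scheme \<Rightarrow> ('a, 'c, 'n) module_scheme \<Rightarrow> bool" where
  "mod_isomorphic R M N \<longleftrightarrow> (\<exists>f \<in> mod_hom R M N. bij_betw f (carrier M) (carrier N))"

definition quot_module :: "('a, 'b, 'm) module_scheme \<Rightarrow> 'b set \<Rightarrow> ('a, 'b set) module" where
  "quot_module M H =
     \<lparr>carrier = a_rcosets\<^bsub>M\<^esub> H, mult = undefined, one = undefined,
      zero = H, add = set_add M,
      smult = (\<lambda>a C. \<Union>x\<in>C. H +>\<^bsub>M\<^esub> (a \<odot>\<^bsub>M\<^esub> x))\<rparr>"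

definition coker ::
    "('a, 'b, 'm) module_scheme \<Rightarrow> ('a, 'c, 'n) module_scheme \<Rightarrow> ('b \<Rightarrow> 'c) \<Rightarrow>
     ('a, 'c set) module" where
  "coker M N f = quot_module N (f ` carrier M)"

definition is_cokernel ::
    "('a, 'r) ring_scheme \<Rightarrow> ('a, 'b, 'm) module_scheme \<Rightarrow> ('a, 'c, 'n) module_scheme \<Rightarrow>
     ('b \<Rightarrow> 'c) \<Rightarrow> ('a, 'd, 'l) module_scheme \<Rightarrow> bool" where
  "is_cokernel R M N f W \<longleftrightarrow> left_module R W \<and> mod_isomorphic R (coker M N f) W"


subsection \<open>Modules of finite length\<close>

definition simple_module ::
    "('a, 'r) ring_scheme \<Rightarrow> ('a, 'b, 'm) module_scheme \<Rightarrow> bool" where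
  "simple_module R M \<longleftrightarrow> left_module R M \<and> carrier M \<noteq> {\<zero>\<^bsub>M\<^esub>} \<and>
     (\<forall>H. submodule H R M \<longrightarrow> H = {\<zero>\<^bsub>M\<^esub>} \<or> H = carrier M)"

definition composition_series ::
    "('a, 'r) ring_scheme \<Rightarrow> ('a, 'b, 'm) module_scheme \<Rightarrow> (nat \<Rightarrow> 'b set) \<Rightarrow> nat \<Rightarrow> bool" where
  "composition_series R M C n \<longleftrightarrow>
     C 0 = {\<zero>\<^bsub>M\<^esub>} \<and> C n = carrier M \<and> (\<forall>i\<le>n. submodule (C i) R M) \<and>
     (\<forall>i<n. C i \<subseteq> C (Suc i) \<and>
        simple_module R (quot_module (M\<lparr>carrier := C (Suc i)\<rparr>) (C i)))"

definition finite_length ::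
    "('a, 'r) ring_scheme \<Rightarrow> ('a, 'b, 'm) module_scheme \<Rightarrow> bool" where
  "finite_length R M \<longleftrightarrow> (\<exists>C n. composition_series R M C n)"


subsection \<open>The first extension group\<close>

text \<open>
  The free module on a set \<open>S\<close>: finitely supported functions into the ring that vanish outside
  \<open>S\<close>. If \<open>S\<close> is a subset of a module \<open>M\<close>, then \<open>lin_comb R M\<close> is the homomorphism to \<open>M\<close>
  sending each basis element to the corresponding element of \<open>S\<close>.
\<close>

definition free_module :: "('a, 'r) ring_scheme \<Rightarrow> 's set \<Rightarrow> ('a, 's \<Rightarrow> 'a) module" where
  "free_module R S =
     \<lparr>carrier = {c \<in> UNIV \<rightarrow> carrier R. finite {s. c s \<noteq> \<zero>\<^bsub>R\<^esub>} \<and> {s. c s \<noteq> \<zero>\<^bsub>R\<^esub>} \<subseteq> S},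
      mult = undefined, one = undefined,
      zero = (\<lambda>s. \<zero>\<^bsub>R\<^esub>), add = (\<lambda>c d s. c s \<oplus>\<^bsub>R\<^esub> d s),
      smult = (\<lambda>a c s. a \<otimes>\<^bsub>R\<^esub> c s)\<rparr>"

definition lin_comb ::
    "('a, 'r) ring_scheme \<Rightarrow> ('a, 'b, 'm) module_scheme \<Rightarrow> ('b \<Rightarrow> 'a) \<Rightarrow> 'b" where
  "lin_comb R M c = (\<Oplus>\<^bsub>M\<^esub>s\<in>{s. c s \<noteq> \<zero>\<^bsub>R\<^esub>}. c s \<odot>\<^bsub>M\<^esub> s)"

text \<open>
  The beginning of the standard free resolution of \<open>M\<close>: starting from the free module on the
  carrier of \<open>M\<close>, each further term is the free module on the kernel of the preceding map.
  The augmentation and the differentials are \<open>lin_comb R M\<close>,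
  \<open>lin_comb R (res0 R M)\<close> and \<open>lin_comb R (res1 R M)\<close>.
\<close>

definition res0 ::
    "('a, 'r) ring_scheme \<Rightarrow> ('a, 'b, 'm) module_scheme \<Rightarrow> ('a, 'b \<Rightarrow> 'a) module" where
  "res0 R M = free_module R (carrier M)"

definition res1 ::
    "('a, 'r) ring_scheme \<Rightarrow> ('a, 'b, 'm) module_scheme \<Rightarrow> ('a, ('b \<Rightarrow> 'a) \<Rightarrow> 'a) module" where
  "res1 R M = free_module R (a_kernel (res0 R M) M (lin_comb R M))"

definition res2 ::
    "('a, 'r) ring_scheme \<Rightarrow> ('a, 'b, 'm) module_scheme \<Rightarrow>
     ('a, (('b \<Rightarrow> 'a) \<Rightarrow> 'a) \<Rightarrow> 'a) module" where
  "res2 R M = free_module R (a_kernel (res1 R M) (res0 R M) (lin_comb R (res0 R M)))"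

definition ext1_cocycles ::
    "('a, 'r) ring_scheme \<Rightarrow> ('a, 'b, 'm) module_scheme \<Rightarrow> ('a, 'c, 'n) module_scheme \<Rightarrow>
     ((('b \<Rightarrow> 'a) \<Rightarrow> 'a) \<Rightarrow> 'c) set" where
  "ext1_cocycles R M N =
     {f \<in> mod_hom R (res1 R M) N.
        \<forall>c \<in> carrier (res2 R M). f (lin_comb R (res1 R M) c) = \<zero>\<^bsub>N\<^esub>}"

definition ext1_coboundaries ::
    "('a, 'r) ring_scheme \<Rightarrow> ('a, 'b, 'm) module_scheme \<Rightarrow> ('a, 'c, 'n) module_scheme \<Rightarrow>
     ((('b \<Rightarrow> 'a) \<Rightarrow> 'a) \<Rightarrow> 'c) set" where
  "ext1_coboundaries R M N =
     (\<lambda>g. compose (carrier (res1 R M)) g (lin_comb R (res0 R M))) ` mod_hom R (res0 R M) N"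

definition hom_group ::
    "('a, 'r) ring_scheme \<Rightarrow> ('a, 'b, 'm) module_scheme \<Rightarrow> ('a, 'c, 'n) module_scheme \<Rightarrow>
     ('b \<Rightarrow> 'c) monoid" where
  "hom_group R M N =
     \<lparr>carrier = mod_hom R M N,
      mult = (\<lambda>f g. \<lambda>x\<in>carrier M. f x \<oplus>\<^bsub>N\<^esub> g x),
      one = (\<lambda>x\<in>carrier M. \<zero>\<^bsub>N\<^esub>)\<rparr>"

text \<open>
  The first right derived functor of \<open>Hom\<close>: the first cohomology group of the complex obtained by
  applying \<open>Hom(-, N)\<close> to the free resolution of \<open>M\<close>.
\<close>

definition Ext1 ::
    "('a, 'r) ring_scheme \<Rightarrow> ('a, 'b, 'm) module_scheme \<Rightarrow> ('a, 'c, 'n) module_scheme \<Rightarrow>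
     ((('b \<Rightarrow> 'a) \<Rightarrow> 'a) \<Rightarrow> 'c) set monoid" where
  "Ext1 R M N =
     (hom_group R (res1 R M) N)\<lparr>carrier := ext1_cocycles R M N\<rparr> Mod ext1_coboundaries R M N"

end

theory Submission
  imports Defs "HOL-Library.Extended_Nat"
begin

text \<open>
  Write \<open>[M, X]\<close> for the length of \<open>Hom(M, X)\<close> over the commutative base ring. The proof has three
  steps: \<open>[W, X] = [W', X]\<close> for every module \<open>X\<close> of finite length; equality of all these numbers forces
  \<open>W\<close> and \<open>W'\<close> to be isomorphic; and an artin algebra provides the finiteness that both need.

  \<^emph>\<open>The pencil.\<close> For \<open>n \<ge> 0\<close> let \<open>R\<close> be the space of sequences \<open>\<phi>\<^sub>0, \<dots>, \<phi>\<^sub>n\<close> in \<open>Hom(V, X)\<close> such that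
  \<open>\<phi>\<^sub>i f + \<phi>\<^sub>i\<^sub>+\<^sub>1 f' = 0\<close> for \<open>i < n\<close>; it is \<open>Hom(C, X)\<close> for the cokernel \<open>C\<close> of multiplication by \<open>f + T f'\<close>
  from polynomials of degree less than \<open>n\<close> over \<open>U\<close> to those of degree at most \<open>n\<close> over \<open>V\<close>.
  The sequences with \<open>\<phi>\<^sub>n = 0\<close> form a subspace, filtered by the vanishing of further last terms. Each layer
  embeds into \<open>{\<psi>. \<psi> f = 0} = Hom(W, X)\<close>, and when \<open>Ext\<^sup>1(W, W) = 0\<close> it is everything: the projection
  \<open>h\<^sub>0 : V \<rightarrow> W\<close> continues to maps \<open>h\<^sub>i : V \<rightarrow> W\<close> with \<open>h\<^sub>i\<^sub>+\<^sub>1 f = - h\<^sub>i f'\<close>, since every map \<open>U \<rightarrow> W\<close> extends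
  along \<open>f\<close>. So this subspace has length \<open>n [W, X]\<close>, and \<open>R\<close> exceeds it by at most \<open>[V, X]\<close>.
  The condition \<open>\<phi>\<^sub>0 = 0\<close> gives in the same way a subspace of length \<open>n [W', X]\<close>, because reversing the
  sequences exchanges \<open>f\<close> and \<open>f'\<close>. Hence \<open>n [W, X]\<close> and \<open>n [W', X]\<close> differ by at most \<open>[V, X]\<close> for every \<open>n\<close>,
  and \<open>[W, X] = [W', X]\<close> (\<open>annih_len_eq\<close>). Since \<open>f\<close> and \<open>f'\<close> are the values of the pencil at zero and at infinity,
  no generic value of \<open>T\<close> is ever chosen, and residue fields may be finite.

  \<^emph>\<open>Hom lengths determine the module.\<close> This is Bongartz's argument, in \<open>isomorphic_if_hom_len_eq\<close>.
  Take \<open>h : P \<rightarrow> W\<close>, where \<open>P\<close> is a finite power of \<open>W'\<close>, such that every map \<open>W' \<rightarrow> W\<close> factors through \<open>h\<close>.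
  Comparing lengths in \<open>0 \<rightarrow> Hom(-, ker h) \<rightarrow> Hom(-, P) \<rightarrow> Hom(-, W)\<close> at \<open>W'\<close> and at \<open>W\<close>, the identity of \<open>W\<close>
  factors through \<open>h\<close> as well, so it is a sum of endomorphisms \<open>b c\<close> that factor through \<open>W'\<close>. If \<open>W \<noteq> 0\<close>,
  not all such endomorphisms are nilpotent, and Fitting's lemma turns one that is not into a common nonzero
  direct summand of \<open>W\<close> and \<open>W'\<close>. Lengths being additive, the complements again have equal Hom lengths, and
  induction on the length of \<open>W\<close> finishes.

  \<^emph>\<open>Finiteness.\<close> Lengths are suprema of lengths of chains, and the modular law makes them additive (\<open>rlen_add\<close>).
  Over an artin algebra a simple module is a finite-dimensional vector space over a residue field of the
  base ring, so modules of finite length have finite length over the base ring, and so do their Hom groups.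
\<close>

section \<open>Lengths of modules with operators\<close>

text \<open>
  The base ring acts on every module through central elements of the algebra, so it is represented by a set
  \<open>Z\<close> of ring elements. With \<open>Z\<close> the whole ring the same notion gives submodules. Inverses are asserted
  without the operator \<open>\<ominus>\<close> so that the predicate does not change when the carrier is restricted.
\<close>

definition stable_sub :: "'a set \<Rightarrow> ('a, 'b, 'm) module_scheme \<Rightarrow> 'b set \<Rightarrow> bool" where
  "stable_sub Z M H \<longleftrightarrow> H \<subseteq> carrier M \<and> \<zero>\<^bsub>M\<^esub> \<in> H \<and> (\<forall>x\<in>H. \<forall>y\<in>H. x \<oplus>\<^bsub>M\<^esub> y \<in> H) \<and>
     (\<forall>x\<in>H. \<exists>y\<in>H. x \<oplus>\<^bsub>M\<^esub> y = \<zero>\<^bsub>M\<^esub>) \<and> (\<forall>z\<in>Z. \<forall>x\<in>H. z \<odot>\<^bsub>M\<^esub> x \<in> H)"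

definition chain :: "'a set \<Rightarrow> ('a, 'b, 'm) module_scheme \<Rightarrow> 'b set \<Rightarrow> 'b set \<Rightarrow> (nat \<Rightarrow> 'b set) \<Rightarrow> nat \<Rightarrow> bool"
  where "chain Z M A B C n \<longleftrightarrow> (\<forall>i\<le>n. stable_sub Z M (C i) \<and> A \<subseteq> C i \<and> C i \<subseteq> B) \<and> (\<forall>i<n. C i \<subset> C (Suc i))"

text \<open>
  The length of the quotient of \<open>B\<close> by \<open>A\<close>, expressed through the interval of subgroups between them.
\<close>

definition rlen :: "'a set \<Rightarrow> ('a, 'b, 'm) module_scheme \<Rightarrow> 'b set \<Rightarrow> 'b set \<Rightarrow> enat" where
  "rlen Z M A B = Sup (enat ` {n. \<exists>C. chain Z M A B C n})"

abbreviation len :: "'a set \<Rightarrow> ('a, 'b, 'm) module_scheme \<Rightarrow> 'b set \<Rightarrow> enat" where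
  "len Z M H \<equiv> rlen Z M {\<zero>\<^bsub>M\<^esub>} H"

definition lin :: "'a set \<Rightarrow> ('a, 'b, 'm) module_scheme \<Rightarrow> ('a, 'c, 'n) module_scheme \<Rightarrow> 'b set \<Rightarrow> ('b \<Rightarrow> 'c) \<Rightarrow> bool"
  where "lin Z M N H f \<longleftrightarrow> f \<in> H \<rightarrow> carrier N \<and> (\<forall>x\<in>H. \<forall>y\<in>H. f (x \<oplus>\<^bsub>M\<^esub> y) = f x \<oplus>\<^bsub>N\<^esub> f y) \<and>
     (\<forall>z\<in>Z. \<forall>x\<in>H. f (z \<odot>\<^bsub>M\<^esub> x) = z \<odot>\<^bsub>N\<^esub> f x)"

lemma stableD:
  assumes "stable_sub Z M H"
  shows "H \<subseteq> carrier M" "\<zero>\<^bsub>M\<^esub> \<in> H" "\<And>x y. x \<in> H \<Longrightarrow> y \<in> H \<Longrightarrow> x \<oplus>\<^bsub>M\<^esub> y \<in> H"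
    "\<And>z x. z \<in> Z \<Longrightarrow> x \<in> H \<Longrightarrow> z \<odot>\<^bsub>M\<^esub> x \<in> H" "\<And>x. x \<in> H \<Longrightarrow> x \<in> carrier M"
  using assms unfolding stable_sub_def by auto

lemma stable_mono: "stable_sub Z M H \<Longrightarrow> Y \<subseteq> Z \<Longrightarrow> stable_sub Y M H"
  unfolding stable_sub_def by blast

lemma stable_restrict:
  "stable_sub Z (M\<lparr>carrier := B\<rparr>) H \<longleftrightarrow> H \<subseteq> B \<and> stable_sub Z M H" if "B \<subseteq> carrier M"
  using that unfolding stable_sub_def by auto

lemma chainD:
  assumes "chain Z M A B C n"
  shows "i \<le> n \<Longrightarrow> stable_sub Z M (C i)" "i \<le> n \<Longrightarrow> A \<subseteq> C i" "i \<le> n \<Longrightarrow> C i \<subseteq> B" "i < n \<Longrightarrow> C i \<subset> C (Suc i)"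
  using assms unfolding chain_def by blast+

lemma chain_restrict:
  assumes "B \<subseteq> carrier M" "H \<subseteq> B"
  shows "chain Z (M\<lparr>carrier := B\<rparr>) A H = chain Z M A H"
proof -
  have "stable_sub Z (M\<lparr>carrier := B\<rparr>) G \<and> A \<subseteq> G \<and> G \<subseteq> H \<longleftrightarrow> stable_sub Z M G \<and> A \<subseteq> G \<and> G \<subseteq> H" for G
    using stable_restrict[OF assms(1)] assms(2) by blast
  then show ?thesis unfolding chain_def fun_eq_iff by simp
qed

lemma rlen_restrict:
  assumes "B \<subseteq> carrier M" "H \<subseteq> B"
  shows "rlen Z (M\<lparr>carrier := B\<rparr>) A H = rlen Z M A H"
  unfolding rlen_def chain_restrict[OF assms] ..

lemma rlen_geI: "chain Z M A B C n \<Longrightarrow> enat n \<le> rlen Z M A B"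
  unfolding rlen_def by (rule Sup_upper) auto

lemma rlen_leI: "(\<And>C n. chain Z M A B C n \<Longrightarrow> enat n \<le> x) \<Longrightarrow> rlen Z M A B \<le> x"
  unfolding rlen_def by (rule Sup_least) auto

lemma rlen_attained:
  assumes "stable_sub Z M A" "A \<subseteq> B" "rlen Z M A B \<noteq> \<infinity>"
  obtains C n where "chain Z M A B C n" "rlen Z M A B = enat n"
proof -
  let ?S = "{n. \<exists>C. chain Z M A B C n}"
  have "chain Z M A B (\<lambda>_. A) 0" using assms(1,2) by (auto simp: chain_def)
  then have ne: "?S \<noteq> {}" by blast
  have "finite (enat ` ?S)" using assms(3) unfolding rlen_def Sup_enat_def by (auto split: if_splits)
  then have "Max (enat ` ?S) \<in> enat ` ?S" using ne by (intro Max_in) auto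
  moreover have "rlen Z M A B = Max (enat ` ?S)"
    using assms(3) ne unfolding rlen_def Sup_enat_def by (auto split: if_splits)
  ultimately show ?thesis using that by auto
qed

lemma rlen_mono: "A' \<subseteq> A \<Longrightarrow> B \<subseteq> B' \<Longrightarrow> rlen Z M A B \<le> rlen Z M A' B'"
proof (rule rlen_leI)
  fix C n assume *: "A' \<subseteq> A" "B \<subseteq> B'" "chain Z M A B C n"
  then have "chain Z M A' B' C n" unfolding chain_def by (meson subset_trans)
  then show "enat n \<le> rlen Z M A' B'" by (rule rlen_geI)
qed

lemma chain_append:
  assumes "chain Z M A B C n" "chain Z M B E D m" "A \<subseteq> B" "B \<subseteq> E"
  shows "\<exists>F. chain Z M A E F (n + m)"
proof (rule exI)
  let ?F = "\<lambda>i. if i \<le> n then C i else D (i - n)"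
  have "?F i \<subset> ?F (Suc i)" if "i < n + m" for i
  proof -
    consider "Suc i \<le> n" | "i = n" | "i > n" by linarith
    then show ?thesis
    proof cases
      case 1 then show ?thesis using assms(1) by (auto simp: chain_def)
    next
      case 2
      have "C n \<subseteq> D 0" using assms(1,2) unfolding chain_def by (meson le_refl zero_le subset_trans)
      moreover have "D 0 \<subset> D 1" using 2 that assms(2) by (auto simp: chain_def)
      ultimately show ?thesis using 2 by auto
    next
      case 3
      then have "Suc i - n = Suc (i - n)" "i - n < m" using that by auto
      then show ?thesis using 3 assms(2) by (auto simp: chain_def)
    qed
  qed
  moreover have "stable_sub Z M (?F i) \<and> A \<subseteq> ?F i \<and> ?F i \<subseteq> E" if "i \<le> n + m" for i
  proof (cases "i \<le> n")
    case True
    then show ?thesis using chainD(1-3)[OF assms(1) True] assms(4) by auto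
  next
    case False
    then have "i - n \<le> m" using that by simp
    then show ?thesis using False chainD(1-3)[OF assms(2), of "i - n"] assms(3) by auto
  qed
  ultimately show "chain Z M A E ?F (n + m)" unfolding chain_def by blast
qed

text \<open>
  Repetitions in an increasing sequence are allowed and not counted: intersections and sums with a fixed
  subgroup turn chains into such sequences.
\<close>

lemma weak_chain:
  assumes "\<And>i. i \<le> n \<Longrightarrow> stable_sub Z M (X i) \<and> A \<subseteq> X i \<and> X i \<subseteq> B"
    and "\<And>i. i < n \<Longrightarrow> X i \<subseteq> X (Suc i)"
  shows "enat (card {i. i < n \<and> X i \<noteq> X (Suc i)}) \<le> rlen Z M A B"
proof -
  have "\<exists>D. chain Z M A (X m) D (card {i. i < m \<and> X i \<noteq> X (Suc i)})" if "m \<le> n" for m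
    using that
  proof (induction m)
    case 0
    show ?case by (rule exI[of _ "\<lambda>_. X 0"]) (use assms(1)[of 0] in \<open>auto simp: chain_def\<close>)
  next
    case (Suc m)
    then obtain D where D: "chain Z M A (X m) D (card {i. i < m \<and> X i \<noteq> X (Suc i)})" by auto
    have st: "stable_sub Z M (X m)" "stable_sub Z M (X (Suc m))" "A \<subseteq> X m" "X m \<subseteq> X (Suc m)"
      using assms Suc.prems by auto
    show ?case
    proof (cases "X m = X (Suc m)")
      case True
      then have "{i. i < Suc m \<and> X i \<noteq> X (Suc i)} = {i. i < m \<and> X i \<noteq> X (Suc i)}"
        by (auto simp: less_Suc_eq)
      then show ?thesis using D True by auto
    next
      case False
      then have "{i. i < Suc m \<and> X i \<noteq> X (Suc i)} = insert m {i. i < m \<and> X i \<noteq> X (Suc i)}"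
        by (auto simp: less_Suc_eq)
      then have c: "card {i. i < Suc m \<and> X i \<noteq> X (Suc i)} = card {i. i < m \<and> X i \<noteq> X (Suc i)} + 1"
        by simp
      have "chain Z M (X m) (X (Suc m)) (\<lambda>i. if i = 0 then X m else X (Suc m)) 1"
        using st False by (auto simp: chain_def)
      from chain_append[OF D this st(3,4)] show ?thesis unfolding c .
    qed
  qed
  from this[of n] obtain D where "chain Z M A (X n) D (card {i. i < n \<and> X i \<noteq> X (Suc i)})" by auto
  from rlen_geI[OF this] have "enat (card {i. i < n \<and> X i \<noteq> X (Suc i)}) \<le> rlen Z M A (X n)" .
  also have "\<dots> \<le> rlen Z M A B" using assms(1)[of n] by (intro rlen_mono) auto
  finally show ?thesis .
qed

context left_module begin

lemma smult_zero: "a \<in> carrier R \<Longrightarrow> a \<odot>\<^bsub>M\<^esub> \<zero>\<^bsub>M\<^esub> = \<zero>\<^bsub>M\<^esub>"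
  using smult_r_distr[of a "\<zero>\<^bsub>M\<^esub>" "\<zero>\<^bsub>M\<^esub>"] smult_closed[of a "\<zero>\<^bsub>M\<^esub>"]
  by (metis M.add.l_cancel_one M.l_zero M.zero_closed)

lemma zero_smult: "x \<in> carrier M \<Longrightarrow> \<zero> \<odot>\<^bsub>M\<^esub> x = \<zero>\<^bsub>M\<^esub>"
  using smult_l_distr[of "\<zero>" "\<zero>" x] smult_closed[of "\<zero>" x]
  by (metis M.add.l_cancel_one R.l_zero R.zero_closed)

lemma smult_neg: "a \<in> carrier R \<Longrightarrow> x \<in> carrier M \<Longrightarrow> a \<odot>\<^bsub>M\<^esub> (\<ominus>\<^bsub>M\<^esub> x) = \<ominus>\<^bsub>M\<^esub> (a \<odot>\<^bsub>M\<^esub> x)"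
  by (metis M.a_inv_closed M.l_neg M.minus_equality smult_closed smult_r_distr smult_zero)

lemma neg_smult: "a \<in> carrier R \<Longrightarrow> x \<in> carrier M \<Longrightarrow> (\<ominus> a) \<odot>\<^bsub>M\<^esub> x = \<ominus>\<^bsub>M\<^esub> (a \<odot>\<^bsub>M\<^esub> x)"
  by (metis R.a_inv_closed R.l_neg M.minus_equality smult_closed smult_l_distr zero_smult)

lemma stable_neg: "stable_sub Z M H \<Longrightarrow> x \<in> H \<Longrightarrow> \<ominus>\<^bsub>M\<^esub> x \<in> H"
proof -
  assume *: "stable_sub Z M H" "x \<in> H"
  then obtain y where "y \<in> H" "x \<oplus>\<^bsub>M\<^esub> y = \<zero>\<^bsub>M\<^esub>" unfolding stable_sub_def by blast
  then show ?thesis using stableD(5)[OF *(1)] *(2) M.minus_equality M.a_comm by metis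
qed

lemma stable_minus: "stable_sub Z M H \<Longrightarrow> x \<in> H \<Longrightarrow> y \<in> H \<Longrightarrow> x \<ominus>\<^bsub>M\<^esub> y \<in> H"
  unfolding a_minus_def by (rule stableD(3)) (auto intro: stable_neg)

lemma stableI:
  assumes "H \<subseteq> carrier M" "\<zero>\<^bsub>M\<^esub> \<in> H" "\<And>x y. x \<in> H \<Longrightarrow> y \<in> H \<Longrightarrow> x \<oplus>\<^bsub>M\<^esub> y \<in> H"
    "\<And>x. x \<in> H \<Longrightarrow> \<ominus>\<^bsub>M\<^esub> x \<in> H" "\<And>z x. z \<in> Z \<Longrightarrow> x \<in> H \<Longrightarrow> z \<odot>\<^bsub>M\<^esub> x \<in> H"
  shows "stable_sub Z M H"
proof -
  have "\<exists>y\<in>H. x \<oplus>\<^bsub>M\<^esub> y = \<zero>\<^bsub>M\<^esub>" if "x \<in> H" for x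
    using assms(1,4) that by (intro bexI[of _ "\<ominus>\<^bsub>M\<^esub> x"]) (auto simp: M.r_neg)
  then show ?thesis unfolding stable_sub_def using assms by auto
qed

lemma stable_finsum:
  assumes "stable_sub Z M H" "finite A" "\<And>a. a \<in> A \<Longrightarrow> g a \<in> H"
  shows "finsum M g A \<in> H"
  using assms(2,3)
proof (induction A rule: finite_induct)
  case empty then show ?case by (simp add: stableD(2)[OF assms(1)])
next
  case (insert a A)
  have "g \<in> A \<rightarrow> carrier M" "g a \<in> carrier M" using insert.prems stableD(5)[OF assms(1)] by auto
  then show ?case using insert stableD(3)[OF assms(1), of "g a" "finsum M g A"] by simp
qed

lemma stable_zero: "Z \<subseteq> carrier R \<Longrightarrow> stable_sub Z M {\<zero>\<^bsub>M\<^esub>}"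
  by (rule stableI) (auto simp: smult_zero)

lemma stable_carrier: "Z \<subseteq> carrier R \<Longrightarrow> stable_sub Z M (carrier M)"
  by (rule stableI) (auto simp: smult_closed)

lemma stable_Int: "stable_sub Z M H \<Longrightarrow> stable_sub Z M G \<Longrightarrow> stable_sub Z M (H \<inter> G)"
  by (rule stableI) (auto intro: stableD stable_neg)

lemma set_add_iff: "x \<in> H <+>\<^bsub>M\<^esub> G \<longleftrightarrow> (\<exists>h\<in>H. \<exists>g\<in>G. x = h \<oplus>\<^bsub>M\<^esub> g)"
  unfolding set_add_def' by auto

lemma stable_set_add:
  assumes "stable_sub Z M H" "stable_sub Z M G" "Z \<subseteq> carrier R"
  shows "stable_sub Z M (H <+>\<^bsub>M\<^esub> G)"
proof (rule stableI)
  show "H <+>\<^bsub>M\<^esub> G \<subseteq> carrier M" using stableD(5)[OF assms(1)] stableD(5)[OF assms(2)] by (auto simp: set_add_iff)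
  show "\<zero>\<^bsub>M\<^esub> \<in> H <+>\<^bsub>M\<^esub> G" unfolding set_add_iff using stableD(2)[OF assms(1)] stableD(2)[OF assms(2)] by (metis M.l_zero M.zero_closed)
next
  fix x y assume "x \<in> H <+>\<^bsub>M\<^esub> G" "y \<in> H <+>\<^bsub>M\<^esub> G"
  then obtain h g h' g' where *: "h \<in> H" "g \<in> G" "x = h \<oplus>\<^bsub>M\<^esub> g" "h' \<in> H" "g' \<in> G" "y = h' \<oplus>\<^bsub>M\<^esub> g'"
    unfolding set_add_iff by blast
  have c: "h \<in> carrier M" "g \<in> carrier M" "h' \<in> carrier M" "g' \<in> carrier M" using * stableD(5)[OF assms(1)] stableD(5)[OF assms(2)] by auto
  have "x \<oplus>\<^bsub>M\<^esub> y = (h \<oplus>\<^bsub>M\<^esub> h') \<oplus>\<^bsub>M\<^esub> (g \<oplus>\<^bsub>M\<^esub> g')" unfolding * using c by (simp add: M.a_ac)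
  then show "x \<oplus>\<^bsub>M\<^esub> y \<in> H <+>\<^bsub>M\<^esub> G" unfolding set_add_iff using stableD(3)[OF assms(1) *(1,4)] stableD(3)[OF assms(2) *(2,5)] by blast
next
  fix x assume "x \<in> H <+>\<^bsub>M\<^esub> G"
  then obtain h g where *: "h \<in> H" "g \<in> G" "x = h \<oplus>\<^bsub>M\<^esub> g" unfolding set_add_iff by blast
  have c: "h \<in> carrier M" "g \<in> carrier M" using * stableD(5)[OF assms(1)] stableD(5)[OF assms(2)] by auto
  then show "\<ominus>\<^bsub>M\<^esub> x \<in> H <+>\<^bsub>M\<^esub> G" unfolding set_add_iff *(3) using stable_neg[OF assms(1) *(1)] stable_neg[OF assms(2) *(2)] M.minus_add by metis
next
  fix z x assume z: "z \<in> Z" and "x \<in> H <+>\<^bsub>M\<^esub> G"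
  then obtain h g where *: "h \<in> H" "g \<in> G" "x = h \<oplus>\<^bsub>M\<^esub> g" unfolding set_add_iff by blast
  have c: "h \<in> carrier M" "g \<in> carrier M" using * stableD(5)[OF assms(1)] stableD(5)[OF assms(2)] by auto
  then show "z \<odot>\<^bsub>M\<^esub> x \<in> H <+>\<^bsub>M\<^esub> G" unfolding set_add_iff *(3)
    using stableD(4)[OF assms(1) z *(1)] stableD(4)[OF assms(2) z *(2)] smult_r_distr z assms(3) by (metis subsetD)
qed

lemma set_add_upper:
  assumes "stable_sub Z M H" "stable_sub Z M G"
  shows "H \<subseteq> H <+>\<^bsub>M\<^esub> G" "G \<subseteq> H <+>\<^bsub>M\<^esub> G"
proof -
  have "h = h \<oplus>\<^bsub>M\<^esub> \<zero>\<^bsub>M\<^esub>" if "h \<in> H" for h using stableD(5)[OF assms(1) that] by simp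
  then show "H \<subseteq> H <+>\<^bsub>M\<^esub> G" unfolding subset_iff set_add_iff using stableD(2)[OF assms(2)] by blast
  have "g = \<zero>\<^bsub>M\<^esub> \<oplus>\<^bsub>M\<^esub> g" if "g \<in> G" for g using stableD(5)[OF assms(2) that] by simp
  then show "G \<subseteq> H <+>\<^bsub>M\<^esub> G" unfolding subset_iff set_add_iff using stableD(2)[OF assms(1)] by blast
qed

text \<open>
  The modular law: it is what makes every strict step of a chain visible below or above \<open>B\<close>.
\<close>

lemma modular:
  assumes st: "stable_sub Z M X" "stable_sub Z M Y" "stable_sub Z M B" and "X \<subseteq> Y" "Y \<inter> B \<subseteq> X \<inter> B" "Y <+>\<^bsub>M\<^esub> B \<subseteq> X <+>\<^bsub>M\<^esub> B"
  shows "X = Y"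
proof
  show "Y \<subseteq> X"
  proof
    fix y assume y: "y \<in> Y"
    then have "y \<in> X <+>\<^bsub>M\<^esub> B" using set_add_upper(1)[OF st(2,3)] assms(6) by blast
    then obtain x b where *: "x \<in> X" "b \<in> B" "y = x \<oplus>\<^bsub>M\<^esub> b" unfolding set_add_iff by blast
    then have c: "x \<in> carrier M" "b \<in> carrier M" using * stableD(5)[OF st(1)] stableD(5)[OF st(3)] by auto
    then have "b = y \<ominus>\<^bsub>M\<^esub> x" using * by (simp add: a_minus_def M.a_ac M.r_neg M.r_neg1)
    then have "b \<in> Y" using stable_minus[OF st(2) y] * assms(4) by blast
    then have "b \<in> X" using * assms(5) by blast
    then show "y \<in> X" unfolding *(3) by (rule stableD(3)[OF st(1) *(1)])
  qed
qed fact

text \<open>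
  A chain from \<open>A\<close> to \<open>E\<close> induces weak chains from \<open>A\<close> to \<open>B\<close> and
  from \<open>B\<close> to \<open>E\<close>, and by the modular law each of its steps stays strict in at least one of them.
\<close>

lemma rlen_add:
  assumes st: "stable_sub Z M A" "stable_sub Z M B" and Z: "Z \<subseteq> carrier R" and sub: "A \<subseteq> B" "B \<subseteq> E" and stE: "stable_sub Z M E"
  shows "rlen Z M A E = rlen Z M A B + rlen Z M B E"
proof (rule antisym)
  show "rlen Z M A E \<le> rlen Z M A B + rlen Z M B E"
  proof (rule rlen_leI)
    fix X n assume X: "chain Z M A E X n"
    let ?I = "{i. i < n \<and> X i \<inter> B \<noteq> X (Suc i) \<inter> B}" and ?J = "{i. i < n \<and> X i <+>\<^bsub>M\<^esub> B \<noteq> X (Suc i) <+>\<^bsub>M\<^esub> B}"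
    have stX: "stable_sub Z M (X i)" if "i \<le> n" for i using X that by (auto simp: chain_def)
    have "i \<in> ?I \<union> ?J" if "i < n" for i
    proof (rule ccontr)
      assume "i \<notin> ?I \<union> ?J"
      then have "X i = X (Suc i)" using X that by (intro modular[OF stX stX st(2)]) (auto simp: chain_def)
      then show False using X that by (auto simp: chain_def)
    qed
    then have "{..<n} \<subseteq> ?I \<union> ?J" by auto
    then have "n \<le> card (?I \<union> ?J)" using card_mono[of "?I \<union> ?J" "{..<n}"] by simp
    also have "\<dots> \<le> card ?I + card ?J" by (rule card_Un_le)
    finally have "enat n \<le> enat (card ?I) + enat (card ?J)" by simp
    also have "enat (card ?I) \<le> rlen Z M A B"
      using X sub st by (intro weak_chain) (auto simp: chain_def intro!: stable_Int)
    also have "enat (card ?J) \<le> rlen Z M B E"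
    proof (rule weak_chain)
      fix i assume i: "i \<le> n"
      have "h \<oplus>\<^bsub>M\<^esub> g \<in> E" if "h \<in> X i" "g \<in> B" for h g
        using stableD(3)[OF stE, of h g] that chainD(3)[OF X i] sub(2) by blast
      then have "X i <+>\<^bsub>M\<^esub> B \<subseteq> E" unfolding subset_iff set_add_iff by blast
      then show "stable_sub Z M (X i <+>\<^bsub>M\<^esub> B) \<and> B \<subseteq> X i <+>\<^bsub>M\<^esub> B \<and> X i <+>\<^bsub>M\<^esub> B \<subseteq> E"
        using stable_set_add[OF stX[OF i] st(2) Z] set_add_upper[OF stX[OF i] st(2)] by blast
    next
      fix i assume i: "i < n"
      then show "X i <+>\<^bsub>M\<^esub> B \<subseteq> X (Suc i) <+>\<^bsub>M\<^esub> B" using chainD(4)[OF X i] unfolding subset_iff set_add_iff by blast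
    qed
    finally show "enat n \<le> rlen Z M A B + rlen Z M B E" by (simp add: add_mono)
  qed
next
  show "rlen Z M A B + rlen Z M B E \<le> rlen Z M A E"
  proof (cases "rlen Z M A E = \<infinity>")
    case False
    have "rlen Z M A B \<le> rlen Z M A E" "rlen Z M B E \<le> rlen Z M A E" using sub by (auto intro!: rlen_mono)
    then have "rlen Z M A B \<noteq> \<infinity>" "rlen Z M B E \<noteq> \<infinity>" using False by (metis enat_ord_simps(5) not_infinity_eq)+
    then obtain C n D m where *: "chain Z M A B C n" "rlen Z M A B = enat n" "chain Z M B E D m" "rlen Z M B E = enat m"
      using rlen_attained st sub by metis
    then show ?thesis using chain_append[OF *(1,3) sub] rlen_geI by (metis plus_enat_simps(1))
  qed simp
qed

lemma rlen_self: "rlen Z M A A = 0"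
proof -
  have "rlen Z M A A \<le> 0"
  proof (rule rlen_leI)
    fix C n assume *: "chain Z M A A C n"
    have "n = 0" 
    proof (rule ccontr)
      assume "n \<noteq> 0"
      then have "0 \<le> n" "1 \<le> n" "0 < n" by auto
      then show False using chainD[OF *, of 0] chainD(2,3)[OF *, of 1] by auto
    qed
    then show "enat n \<le> 0" by (simp add: zero_enat_def)
  qed
  then show ?thesis by simp
qed

lemma rlen_pos:
  assumes "stable_sub Z M A" "stable_sub Z M B" "A \<subset> B"
  shows "rlen Z M A B \<ge> 1"
proof -
  have "chain Z M A B (\<lambda>i. if i = 0 then A else B) 1" using assms by (auto simp: chain_def)
  from rlen_geI[OF this] show ?thesis by (simp add: one_enat_def)
qed

lemma rlen_simple:
  assumes "\<And>H. stable_sub Z M H \<Longrightarrow> A \<subseteq> H \<Longrightarrow> H \<subseteq> B \<Longrightarrow> H = A \<or> H = B"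
  shows "rlen Z M A B \<le> 1"
proof (rule rlen_leI)
  fix C n assume *: "chain Z M A B C n"
  have "n \<le> 1"
  proof (rule ccontr)
    assume "\<not> n \<le> 1"
    then have i: "0 \<le> n" "1 \<le> n" "2 \<le> n" "0 < n" "1 < n" by auto
    then have "C 0 \<subset> C 1" "C 1 \<subset> C 2" using * unfolding chain_def by (auto simp: numeral_2_eq_2)
    moreover have "C 1 = A \<or> C 1 = B" "A \<subseteq> C 0" "C 2 \<subseteq> B" using * i assms unfolding chain_def by auto
    ultimately show False by auto
  qed
  then show "enat n \<le> 1" by (simp add: one_enat_def)
qed

lemma rlen_eq_imp_eq:
  assumes "stable_sub Z M A" "stable_sub Z M B" "stable_sub Z M E" "Z \<subseteq> carrier R" "A \<subseteq> B" "B \<subseteq> E"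
    and "rlen Z M A B = rlen Z M A E" "rlen Z M A E \<noteq> \<infinity>"
  shows "B = E"
proof (rule ccontr)
  assume "B \<noteq> E"
  then have "rlen Z M B E \<ge> 1" using assms by (intro rlen_pos) auto
  moreover obtain k where "rlen Z M A E = enat k" using assms(8) by auto
  moreover have "rlen Z M A E = rlen Z M A B + rlen Z M B E" by (rule rlen_add) fact+
  ultimately show False unfolding assms(7) by (cases "rlen Z M B E") (auto simp: one_enat_def)
qed

end

lemma lin_stable_image:
  assumes "left_module R M" "left_module R N" "Z \<subseteq> carrier R" and f: "lin Z M N H f" and H: "stable_sub Z M H"
  shows "f \<zero>\<^bsub>M\<^esub> = \<zero>\<^bsub>N\<^esub>" "x \<in> H \<Longrightarrow> f (\<ominus>\<^bsub>M\<^esub> x) = \<ominus>\<^bsub>N\<^esub> f x"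
    "\<And>G. stable_sub Z M G \<Longrightarrow> G \<subseteq> H \<Longrightarrow> stable_sub Z N (f ` G)"
    "\<And>G. stable_sub Z N G \<Longrightarrow> stable_sub Z M {x \<in> H. f x \<in> G}"
proof -
  interpret M: left_module R M by fact
  interpret N: left_module R N by fact
  have cl: "\<And>x. x \<in> H \<Longrightarrow> f x \<in> carrier N" and ad: "\<And>x y. x \<in> H \<Longrightarrow> y \<in> H \<Longrightarrow> f (x \<oplus>\<^bsub>M\<^esub> y) = f x \<oplus>\<^bsub>N\<^esub> f y"
    and sm: "\<And>z x. z \<in> Z \<Longrightarrow> x \<in> H \<Longrightarrow> f (z \<odot>\<^bsub>M\<^esub> x) = z \<odot>\<^bsub>N\<^esub> f x"
    using f by (auto simp: lin_def)
  have "f \<zero>\<^bsub>M\<^esub> \<oplus>\<^bsub>N\<^esub> f \<zero>\<^bsub>M\<^esub> = f \<zero>\<^bsub>M\<^esub>" using ad[of "\<zero>\<^bsub>M\<^esub>" "\<zero>\<^bsub>M\<^esub>"] stableD(2)[OF H] by simp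
  then show z: "f \<zero>\<^bsub>M\<^esub> = \<zero>\<^bsub>N\<^esub>" using cl stableD(2)[OF H] N.M.add.l_cancel_one by blast
  show ng: "f (\<ominus>\<^bsub>M\<^esub> x) = \<ominus>\<^bsub>N\<^esub> f x" if "x \<in> H" for x
    using ad[of "\<ominus>\<^bsub>M\<^esub> x" x] z cl that M.stable_neg[OF H that] stableD(5)[OF H that]
    by (metis M.M.l_neg N.M.minus_equality)
  show "stable_sub Z N (f ` G)" if "stable_sub Z M G" "G \<subseteq> H" for G
  proof (rule N.stableI)
    show "f ` G \<subseteq> carrier N" using cl that by auto
    show "\<zero>\<^bsub>N\<^esub> \<in> f ` G" using stableD(2)[OF that(1)] z by force
  next
    fix x y assume "x \<in> f ` G" "y \<in> f ` G"
    then obtain a b where *: "a \<in> G" "x = f a" "b \<in> G" "y = f b" by blast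
    then have "f (a \<oplus>\<^bsub>M\<^esub> b) = x \<oplus>\<^bsub>N\<^esub> y" using ad that(2) by auto
    then show "x \<oplus>\<^bsub>N\<^esub> y \<in> f ` G" using * stableD(3)[OF that(1)] by (metis imageI)
  next
    fix x assume "x \<in> f ` G"
    then obtain a where a: "a \<in> G" "x = f a" by blast
    then have "\<ominus>\<^bsub>N\<^esub> x = f (\<ominus>\<^bsub>M\<^esub> a)" using ng[of a] that(2) by auto
    then show "\<ominus>\<^bsub>N\<^esub> x \<in> f ` G" using M.stable_neg[OF that(1) a(1)] by blast
  next
    fix z x assume z: "z \<in> Z" and "x \<in> f ` G"
    then obtain a where a: "a \<in> G" "x = f a" by blast
    then have "z \<odot>\<^bsub>N\<^esub> x = f (z \<odot>\<^bsub>M\<^esub> a)" using sm[OF z, of a] that(2) by auto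
    then show "z \<odot>\<^bsub>N\<^esub> x \<in> f ` G" using stableD(4)[OF that(1) z a(1)] by blast
  qed
  show "stable_sub Z M {x \<in> H. f x \<in> G}" if G: "stable_sub Z N G" for G
    by (rule M.stableI) (use stableD(1-4)[OF H] M.stable_neg[OF H] N.stable_neg[OF G] stableD(2-4)[OF G] z ng ad sm in auto)
qed

lemma lin_subset: "lin Z M N H f \<Longrightarrow> G \<subseteq> H \<Longrightarrow> lin Z M N G f"
  unfolding lin_def by blast

text \<open>
  The correspondence between submodules of an image and submodules that contain the kernel.
\<close>

lemma rlen_image:
  assumes lm: "left_module R M" "left_module R N" "Z \<subseteq> carrier R" and f: "lin Z M N H f" and H: "stable_sub Z M H"
  shows "rlen Z M {x \<in> H. f x = \<zero>\<^bsub>N\<^esub>} H = len Z N (f ` H)"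
proof (rule antisym)
  interpret M: left_module R M by fact
  interpret N: left_module R N by fact
  note im = lin_stable_image[OF lm f H]
  let ?K = "{x \<in> H. f x = \<zero>\<^bsub>N\<^esub>}"
  have K: "stable_sub Z M ?K" using im(4)[OF N.stable_zero[OF lm(3)]] by simp
  show "rlen Z M ?K H \<le> len Z N (f ` H)"
  proof (rule rlen_leI)
    fix C n assume C: "chain Z M ?K H C n"
    have inv: "x \<in> C i" if "x \<in> H" "f x \<in> f ` C i" "i \<le> n" for i x
    proof -
      have st: "stable_sub Z M (C i)" "?K \<subseteq> C i" "C i \<subseteq> H" using C that by (auto simp: chain_def)
      obtain y where y: "y \<in> C i" "f x = f y" using \<open>f x \<in> f ` C i\<close> by blast
      then have yH: "y \<in> H" using st by blast
      have c: "x \<in> carrier M" "y \<in> carrier M" using that yH stableD(5)[OF H] by auto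
      have "f (x \<ominus>\<^bsub>M\<^esub> y) = f x \<oplus>\<^bsub>N\<^esub> \<ominus>\<^bsub>N\<^esub> f y"
        using f that(1) yH M.stable_neg[OF H yH] im(2)[OF yH] by (simp add: lin_def a_minus_def)
      also have "\<dots> = \<zero>\<^bsub>N\<^esub>" using y f yH by (simp add: lin_def N.M.r_neg Pi_iff)
      finally have "x \<ominus>\<^bsub>M\<^esub> y \<in> C i" using st(2) M.stable_minus[OF H that(1) yH] by blast
      then have "(x \<ominus>\<^bsub>M\<^esub> y) \<oplus>\<^bsub>M\<^esub> y \<in> C i" using y st stableD(3) by metis
      then show "x \<in> C i" using c by (simp add: a_minus_def M.a_assoc M.l_neg)
    qed
    have "chain Z N {\<zero>\<^bsub>N\<^esub>} (f ` H) (\<lambda>i. f ` C i) n"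
      unfolding chain_def
    proof (intro conjI allI impI)
      fix i assume i: "i \<le> n"
      then show "stable_sub Z N (f ` C i)" by (intro im(3) chainD[OF C])
      then show "{\<zero>\<^bsub>N\<^esub>} \<subseteq> f ` C i" by (auto dest: stableD(2))
      show "f ` C i \<subseteq> f ` H" using chainD(3)[OF C i] by blast
    next
      fix i assume i: "i < n"
      then have "C i \<subset> C (Suc i)" "C (Suc i) \<subseteq> H" using chainD(4)[OF C i] chainD(3)[OF C, of "Suc i"] by auto
      then obtain x where x: "x \<in> C (Suc i)" "x \<notin> C i" "x \<in> H" by blast
      then have "f x \<notin> f ` C i" using inv[OF x(3), of i] i by auto
      then show "f ` C i \<subset> f ` C (Suc i)" using x(1) \<open>C i \<subset> C (Suc i)\<close> by blast
    qed
    then show "enat n \<le> len Z N (f ` H)" by (rule rlen_geI)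
  qed
  show "len Z N (f ` H) \<le> rlen Z M ?K H"
  proof (rule rlen_leI)
    fix D n assume D: "chain Z N {\<zero>\<^bsub>N\<^esub>} (f ` H) D n"
    let ?P = "\<lambda>i. {x \<in> H. f x \<in> D i}"
    have "?P i \<subset> ?P (Suc i)" if "i < n" for i
    proof -
      have D': "D i \<subset> D (Suc i)" "D (Suc i) \<subseteq> f ` H" using chainD(4)[OF D that] chainD(3)[OF D, of "Suc i"] that by auto
      then obtain x where "x \<in> H" "f x \<in> D (Suc i)" "f x \<notin> D i" by blast
      then show ?thesis using D'(1) by blast
    qed
    moreover have "stable_sub Z M (?P i)" "?K \<subseteq> ?P i" if "i \<le> n" for i
      by (rule im(4)[OF chainD(1)[OF D that]], use chainD(2)[OF D that] in auto)
    ultimately have "chain Z M ?K H ?P n" unfolding chain_def by auto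
    then show "enat n \<le> rlen Z M ?K H" by (rule rlen_geI)
  qed
qed

lemma rank_nullity:
  assumes lm: "left_module R M" "left_module R N" "Z \<subseteq> carrier R" and f: "lin Z M N H f" and H: "stable_sub Z M H"
  shows "len Z M H = len Z M {x \<in> H. f x = \<zero>\<^bsub>N\<^esub>} + len Z N (f ` H)"
proof -
  interpret M: left_module R M by fact
  interpret N: left_module R N by fact
  note im = lin_stable_image[OF lm f H]
  have "stable_sub Z M {x \<in> H. f x = \<zero>\<^bsub>N\<^esub>}" using im(4)[OF N.stable_zero[OF lm(3)]] by simp
  then have "len Z M H = len Z M {x \<in> H. f x = \<zero>\<^bsub>N\<^esub>} + rlen Z M {x \<in> H. f x = \<zero>\<^bsub>N\<^esub>} H"
    by (intro M.rlen_add M.stable_zero lm(3) H) (auto dest: stableD(2))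
  then show ?thesis unfolding rlen_image[OF assms] .
qed

lemma len_inj:
  assumes lm: "left_module R M" "left_module R N" "Z \<subseteq> carrier R" and f: "lin Z M N H f" and H: "stable_sub Z M H"
    and inj: "\<And>x. x \<in> H \<Longrightarrow> f x = \<zero>\<^bsub>N\<^esub> \<Longrightarrow> x = \<zero>\<^bsub>M\<^esub>"
  shows "len Z M H = len Z N (f ` H)"
proof -
  interpret M: left_module R M by fact
  have "{x \<in> H. f x = \<zero>\<^bsub>N\<^esub>} = {\<zero>\<^bsub>M\<^esub>}"
    using inj lin_stable_image(1)[OF lm f H] stableD(2)[OF H] by blast
  then show ?thesis using rlen_image[OF lm f H] by simp
qed

section \<open>Homomorphisms and function modules\<close>

lemma mod_homD:
  assumes "f \<in> mod_hom R M N"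
  shows "x \<in> carrier M \<Longrightarrow> f x \<in> carrier N"
    "x \<in> carrier M \<Longrightarrow> y \<in> carrier M \<Longrightarrow> f (x \<oplus>\<^bsub>M\<^esub> y) = f x \<oplus>\<^bsub>N\<^esub> f y"
    "a \<in> carrier R \<Longrightarrow> x \<in> carrier M \<Longrightarrow> f (a \<odot>\<^bsub>M\<^esub> x) = a \<odot>\<^bsub>N\<^esub> f x"
    "x \<notin> carrier M \<Longrightarrow> f x = undefined"
  using assms unfolding mod_hom_def by (auto simp: PiE_iff extensional_def)

lemma mod_homI:
  assumes "\<And>x. x \<in> carrier M \<Longrightarrow> f x \<in> carrier N"
    "\<And>x y. x \<in> carrier M \<Longrightarrow> y \<in> carrier M \<Longrightarrow> f (x \<oplus>\<^bsub>M\<^esub> y) = f x \<oplus>\<^bsub>N\<^esub> f y"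
    "\<And>a x. a \<in> carrier R \<Longrightarrow> x \<in> carrier M \<Longrightarrow> f (a \<odot>\<^bsub>M\<^esub> x) = a \<odot>\<^bsub>N\<^esub> f x"
    "\<And>x. x \<notin> carrier M \<Longrightarrow> f x = undefined"
  shows "f \<in> mod_hom R M N"
  using assms unfolding mod_hom_def by (auto simp: PiE_iff extensional_def)

lemma mod_hom_eqI:
  "f \<in> mod_hom R M N \<Longrightarrow> g \<in> mod_hom R M N' \<Longrightarrow> (\<And>x. x \<in> carrier M \<Longrightarrow> f x = g x) \<Longrightarrow> f = g"
  by (metis mod_homD(4) ext)

lemma mod_hom_lin: "f \<in> mod_hom R M N \<Longrightarrow> Z \<subseteq> carrier R \<Longrightarrow> lin Z M N (carrier M) f"
  unfolding lin_def mod_hom_def by auto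

lemma mod_hom_arith:
  assumes "left_module R M" "left_module R N" "f \<in> mod_hom R M N"
  shows "f \<zero>\<^bsub>M\<^esub> = \<zero>\<^bsub>N\<^esub>" "x \<in> carrier M \<Longrightarrow> f (\<ominus>\<^bsub>M\<^esub> x) = \<ominus>\<^bsub>N\<^esub> f x"
    "x \<in> carrier M \<Longrightarrow> y \<in> carrier M \<Longrightarrow> f (x \<ominus>\<^bsub>M\<^esub> y) = f x \<ominus>\<^bsub>N\<^esub> f y"
proof -
  interpret M: left_module R M by fact
  note im = lin_stable_image[OF assms(1,2) _ mod_hom_lin[OF assms(3)] M.stable_carrier, of "{}"]
  show "f \<zero>\<^bsub>M\<^esub> = \<zero>\<^bsub>N\<^esub>" "x \<in> carrier M \<Longrightarrow> f (\<ominus>\<^bsub>M\<^esub> x) = \<ominus>\<^bsub>N\<^esub> f x" for x using im(1,2) by auto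
  then show "x \<in> carrier M \<Longrightarrow> y \<in> carrier M \<Longrightarrow> f (x \<ominus>\<^bsub>M\<^esub> y) = f x \<ominus>\<^bsub>N\<^esub> f y"
    unfolding a_minus_def using mod_homD(2)[OF assms(3)] by simp
qed

lemma mod_hom_compose:
  "f \<in> mod_hom R M N \<Longrightarrow> g \<in> mod_hom R N P \<Longrightarrow> compose (carrier M) g f \<in> mod_hom R M P"
  if "left_module R M"
proof -
  interpret left_module R M by fact
  assume f: "f \<in> mod_hom R M N" and g: "g \<in> mod_hom R N P"
  show "compose (carrier M) g f \<in> mod_hom R M P"
    by (intro mod_homI) (auto simp: compose_def mod_homD(1-3)[OF f] mod_homD(1-3)[OF g] smult_closed)
qed

definition mod_id :: "('a, 'b, 'm) module_scheme \<Rightarrow> 'b \<Rightarrow> 'b" where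
  "mod_id M = (\<lambda>x\<in>carrier M. x)"

lemma mod_id_hom: "left_module R M \<Longrightarrow> mod_id M \<in> mod_hom R M M"
proof -
  assume "left_module R M"
  then interpret left_module R M .
  show ?thesis by (intro mod_homI) (auto simp: mod_id_def smult_closed)
qed

definition fun_mod :: "'i set \<Rightarrow> ('a, 'b, 'm) module_scheme \<Rightarrow> ('a, 'i \<Rightarrow> 'b) module" where
  "fun_mod S X = \<lparr>carrier = S \<rightarrow>\<^sub>E carrier X, mult = undefined, one = undefined,
     zero = (\<lambda>i\<in>S. \<zero>\<^bsub>X\<^esub>), add = (\<lambda>f g. \<lambda>i\<in>S. f i \<oplus>\<^bsub>X\<^esub> g i), smult = (\<lambda>a f. \<lambda>i\<in>S. a \<odot>\<^bsub>X\<^esub> f i)\<rparr>"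

lemma fun_mod_simps [simp]:
  "carrier (fun_mod S X) = S \<rightarrow>\<^sub>E carrier X" "\<zero>\<^bsub>fun_mod S X\<^esub> = (\<lambda>i\<in>S. \<zero>\<^bsub>X\<^esub>)"
  "f \<oplus>\<^bsub>fun_mod S X\<^esub> g = (\<lambda>i\<in>S. f i \<oplus>\<^bsub>X\<^esub> g i)" "a \<odot>\<^bsub>fun_mod S X\<^esub> f = (\<lambda>i\<in>S. a \<odot>\<^bsub>X\<^esub> f i)"
  by (simp_all add: fun_mod_def)

lemma left_moduleI:
  assumes "ring R" and cl: "\<And>x y. x \<in> carrier M \<Longrightarrow> y \<in> carrier M \<Longrightarrow> x \<oplus>\<^bsub>M\<^esub> y \<in> carrier M"
    and "\<zero>\<^bsub>M\<^esub> \<in> carrier M"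
    and "\<And>x y z. x \<in> carrier M \<Longrightarrow> y \<in> carrier M \<Longrightarrow> z \<in> carrier M \<Longrightarrow> (x \<oplus>\<^bsub>M\<^esub> y) \<oplus>\<^bsub>M\<^esub> z = x \<oplus>\<^bsub>M\<^esub> (y \<oplus>\<^bsub>M\<^esub> z)"
    and "\<And>x y. x \<in> carrier M \<Longrightarrow> y \<in> carrier M \<Longrightarrow> x \<oplus>\<^bsub>M\<^esub> y = y \<oplus>\<^bsub>M\<^esub> x"
    and "\<And>x. x \<in> carrier M \<Longrightarrow> \<zero>\<^bsub>M\<^esub> \<oplus>\<^bsub>M\<^esub> x = x"
    and "\<And>x. x \<in> carrier M \<Longrightarrow> \<exists>y\<in>carrier M. y \<oplus>\<^bsub>M\<^esub> x = \<zero>\<^bsub>M\<^esub>"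
    and "\<And>a x. a \<in> carrier R \<Longrightarrow> x \<in> carrier M \<Longrightarrow> a \<odot>\<^bsub>M\<^esub> x \<in> carrier M"
    and "\<And>a b x. a \<in> carrier R \<Longrightarrow> b \<in> carrier R \<Longrightarrow> x \<in> carrier M \<Longrightarrow> (a \<oplus>\<^bsub>R\<^esub> b) \<odot>\<^bsub>M\<^esub> x = a \<odot>\<^bsub>M\<^esub> x \<oplus>\<^bsub>M\<^esub> b \<odot>\<^bsub>M\<^esub> x"
    and "\<And>a x y. a \<in> carrier R \<Longrightarrow> x \<in> carrier M \<Longrightarrow> y \<in> carrier M \<Longrightarrow> a \<odot>\<^bsub>M\<^esub> (x \<oplus>\<^bsub>M\<^esub> y) = a \<odot>\<^bsub>M\<^esub> x \<oplus>\<^bsub>M\<^esub> a \<odot>\<^bsub>M\<^esub> y"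
    and "\<And>a b x. a \<in> carrier R \<Longrightarrow> b \<in> carrier R \<Longrightarrow> x \<in> carrier M \<Longrightarrow> (a \<otimes>\<^bsub>R\<^esub> b) \<odot>\<^bsub>M\<^esub> x = a \<odot>\<^bsub>M\<^esub> (b \<odot>\<^bsub>M\<^esub> x)"
    and "\<And>x. x \<in> carrier M \<Longrightarrow> \<one>\<^bsub>R\<^esub> \<odot>\<^bsub>M\<^esub> x = x"
  shows "left_module R M"
proof -
  have "abelian_group M" by (rule abelian_groupI) (use assms in auto)
  then show ?thesis unfolding left_module_def left_module_axioms_def using assms by auto
qed

lemma left_module_fun_mod:
  assumes "left_module R X"
  shows "left_module R (fun_mod S X)"
proof -
  interpret left_module R X by fact
  have inv: "\<exists>y\<in>S \<rightarrow>\<^sub>E carrier X. (\<lambda>i\<in>S. y i \<oplus>\<^bsub>X\<^esub> x i) = (\<lambda>i\<in>S. \<zero>\<^bsub>X\<^esub>)" if "x \<in> S \<rightarrow>\<^sub>E carrier X" for x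
    by (rule bexI[of _ "\<lambda>i\<in>S. \<ominus>\<^bsub>X\<^esub> x i"]) (use that in \<open>auto simp: fun_eq_iff M.l_neg PiE_iff\<close>)
  show ?thesis
    by (rule left_moduleI)
       (use inv in \<open>auto simp: R.ring_axioms M.a_ac smult_closed smult_l_distr smult_r_distr smult_assoc smult_one
          PiE_iff extensional_def fun_eq_iff Pi_iff\<close>)
qed

lemma left_module_restrict:
  assumes "left_module R M" "stable_sub (carrier R) M H"
  shows "left_module R (M\<lparr>carrier := H\<rparr>)"
proof -
  interpret left_module R M by fact
  note H = stableD[OF assms(2)]
  have inv: "\<exists>y\<in>H. y \<oplus>\<^bsub>M\<^esub> x = \<zero>\<^bsub>M\<^esub>" if "x \<in> H" for x
    using stable_neg[OF assms(2) that] M.l_neg[OF H(5)[OF that]] by blast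
  show ?thesis
    by (rule left_moduleI)
       (use H inv in \<open>auto simp: R.ring_axioms M.a_ac smult_l_distr smult_r_distr smult_assoc smult_one\<close>)
qed

lemma restrict_hom_iff:
  "f \<in> mod_hom R Y (X\<lparr>carrier := H\<rparr>) \<longleftrightarrow> f \<in> mod_hom R Y X \<and> (\<forall>y\<in>carrier Y. f y \<in> H)" if "H \<subseteq> carrier X"
  using that unfolding mod_hom_def by (auto simp: PiE_iff)

lemma restrict_dom_hom:
  assumes "f \<in> mod_hom R Y X" "H \<subseteq> carrier Y" "left_module R (Y\<lparr>carrier := H\<rparr>)"
  shows "restrict f H \<in> mod_hom R (Y\<lparr>carrier := H\<rparr>) X"
proof -
  interpret H: left_module R "Y\<lparr>carrier := H\<rparr>" by fact
  have "x \<oplus>\<^bsub>Y\<^esub> y \<in> H" "a \<in> carrier R \<Longrightarrow> a \<odot>\<^bsub>Y\<^esub> x \<in> H" if "x \<in> H" "y \<in> H" for x y a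
    using H.M.a_closed[of x y] H.smult_closed[of a x] that by auto
  then show ?thesis using assms(2) by (intro mod_homI) (auto simp: mod_homD(1-3)[OF assms(1)] subset_iff)
qed

lemma enat_le_finite: "(a :: enat) \<le> b \<Longrightarrow> b \<noteq> \<infinity> \<Longrightarrow> a \<noteq> \<infinity>"
  by (metis enat_ord_simps(5))

text \<open>
  The set \<open>Z\<close> must be central so that multiplication by its elements preserves spaces of homomorphisms.
\<close>

locale central_ops = ring R for R :: "('a, 'r) ring_scheme" (structure) +
  fixes Z :: "'a set"
  assumes Z_sub: "Z \<subseteq> carrier R"
    and Z_central: "z \<in> Z \<Longrightarrow> a \<in> carrier R \<Longrightarrow> z \<otimes> a = a \<otimes> z"
begin

definition hom_len :: "('a, 'b, 'm) module_scheme \<Rightarrow> ('a, 'c, 'n) module_scheme \<Rightarrow> enat" where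
  "hom_len Y X = len Z (fun_mod (carrier Y) X) (mod_hom R Y X)"

definition zfinite :: "('a, 'b, 'm) module_scheme \<Rightarrow> bool" where
  "zfinite M \<longleftrightarrow> len Z M (carrier M) \<noteq> \<infinity>"

lemma ZR: "z \<in> Z \<Longrightarrow> z \<in> carrier R" using Z_sub by blast

lemma mod_hom_stable:
  assumes "left_module R Y" "left_module R X"
  shows "stable_sub Z (fun_mod (carrier Y) X) (mod_hom R Y X)"
proof -
  interpret Y: left_module R Y by fact
  interpret X: left_module R X by fact
  let ?F = "fun_mod (carrier Y) X"
  interpret F: left_module R ?F by (rule left_module_fun_mod) fact
  have neg: "\<exists>g\<in>mod_hom R Y X. f \<oplus>\<^bsub>?F\<^esub> g = \<zero>\<^bsub>?F\<^esub>" if f: "f \<in> mod_hom R Y X" for f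
    by (rule bexI[of _ "\<lambda>y\<in>carrier Y. \<ominus>\<^bsub>X\<^esub> f y"])
       (auto intro!: mod_homI simp: mod_homD(1-3)[OF f] X.M.r_neg X.M.minus_add X.M.a_ac Y.smult_closed X.smult_neg fun_eq_iff)
  have sm: "a \<odot>\<^bsub>X\<^esub> (b \<odot>\<^bsub>X\<^esub> x) = b \<odot>\<^bsub>X\<^esub> (a \<odot>\<^bsub>X\<^esub> x)" if "a \<in> Z" "b \<in> carrier R" "x \<in> carrier X" for a b x
    using X.smult_assoc[of a b x] X.smult_assoc[of b a x] Z_central[of a b] that ZR by auto
  show ?thesis unfolding stable_sub_def
  proof (intro conjI ballI neg)
    show "mod_hom R Y X \<subseteq> carrier ?F" by (auto simp: mod_hom_def)
    show "\<zero>\<^bsub>?F\<^esub> \<in> mod_hom R Y X" by (intro mod_homI) (auto simp: X.smult_zero Y.smult_closed)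
  next
    fix f g assume f: "f \<in> mod_hom R Y X" and g: "g \<in> mod_hom R Y X"
    show "f \<oplus>\<^bsub>?F\<^esub> g \<in> mod_hom R Y X"
      by (intro mod_homI) (auto simp: mod_homD(1-3)[OF f] mod_homD(1-3)[OF g] X.M.a_ac X.smult_r_distr Y.smult_closed)
  next
    fix z f assume z: "z \<in> Z" and f: "f \<in> mod_hom R Y X"
    show "z \<odot>\<^bsub>?F\<^esub> f \<in> mod_hom R Y X" using z
      by (intro mod_homI) (auto simp: mod_homD(1-3)[OF f] X.smult_r_distr X.smult_closed Y.smult_closed ZR sm)
  qed
qed

lemma precomp_lin:
  assumes "left_module R Y'" "g \<in> mod_hom R Y' Y" "left_module R Y"
  shows "lin Z (fun_mod (carrier Y) X) (fun_mod (carrier Y') X) (mod_hom R Y X) (\<lambda>f. compose (carrier Y') f g)"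
proof -
  interpret Y': left_module R Y' by fact
  have "compose (carrier Y') f g \<in> carrier (fun_mod (carrier Y') X)" if "f \<in> mod_hom R Y X" for f
    using that by (auto simp: compose_def mod_homD(1)[OF assms(2)] mod_homD(1)[OF that])
  then show ?thesis unfolding lin_def
    by (auto simp: compose_def mod_homD(1)[OF assms(2)] fun_eq_iff)
qed

lemma postcomp_lin:
  assumes "left_module R X'" "h \<in> mod_hom R X X'"
  shows "lin Z (fun_mod (carrier Y) X) (fun_mod (carrier Y) X') (mod_hom R Y X) (\<lambda>f. compose (carrier Y) h f)"
proof -
  have cl: "f y \<in> carrier X" if "f \<in> mod_hom R Y X" "y \<in> carrier Y" for f y using mod_homD(1)[OF that] .
  show ?thesis unfolding lin_def
    using mod_homD(1-3)[OF assms(2)] by (auto simp: compose_def fun_eq_iff ZR cl)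
qed

lemma len_mono: "H \<subseteq> G \<Longrightarrow> len Z M H \<le> len Z M G"
  by (rule rlen_mono) auto

section \<open>The pencil of two maps\<close>

text \<open>
  The homomorphisms that factor through the cokernel of \<open>f\<close>.
\<close>

definition annih :: "('a, 'u, 'ux) module_scheme \<Rightarrow> ('a, 'v, 'vx) module_scheme \<Rightarrow> ('a, 'x, 'xx) module_scheme \<Rightarrow> ('u \<Rightarrow> 'v) \<Rightarrow> ('v \<Rightarrow> 'x) set" where
  "annih U V X f = {\<phi> \<in> mod_hom R V X. \<forall>u\<in>carrier U. \<phi> (f u) = \<zero>\<^bsub>X\<^esub>}"

text \<open>
  Sequences are indexed by all natural numbers and vanish from \<open>n\<close> on. For \<open>I = UNIV\<close> the relation at
  \<open>i = n - 1\<close> also says that the last term kills the image of \<open>f\<close>; for \<open>I = {..<n - 1}\<close> it does not.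
\<close>

definition pencil :: "('a, 'u, 'ux) module_scheme \<Rightarrow> ('a, 'v, 'vx) module_scheme \<Rightarrow> ('a, 'x, 'xx) module_scheme \<Rightarrow> ('u \<Rightarrow> 'v) \<Rightarrow> ('u \<Rightarrow> 'v) \<Rightarrow> nat set \<Rightarrow> nat \<Rightarrow> (nat \<Rightarrow> 'v \<Rightarrow> 'x) set" where
  "pencil U V X f f' I n = {\<phi>. (\<forall>i. \<phi> i \<in> mod_hom R V X) \<and> (\<forall>i\<ge>n. \<phi> i = (\<lambda>v\<in>carrier V. \<zero>\<^bsub>X\<^esub>)) \<and>
     (\<forall>i\<in>I. \<forall>u\<in>carrier U. \<phi> i (f u) \<oplus>\<^bsub>X\<^esub> \<phi> (Suc i) (f' u) = \<zero>\<^bsub>X\<^esub>)}"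

lemma pencil_stable:
  assumes "left_module R U" "left_module R V" "left_module R X" "f \<in> mod_hom R U V" "f' \<in> mod_hom R U V"
  shows "stable_sub Z (fun_mod UNIV (fun_mod (carrier V) X)) (pencil U V X f f' I n)"
proof -
  interpret U: left_module R U by fact
  interpret V: left_module R V by fact
  interpret X: left_module R X by fact
  let ?F = "fun_mod (carrier V) X"
  interpret F: left_module R ?F by (rule left_module_fun_mod) fact
  interpret N: left_module R "fun_mod UNIV ?F" by (rule left_module_fun_mod) (rule F.left_module_axioms)
  note st = mod_hom_stable[OF assms(2,3)]
  have Fneg: "\<ominus>\<^bsub>?F\<^esub> g = (\<lambda>v\<in>carrier V. \<ominus>\<^bsub>X\<^esub> g v)" if "g \<in> mod_hom R V X" for g
    by (rule F.M.minus_equality) (use that in \<open>auto simp: fun_eq_iff X.M.l_neg mod_homD(1)[OF that] mod_hom_def\<close>)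
  have neg: "\<exists>\<psi>\<in>pencil U V X f f' I n. \<phi> \<oplus>\<^bsub>fun_mod UNIV ?F\<^esub> \<psi> = \<zero>\<^bsub>fun_mod UNIV ?F\<^esub>"
    if p: "\<phi> \<in> pencil U V X f f' I n" for \<phi>
  proof (rule bexI)
    have ph: "\<phi> i \<in> mod_hom R V X" for i using p by (auto simp: pencil_def)
    show "\<phi> \<oplus>\<^bsub>fun_mod UNIV ?F\<^esub> (\<lambda>i. \<lambda>v\<in>carrier V. \<ominus>\<^bsub>X\<^esub> \<phi> i v) = \<zero>\<^bsub>fun_mod UNIV ?F\<^esub>"
      by (auto simp: fun_eq_iff X.M.r_neg mod_homD(1)[OF ph])
    have rel: "(\<ominus>\<^bsub>X\<^esub> \<phi> i (f u)) \<oplus>\<^bsub>X\<^esub> (\<ominus>\<^bsub>X\<^esub> \<phi> (Suc i) (f' u)) = \<zero>\<^bsub>X\<^esub>" if "i \<in> I" "u \<in> carrier U" for i u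
    proof -
      have c: "\<phi> i (f u) \<in> carrier X" "\<phi> (Suc i) (f' u) \<in> carrier X"
        using that mod_homD(1)[OF ph mod_homD(1)[OF assms(4)]] mod_homD(1)[OF ph mod_homD(1)[OF assms(5)]] by blast+
      have "\<phi> i (f u) \<oplus>\<^bsub>X\<^esub> \<phi> (Suc i) (f' u) = \<zero>\<^bsub>X\<^esub>" using p that by (auto simp: pencil_def)
      then show ?thesis using X.M.minus_add[OF c] X.M.minus_equality[of "\<zero>\<^bsub>X\<^esub>" "\<zero>\<^bsub>X\<^esub>"] by simp
    qed
    show "(\<lambda>i. \<lambda>v\<in>carrier V. \<ominus>\<^bsub>X\<^esub> \<phi> i v) \<in> pencil U V X f f' I n"
      using p F.stable_neg[OF st ph] rel mod_homD(1)[OF assms(4)] mod_homD(1)[OF assms(5)]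
      by (auto simp: pencil_def Fneg fun_eq_iff)
  qed
  show ?thesis unfolding stable_sub_def
  proof (intro conjI ballI neg)
    show "pencil U V X f f' I n \<subseteq> carrier (fun_mod UNIV ?F)"
      unfolding pencil_def mod_hom_def by auto
    show "\<zero>\<^bsub>fun_mod UNIV ?F\<^esub> \<in> pencil U V X f f' I n"
      using stableD(2)[OF st] mod_homD(1)[OF assms(4)] mod_homD(1)[OF assms(5)] by (auto simp: pencil_def)
  next
    fix \<phi> \<psi> assume p: "\<phi> \<in> pencil U V X f f' I n" "\<psi> \<in> pencil U V X f f' I n"
    have ph: "\<phi> i \<in> mod_hom R V X" "\<psi> i \<in> mod_hom R V X" for i using p by (auto simp: pencil_def)
    have rel: "(\<phi> i (f u) \<oplus>\<^bsub>X\<^esub> \<psi> i (f u)) \<oplus>\<^bsub>X\<^esub> (\<phi> (Suc i) (f' u) \<oplus>\<^bsub>X\<^esub> \<psi> (Suc i) (f' u)) = \<zero>\<^bsub>X\<^esub>"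
      if "i \<in> I" "u \<in> carrier U" for i u
    proof -
      have c: "\<phi> i (f u) \<in> carrier X" "\<phi> (Suc i) (f' u) \<in> carrier X" "\<psi> i (f u) \<in> carrier X" "\<psi> (Suc i) (f' u) \<in> carrier X"
        using that mod_homD(1)[OF ph(1) mod_homD(1)[OF assms(4)]] mod_homD(1)[OF ph(1) mod_homD(1)[OF assms(5)]]
          mod_homD(1)[OF ph(2) mod_homD(1)[OF assms(4)]] mod_homD(1)[OF ph(2) mod_homD(1)[OF assms(5)]] by blast+
      have "\<phi> i (f u) \<oplus>\<^bsub>X\<^esub> \<phi> (Suc i) (f' u) = \<zero>\<^bsub>X\<^esub>" "\<psi> i (f u) \<oplus>\<^bsub>X\<^esub> \<psi> (Suc i) (f' u) = \<zero>\<^bsub>X\<^esub>"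
        using p that by (auto simp: pencil_def)
      moreover have "(\<phi> i (f u) \<oplus>\<^bsub>X\<^esub> \<psi> i (f u)) \<oplus>\<^bsub>X\<^esub> (\<phi> (Suc i) (f' u) \<oplus>\<^bsub>X\<^esub> \<psi> (Suc i) (f' u)) =
        (\<phi> i (f u) \<oplus>\<^bsub>X\<^esub> \<phi> (Suc i) (f' u)) \<oplus>\<^bsub>X\<^esub> (\<psi> i (f u) \<oplus>\<^bsub>X\<^esub> \<psi> (Suc i) (f' u))"
        using c by (simp add: X.M.a_ac)
      ultimately show ?thesis by simp
    qed
    have "(\<lambda>v\<in>carrier V. \<phi> i v \<oplus>\<^bsub>X\<^esub> \<psi> i v) \<in> mod_hom R V X" for i
      using stableD(3)[OF st ph(1) ph(2), of i i] by simp
    then show "\<phi> \<oplus>\<^bsub>fun_mod UNIV ?F\<^esub> \<psi> \<in> pencil U V X f f' I n"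
      using p rel mod_homD(1)[OF assms(4)] mod_homD(1)[OF assms(5)]
      by (auto simp: pencil_def)
  next
    fix z \<phi> assume z: "z \<in> Z" and p: "\<phi> \<in> pencil U V X f f' I n"
    have ph: "\<phi> i \<in> mod_hom R V X" for i using p by (auto simp: pencil_def)
    have rel: "z \<odot>\<^bsub>X\<^esub> \<phi> i (f u) \<oplus>\<^bsub>X\<^esub> z \<odot>\<^bsub>X\<^esub> \<phi> (Suc i) (f' u) = \<zero>\<^bsub>X\<^esub>" if "i \<in> I" "u \<in> carrier U" for i u
    proof -
      have c: "\<phi> i (f u) \<in> carrier X" "\<phi> (Suc i) (f' u) \<in> carrier X"
        using that mod_homD(1)[OF ph mod_homD(1)[OF assms(4)]] mod_homD(1)[OF ph mod_homD(1)[OF assms(5)]] by blast+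
      have "\<phi> i (f u) \<oplus>\<^bsub>X\<^esub> \<phi> (Suc i) (f' u) = \<zero>\<^bsub>X\<^esub>" using p that by (auto simp: pencil_def)
      then show ?thesis using X.smult_r_distr[OF ZR[OF z] c] X.smult_zero[OF ZR[OF z]] by simp
    qed
    have "(\<lambda>v\<in>carrier V. z \<odot>\<^bsub>X\<^esub> \<phi> i v) \<in> mod_hom R V X" for i
      using stableD(4)[OF st z ph, of i] by simp
    then show "z \<odot>\<^bsub>fun_mod UNIV ?F\<^esub> \<phi> \<in> pencil U V X f f' I n"
      using p rel mod_homD(1)[OF assms(4)] mod_homD(1)[OF assms(5)] X.smult_zero[OF ZR[OF z]]
      by (auto simp: pencil_def fun_eq_iff)
  qed
qed

text \<open>
  Every \<open>\<psi>\<close> with \<open>\<psi> f = 0\<close> is the constant term of a formal power series \<open>\<chi>\<close> with \<open>\<chi> (f + T f') = 0\<close>.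
\<close>

definition lifts :: "('a, 'u, 'ux) module_scheme \<Rightarrow> ('a, 'v, 'vx) module_scheme \<Rightarrow> ('a, 'x, 'xx) module_scheme \<Rightarrow> ('u \<Rightarrow> 'v) \<Rightarrow> ('u \<Rightarrow> 'v) \<Rightarrow> bool" where
  "lifts U V X f f' \<longleftrightarrow> (\<forall>\<psi>\<in>annih U V X f. \<exists>\<chi>. \<chi> (0::nat) = \<psi> \<and> (\<forall>i. \<chi> i \<in> mod_hom R V X) \<and>
     (\<forall>i. \<forall>u\<in>carrier U. \<chi> (Suc i) (f u) \<oplus>\<^bsub>X\<^esub> \<chi> i (f' u) = \<zero>\<^bsub>X\<^esub>))"

lemma eval_lin: "(\<And>\<phi>. \<phi> \<in> P \<Longrightarrow> \<phi> n \<in> carrier X) \<Longrightarrow> lin Z (fun_mod UNIV X) X P (\<lambda>\<phi>. \<phi> n)"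
  unfolding lin_def by auto

text \<open>
  Induction on \<open>n\<close>: the term number \<open>n\<close> of a sequence in \<open>pencil UNIV (Suc n)\<close> kills the image of \<open>f\<close>, the
  sequences where it vanishes form \<open>pencil UNIV n\<close>, and reading a lift backwards shows that each value occurs.
\<close>

lemma pencil_len:
  assumes lm: "left_module R U" "left_module R V" "left_module R X" and f: "f \<in> mod_hom R U V" "f' \<in> mod_hom R U V"
    and l: "lifts U V X f f'"
  shows "len Z (fun_mod UNIV (fun_mod (carrier V) X)) (pencil U V X f f' UNIV n)
     = of_nat n * len Z (fun_mod (carrier V) X) (annih U V X f)"
proof (induction n)
  case 0
  interpret X: left_module R X by fact
  interpret F: left_module R "fun_mod (carrier V) X" by (rule left_module_fun_mod) fact
  interpret N: left_module R "fun_mod (UNIV :: nat set) (fun_mod (carrier V) X)" by (rule left_module_fun_mod) (rule F.left_module_axioms)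
  have "pencil U V X f f' UNIV 0 \<subseteq> {\<zero>\<^bsub>fun_mod UNIV (fun_mod (carrier V) X)\<^esub>}"
    by (auto simp: pencil_def fun_eq_iff)
  then have "pencil U V X f f' UNIV 0 = {\<zero>\<^bsub>fun_mod UNIV (fun_mod (carrier V) X)\<^esub>}"
    using stableD(2)[OF pencil_stable[OF lm f]] by blast
  then show ?case by (simp only: N.rlen_self of_nat_0 mult_zero_left)
next
  case (Suc n)
  interpret X: left_module R X by fact
  let ?F = "fun_mod (carrier V) X"
  interpret F: left_module R ?F by (rule left_module_fun_mod) fact
  have lN: "left_module R (fun_mod (UNIV :: nat set) ?F)" by (rule left_module_fun_mod) (rule F.left_module_axioms)
  let ?P = "pencil U V X f f' UNIV"
  have lin: "lin Z (fun_mod UNIV ?F) ?F (?P (Suc n)) (\<lambda>\<phi>. \<phi> n)"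
    by (rule eval_lin) (auto simp: pencil_def mod_hom_def)
  have ker: "{\<phi> \<in> ?P (Suc n). \<phi> n = \<zero>\<^bsub>?F\<^esub>} = ?P n"
  proof -
    have "(\<forall>i\<ge>Suc n. \<phi> i = z) \<and> \<phi> n = z \<longleftrightarrow> (\<forall>i\<ge>n. \<phi> i = z)" for \<phi> z
      by (metis Suc_leD le_antisym not_less_eq_eq order_refl)
    note * = this[of _ "\<lambda>v\<in>carrier V. \<zero>\<^bsub>X\<^esub>"]
    show ?thesis unfolding pencil_def fun_mod_simps *[symmetric] by blast
  qed
  have im: "(\<lambda>\<phi>. \<phi> n) ` ?P (Suc n) = annih U V X f"
  proof
    show "(\<lambda>\<phi>. \<phi> n) ` ?P (Suc n) \<subseteq> annih U V X f"
    proof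
      fix \<psi> assume "\<psi> \<in> (\<lambda>\<phi>. \<phi> n) ` ?P (Suc n)"
      then obtain \<phi> where p: "\<phi> \<in> ?P (Suc n)" "\<psi> = \<phi> n" by blast
      then have ph: "\<phi> i \<in> mod_hom R V X" for i by (auto simp: pencil_def)
      have "\<phi> n (f u) = \<zero>\<^bsub>X\<^esub>" if u: "u \<in> carrier U" for u
      proof -
        have "\<phi> n (f u) \<oplus>\<^bsub>X\<^esub> \<phi> (Suc n) (f' u) = \<zero>\<^bsub>X\<^esub>" "\<phi> (Suc n) = (\<lambda>v\<in>carrier V. \<zero>\<^bsub>X\<^esub>)"
          using p u unfolding pencil_def by blast+
        then show ?thesis using mod_homD(1)[OF f(2) u] mod_homD(1)[OF ph mod_homD(1)[OF f(1) u]] by simp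
      qed
      then show "\<psi> \<in> annih U V X f" using p ph by (auto simp: annih_def)
    qed
    show "annih U V X f \<subseteq> (\<lambda>\<phi>. \<phi> n) ` ?P (Suc n)"
    proof
      fix \<psi> assume ps: "\<psi> \<in> annih U V X f"
      then obtain \<chi> where ch: "\<chi> (0::nat) = \<psi>" "\<And>i. \<chi> i \<in> mod_hom R V X"
        "\<And>i u. u \<in> carrier U \<Longrightarrow> \<chi> (Suc i) (f u) \<oplus>\<^bsub>X\<^esub> \<chi> i (f' u) = \<zero>\<^bsub>X\<^esub>"
        using l unfolding lifts_def by blast
      define \<phi> where "\<phi> i = (if i \<le> n then \<chi> (n - i) else \<zero>\<^bsub>?F\<^esub>)" for i
      have zh: "\<zero>\<^bsub>?F\<^esub> \<in> mod_hom R V X" using stableD(2)[OF mod_hom_stable[OF lm(2,3)]] .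
      have "\<phi> i (f u) \<oplus>\<^bsub>X\<^esub> \<phi> (Suc i) (f' u) = \<zero>\<^bsub>X\<^esub>" if u: "u \<in> carrier U" for i u
      proof -
        have fu: "f u \<in> carrier V" "f' u \<in> carrier V" using mod_homD(1)[OF f(1) u] mod_homD(1)[OF f(2) u] by auto
        consider "i < n" | "i = n" | "i > n" by linarith
        then show ?thesis
        proof cases
          case 1
          then have "n - i = Suc (n - Suc i)" by simp
          then show ?thesis using 1 ch(3)[OF u, of "n - Suc i"] by (simp add: \<phi>_def)
        next
          case 2
          then show ?thesis using ps u fu ch(1) by (simp add: \<phi>_def annih_def)
        next
          case 3
          then show ?thesis using fu by (simp add: \<phi>_def)
        qed
      qed
      then have "\<phi> \<in> ?P (Suc n)" using ch(2) zh by (auto simp: pencil_def \<phi>_def)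
      then show "\<psi> \<in> (\<lambda>\<phi>. \<phi> n) ` ?P (Suc n)" by (rule rev_image_eqI) (simp add: \<phi>_def ch)
    qed
  qed
  from rank_nullity[OF lN F.left_module_axioms Z_sub lin pencil_stable[OF lm f]]
  show ?case unfolding ker im Suc.IH by (simp only: of_nat_Suc distrib_right mult_1_left add.commute)
qed

text \<open>
  Both truncations, at the last and at the first term, live in the space of sequences of length \<open>n + 1\<close>;
  the former has colength at most \<open>hom_len V X\<close> there.
\<close>

lemma pencil_bound:
  assumes lm: "left_module R U" "left_module R V" "left_module R X" and f: "f \<in> mod_hom R U V" "f' \<in> mod_hom R U V"
    and l: "lifts U V X f f'" "lifts U V X f' f"
  shows "of_nat n * len Z (fun_mod (carrier V) X) (annih U V X f')
    \<le> of_nat n * len Z (fun_mod (carrier V) X) (annih U V X f) + hom_len V X"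
proof -
  interpret X: left_module R X by fact
  let ?F = "fun_mod (carrier V) X"
  interpret F: left_module R ?F by (rule left_module_fun_mod) fact
  have lN: "left_module R (fun_mod (UNIV :: nat set) ?F)" by (rule left_module_fun_mod) (rule F.left_module_axioms)
  let ?N = "fun_mod (UNIV :: nat set) ?F"
  let ?P = "pencil U V X f f' UNIV n" and ?P' = "pencil U V X f' f UNIV n" and ?R = "pencil U V X f f' {..<n} (Suc n)"
  have zh: "\<zero>\<^bsub>?F\<^esub> \<in> mod_hom R V X" using stableD(2)[OF mod_hom_stable[OF lm(2,3)]] .
  have lin: "lin Z ?N ?F ?R (\<lambda>\<phi>. \<phi> n)"
    by (rule eval_lin) (auto simp: pencil_def mod_hom_def)
  have ker: "{\<phi> \<in> ?R. \<phi> n = \<zero>\<^bsub>?F\<^esub>} = ?P"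
  proof (intro equalityI subsetI)
    fix \<phi> assume "\<phi> \<in> ?P"
    then show "\<phi> \<in> {\<phi> \<in> ?R. \<phi> n = \<zero>\<^bsub>?F\<^esub>}" by (auto simp: pencil_def)
  next
    fix \<phi> assume p: "\<phi> \<in> {\<phi> \<in> ?R. \<phi> n = \<zero>\<^bsub>?F\<^esub>}"
    then have z: "\<phi> i = \<zero>\<^bsub>?F\<^esub>" if "i \<ge> n" for i using that by (cases "i = n") (auto simp: pencil_def)
    have "\<phi> i (f u) \<oplus>\<^bsub>X\<^esub> \<phi> (Suc i) (f' u) = \<zero>\<^bsub>X\<^esub>" if u: "u \<in> carrier U" for i u
      using p u z[of i] z[of "Suc i"] mod_homD(1)[OF f(1) u] mod_homD(1)[OF f(2) u]
      by (cases "i < n") (auto simp: pencil_def)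
    then show "\<phi> \<in> ?P" using p z by (auto simp: pencil_def)
  qed
  have "len Z ?N ?R = len Z ?N ?P + len Z ?F ((\<lambda>\<phi>. \<phi> n) ` ?R)"
    using rank_nullity[OF lN F.left_module_axioms Z_sub lin pencil_stable[OF lm f]] ker by simp
  moreover have "len Z ?F ((\<lambda>\<phi>. \<phi> n) ` ?R) \<le> hom_len V X"
    unfolding hom_len_def by (rule len_mono) (auto simp: pencil_def)
  ultimately have R: "len Z ?N ?R \<le> len Z ?N ?P + hom_len V X" by (simp add: add_left_mono)
  \<comment> \<open>Reversal turns the relation for \<open>(f', f)\<close> into the one for \<open>(f, f')\<close>; since a sequence in \<open>?P'\<close> vanishes at \<open>n\<close>, its reverse vanishes at \<open>0\<close>.\<close>
  define rv where "rv \<phi> i = (if i \<le> n then \<phi> (n - i) else \<zero>\<^bsub>?F\<^esub>)" for \<phi> :: "nat \<Rightarrow> _" and i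
  have cl: "\<phi> i \<in> carrier ?F" if "\<phi> \<in> ?P'" for \<phi> i using that unfolding pencil_def mod_hom_def by auto
  have rl: "lin Z ?N ?N ?P' rv"
    unfolding lin_def
  proof (intro conjI ballI funcsetI)
    fix \<phi> assume "\<phi> \<in> ?P'"
    then show "rv \<phi> \<in> carrier ?N" using cl[of \<phi>] by (auto simp: rv_def PiE_iff)
  qed (auto simp: rv_def fun_eq_iff X.smult_zero ZR)
  have "len Z ?N ?P' = len Z ?N (rv ` ?P')"
  proof (rule len_inj[OF lN lN Z_sub rl pencil_stable[OF lm f(2,1)]])
    fix \<phi> assume p: "\<phi> \<in> ?P'" "rv \<phi> = \<zero>\<^bsub>?N\<^esub>"
    have "\<phi> i = \<zero>\<^bsub>?F\<^esub>" for i
    proof (cases "i \<le> n")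
      case True
      then show ?thesis using fun_cong[OF p(2), of "n - i"] by (simp add: rv_def)
    next
      case False
      then show ?thesis using p(1) by (auto simp: pencil_def)
    qed
    then show "\<phi> = \<zero>\<^bsub>?N\<^esub>" by auto
  qed
  moreover have "rv ` ?P' \<subseteq> ?R"
  proof
    fix \<psi> assume "\<psi> \<in> rv ` ?P'"
    then obtain \<phi> where p: "\<phi> \<in> ?P'" "\<psi> = rv \<phi>" by blast
    have "\<psi> i (f u) \<oplus>\<^bsub>X\<^esub> \<psi> (Suc i) (f' u) = \<zero>\<^bsub>X\<^esub>" if "i < n" "u \<in> carrier U" for i u
    proof -
      have e: "n - i = Suc (n - Suc i)" using that by simp
      have "\<phi> (n - Suc i) (f' u) \<oplus>\<^bsub>X\<^esub> \<phi> (n - i) (f u) = \<zero>\<^bsub>X\<^esub>" unfolding e using p that by (simp add: pencil_def)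
      moreover have "\<phi> (n - Suc i) (f' u) \<in> carrier X" "\<phi> (n - i) (f u) \<in> carrier X"
        using p that mod_homD(1)[OF f(1)] mod_homD(1)[OF f(2)] by (auto simp: pencil_def intro: mod_homD(1)[where M = V and R = R])
      ultimately show ?thesis using that by (simp add: p(2) rv_def X.M.a_comm)
    qed
    then show "\<psi> \<in> ?R" using p zh by (auto simp: pencil_def rv_def)
  qed
  ultimately have "len Z ?N ?P' \<le> len Z ?N ?R" by (simp only: len_mono)
  then show ?thesis using R unfolding pencil_len[OF lm f l(1)] pencil_len[OF lm f(2,1) l(2)] by (rule order_trans)
qed

text \<open>
  The bound \<open>c\<close> does not depend on \<open>n\<close>, so it disappears when \<open>n\<close> grows.
\<close>

lemma multiples_bounded_imp_le:
  fixes a b c :: enat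
  assumes "\<And>n. of_nat n * a \<le> of_nat n * b + c" "a \<noteq> \<infinity>" "b \<noteq> \<infinity>" "c \<noteq> \<infinity>"
  shows "a \<le> b"
proof -
  obtain a' b' c' where e: "a = enat a'" "b = enat b'" "c = enat c'" using assms(2-4) by auto
  have "n * a' \<le> n * b' + c'" for n using assms(1)[of n] unfolding e by (simp add: of_nat_eq_enat)
  from this[of "Suc c'"] have "a' \<le> b'" 
  proof -
    assume *: "Suc c' * a' \<le> Suc c' * b' + c'"
    show ?thesis
    proof (rule ccontr)
      assume "\<not> a' \<le> b'"
      then have "Suc c' * (b' + 1) \<le> Suc c' * a'" by (intro mult_le_mono) auto
      then have "Suc c' * (b' + 1) \<le> Suc c' * b' + c'" using * by (rule order_trans)
      then show False by (simp add: algebra_simps)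
    qed
  qed
  then show ?thesis using e by simp
qed

lemma annih_len_eq:
  assumes lm: "left_module R U" "left_module R V" "left_module R X" and f: "f \<in> mod_hom R U V" "f' \<in> mod_hom R U V"
    and l: "lifts U V X f f'" "lifts U V X f' f" and fin: "hom_len V X \<noteq> \<infinity>"
  shows "len Z (fun_mod (carrier V) X) (annih U V X f) = len Z (fun_mod (carrier V) X) (annih U V X f')"
proof -
  have "len Z (fun_mod (carrier V) X) (annih U V X g) \<noteq> \<infinity>" for g
    by (rule enat_le_finite[OF len_mono fin[unfolded hom_len_def]]) (auto simp: annih_def)
  then show ?thesis
    by (intro antisym multiples_bounded_imp_le[OF pencil_bound[OF lm f l] _ _ fin]
      multiples_bounded_imp_le[OF pencil_bound[OF lm f(2,1) l(2,1)] _ _ fin])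
qed

end

section \<open>Modules with equal Hom lengths\<close>

lemma enat_sum_finite: "(a :: enat) = b + c \<Longrightarrow> b \<noteq> \<infinity> \<Longrightarrow> c \<noteq> \<infinity> \<Longrightarrow> a \<noteq> \<infinity>"
  by auto

lemma enat_summand_finite: "(a :: enat) = b + c \<Longrightarrow> a \<noteq> \<infinity> \<Longrightarrow> b \<noteq> \<infinity> \<and> c \<noteq> \<infinity>"
  by (cases b; cases c) simp_all

lemma inverse_hom:
  assumes "left_module R M" "f \<in> mod_hom R M N" and bij: "bij_betw f (carrier M) (carrier N)"
  obtains g where "g \<in> mod_hom R N M" "bij_betw g (carrier N) (carrier M)"
    "\<And>x. x \<in> carrier M \<Longrightarrow> g (f x) = x" "\<And>y. y \<in> carrier N \<Longrightarrow> f (g y) = y"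
proof -
  interpret M: left_module R M by fact
  define g where "g = restrict (the_inv_into (carrier M) f) (carrier N)"
  have inj: "inj_on f (carrier M)" using bij by (simp add: bij_betw_def)
  have fg: "f (g y) = y" "g y \<in> carrier M" if "y \<in> carrier N" for y
    using bij that by (auto simp: g_def bij_betw_def f_the_inv_into_f intro: the_inv_into_into)
  have gf: "g (f x) = x" if "x \<in> carrier M" for x
    using bij that mod_homD(1)[OF assms(2) that] by (simp add: g_def bij_betw_def the_inv_into_f_f)
  have eq: "x = y" if "f x = f y" "x \<in> carrier M" "y \<in> carrier M" for x y using inj that by (simp add: inj_on_def)
  have "g \<in> mod_hom R N M"
  proof (rule mod_homI)
    fix y assume "y \<in> carrier N" then show "g y \<in> carrier M" using fg(2) by simp
  next
    fix x y assume *: "x \<in> carrier N" "y \<in> carrier N"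
    have s: "f (g x \<oplus>\<^bsub>M\<^esub> g y) = x \<oplus>\<^bsub>N\<^esub> y" using * fg mod_homD(2)[OF assms(2)] by simp
    then have "x \<oplus>\<^bsub>N\<^esub> y \<in> carrier N" using mod_homD(1)[OF assms(2), of "g x \<oplus>\<^bsub>M\<^esub> g y"] * fg(2) by simp
    then show "g (x \<oplus>\<^bsub>N\<^esub> y) = g x \<oplus>\<^bsub>M\<^esub> g y" using s * fg by (intro eq) auto
  next
    fix a x assume *: "a \<in> carrier R" "x \<in> carrier N"
    have s: "f (a \<odot>\<^bsub>M\<^esub> g x) = a \<odot>\<^bsub>N\<^esub> x" using * fg mod_homD(3)[OF assms(2)] by simp
    then have "a \<odot>\<^bsub>N\<^esub> x \<in> carrier N" using mod_homD(1)[OF assms(2), of "a \<odot>\<^bsub>M\<^esub> g x"] * fg(2) M.smult_closed by simp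
    then show "g (a \<odot>\<^bsub>N\<^esub> x) = a \<odot>\<^bsub>M\<^esub> g x" using s * fg M.smult_closed by (intro eq) auto
  next
    fix x assume "x \<notin> carrier N" then show "g x = undefined" by (simp add: g_def)
  qed
  moreover have "bij_betw g (carrier N) (carrier M)"
    by (rule bij_betw_byWitness[where f' = f]) (use fg gf mod_homD(1)[OF assms(2)] in auto)
  ultimately show ?thesis using that fg(1) gf by blast
qed

lemma (in left_module) finsum_smult:
  assumes "a \<in> carrier R" "g \<in> S \<rightarrow> carrier M"
  shows "a \<odot>\<^bsub>M\<^esub> finsum M g S = finsum M (\<lambda>i. a \<odot>\<^bsub>M\<^esub> g i) S"
  using assms(2)
proof (induction S rule: infinite_finite_induct)
  case (insert i S)
  then have "g \<in> S \<rightarrow> carrier M" "g i \<in> carrier M" "(\<lambda>i. a \<odot>\<^bsub>M\<^esub> g i) \<in> S \<rightarrow> carrier M"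
    using smult_closed[OF assms(1)] by auto
  then show ?case using insert smult_closed[OF assms(1)] smult_r_distr[OF assms(1)] by simp
qed (simp_all add: smult_zero assms(1))

lemma lin_funpow:
  assumes "lin A W W (carrier W) x"
  shows "lin A W W (carrier W) (x ^^ k)"
proof (induction k)
  case (Suc k)
  have cl: "(x ^^ k) w \<in> carrier W" if "w \<in> carrier W" for w using Suc that by (auto simp: lin_def)
  then show ?case using Suc assms unfolding lin_def by auto
qed (auto simp: lin_def)

context central_ops begin

lemma zfinite_sub:
  assumes "zfinite M" "H \<subseteq> carrier M"
  shows "len Z M H \<noteq> \<infinity>"
  using enat_le_finite[OF len_mono[OF assms(2)]] assms(1) unfolding zfinite_def by blast

lemma zfinite_restrict:
  assumes "zfinite M" "H \<subseteq> carrier M"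
  shows "zfinite (M\<lparr>carrier := H\<rparr>)"
  using zfinite_sub[OF assms] rlen_restrict[OF assms(2), of H] unfolding zfinite_def by simp

lemma zfinite_image:
  assumes "left_module R M" "left_module R N" "zfinite M" "f \<in> mod_hom R M N" "f ` carrier M = carrier N"
  shows "zfinite N"
proof -
  interpret M: left_module R M by fact
  from enat_summand_finite[OF rank_nullity[OF assms(1,2) Z_sub mod_hom_lin[OF assms(4) Z_sub] M.stable_carrier[OF Z_sub]]] assms(3)
  show ?thesis unfolding zfinite_def assms(5) by blast
qed

lemma len_strict:
  assumes "left_module R M" "stable_sub Z M A" "stable_sub Z M B" "A \<subset> B" "len Z M B \<noteq> \<infinity>"
  shows "len Z M A < len Z M B"
proof -
  interpret M: left_module R M by fact
  have z: "{\<zero>\<^bsub>M\<^esub>} \<subseteq> A" using stableD(2)[OF assms(2)] by simp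
  have "len Z M A \<noteq> len Z M B"
    using M.rlen_eq_imp_eq[OF M.stable_zero[OF Z_sub] assms(2,3) Z_sub z _ _ assms(5)] assms(4) by blast
  then show ?thesis using len_mono[of A B M] assms(4) by (simp add: less_le psubset_eq)
qed

lemma len_zero_imp:
  assumes "left_module R M" "stable_sub Z M A" "len Z M A = 0"
  shows "A = {\<zero>\<^bsub>M\<^esub>}"
proof (rule ccontr)
  interpret M: left_module R M by fact
  assume "A \<noteq> {\<zero>\<^bsub>M\<^esub>}"
  then have "{\<zero>\<^bsub>M\<^esub>} \<subset> A" using stableD(2)[OF assms(2)] by auto
  from M.rlen_pos[OF M.stable_zero[OF Z_sub] assms(2) this] assms(3) show False by simp
qed

text \<open>
  A finite subset of \<open>H\<close> whose generated subgroup has the largest possible length generates \<open>H\<close>.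
\<close>

lemma finitely_generated:
  assumes "left_module R M" "stable_sub Z M H" "len Z M H \<noteq> \<infinity>"
  obtains S where "finite S" "S \<subseteq> H" "\<And>G. stable_sub Z M G \<Longrightarrow> S \<subseteq> G \<Longrightarrow> H \<subseteq> G"
proof -
  interpret M: left_module R M by fact
  define gen where "gen S = \<Inter>{G. stable_sub Z M G \<and> G \<subseteq> H \<and> S \<subseteq> G}" for S
  have st: "stable_sub Z M (gen S)" if "S \<subseteq> H" for S
  proof (rule M.stableI)
    have "H \<in> {G. stable_sub Z M G \<and> G \<subseteq> H \<and> S \<subseteq> G}" using assms that by auto
    then show "gen S \<subseteq> carrier M" unfolding gen_def using stableD(1)[OF assms(2)] by blast
  qed (unfold gen_def, auto intro: stableD(2-4) M.stable_neg)
  have sub: "S \<subseteq> gen S" "gen S \<subseteq> H" if "S \<subseteq> H" for S unfolding gen_def using that assms by auto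
  obtain b where b: "len Z M H = enat b" using assms(3) by auto
  have "\<exists>S. (finite S \<and> S \<subseteq> H) \<and> (\<forall>T. finite T \<and> T \<subseteq> H \<longrightarrow> the_enat (len Z M (gen T)) \<le> the_enat (len Z M (gen S)))"
  proof (rule ex_has_greatest_nat[where k = "{}" and b = "Suc b" and P = "\<lambda>S. finite S \<and> S \<subseteq> H" and f = "\<lambda>S. the_enat (len Z M (gen S))"])
    show "\<forall>T. finite T \<and> T \<subseteq> H \<longrightarrow> the_enat (len Z M (gen T)) < Suc b"
    proof (intro allI impI)
      fix T assume "finite T \<and> T \<subseteq> H"
      then have "len Z M (gen T) \<le> enat b" using len_mono[OF sub(2), of T M] b by simp
      then show "the_enat (len Z M (gen T)) < Suc b" by (cases "len Z M (gen T)") auto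
    qed
  qed simp
  then obtain S where *: "(finite S \<and> S \<subseteq> H) \<and> (\<forall>T. finite T \<and> T \<subseteq> H \<longrightarrow> the_enat (len Z M (gen T)) \<le> the_enat (len Z M (gen S)))" ..
  then have S: "finite S" "S \<subseteq> H" by simp_all
  from * have mx: "the_enat (len Z M (gen T)) \<le> the_enat (len Z M (gen S))" if "finite T" "T \<subseteq> H" for T using that by simp
  have "gen S = H"
  proof (rule ccontr)
    assume "gen S \<noteq> H"
    then obtain x where x: "x \<in> H" "x \<notin> gen S" using sub(2)[OF S(2)] by blast
    have xs: "insert x S \<subseteq> H" using x S by auto
    have "gen S \<subseteq> gen (insert x S)" unfolding gen_def by (rule Inter_anti_mono) auto
    moreover have "x \<in> gen (insert x S)" using sub(1)[OF xs] by simp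
    ultimately have "gen S \<subset> gen (insert x S)" using x(2) by auto
    moreover have f: "len Z M (gen (insert x S)) \<noteq> \<infinity>" using enat_le_finite[OF len_mono[OF sub(2)[OF xs]] assms(3)] .
    ultimately have "len Z M (gen S) < len Z M (gen (insert x S))" by (intro len_strict assms(1) st xs S(2))
    then have "the_enat (len Z M (gen S)) < the_enat (len Z M (gen (insert x S)))"
      using f by (cases "len Z M (gen S)"; cases "len Z M (gen (insert x S))") auto
    then show False using mx[of "insert x S"] xs S(1) by auto
  qed
  moreover have "H \<subseteq> G" if "stable_sub Z M G" "S \<subseteq> G" for G
  proof -
    have "gen S \<subseteq> G \<inter> H" unfolding gen_def using M.stable_Int[OF that(1) assms(2)] that(2) S(2) by blast
    then show ?thesis using \<open>gen S = H\<close> by blast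
  qed
  ultimately show ?thesis using that S by blast
qed

lemma zfinite_fun_mod:
  assumes "finite S" "left_module R X" "zfinite X"
  shows "zfinite (fun_mod S X)"
proof -
  interpret X: left_module R X by fact
  let ?F = "fun_mod S X"
  interpret F: left_module R ?F by (rule left_module_fun_mod) fact
  let ?D = "\<lambda>T. {\<phi> \<in> S \<rightarrow>\<^sub>E carrier X. \<forall>i\<in>S - T. \<phi> i = \<zero>\<^bsub>X\<^esub>}"
  have st: "stable_sub Z ?F (?D T)" for T
    unfolding stable_sub_def
  proof (intro conjI ballI)
    fix \<phi> assume p: "\<phi> \<in> ?D T"
    show "\<exists>y\<in>?D T. \<phi> \<oplus>\<^bsub>?F\<^esub> y = \<zero>\<^bsub>?F\<^esub>"
      by (rule bexI[of _ "\<lambda>i\<in>S. \<ominus>\<^bsub>X\<^esub> \<phi> i"]) (use p X.M.minus_equality[of "\<zero>\<^bsub>X\<^esub>" "\<zero>\<^bsub>X\<^esub>"] in \<open>auto simp: fun_eq_iff PiE_iff X.M.r_neg\<close>)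
  qed (auto simp: PiE_iff extensional_def ZR X.smult_zero X.smult_closed)
  have "len Z ?F (?D T) \<noteq> \<infinity>" if "T \<subseteq> S" for T
    using finite_subset[OF that assms(1)] that
  proof (induction T rule: finite_induct)
    case empty
    have "?D {} = {\<zero>\<^bsub>?F\<^esub>}" by (auto simp: fun_eq_iff PiE_iff extensional_def)
    then show ?case by (simp only: F.rlen_self) simp
  next
    case (insert a T)
    have a: "a \<in> S" "T \<subseteq> S" using insert.prems by auto
    have cl: "\<phi> a \<in> carrier X" if "\<phi> \<in> ?D (insert a T)" for \<phi> using that a by (simp add: PiE_iff)
    have lin: "lin Z ?F X (?D (insert a T)) (\<lambda>\<phi>. \<phi> a)" unfolding lin_def using a cl by simp
    have ker: "{\<phi> \<in> ?D (insert a T). \<phi> a = \<zero>\<^bsub>X\<^esub>} = ?D T" using a insert.hyps by auto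
    have eq: "len Z ?F (?D (insert a T)) = len Z ?F (?D T) + len Z X ((\<lambda>\<phi>. \<phi> a) ` ?D (insert a T))"
      using rank_nullity[OF F.left_module_axioms assms(2) Z_sub lin st] unfolding ker .
    have "(\<lambda>\<phi>. \<phi> a) ` ?D (insert a T) \<subseteq> carrier X" using cl by blast
    from enat_sum_finite[OF eq insert.IH[OF a(2)] zfinite_sub[OF assms(3) this]] show ?case .
  qed
  from this[of S] show ?thesis unfolding zfinite_def by (simp only: Diff_cancel ball_empty simp_thms Collect_mem_eq fun_mod_simps subset_refl not_False_eq_True)
qed

text \<open>
  A homomorphism is determined by its values on a finite set of generators.
\<close>

lemma hom_len_finite:
  assumes "left_module R Y" "left_module R X" "zfinite Y" "zfinite X"
  shows "hom_len Y X \<noteq> \<infinity>"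
proof -
  interpret Y: left_module R Y by fact
  interpret X: left_module R X by fact
  obtain S where S: "finite S" "S \<subseteq> carrier Y" "\<And>G. stable_sub Z Y G \<Longrightarrow> S \<subseteq> G \<Longrightarrow> carrier Y \<subseteq> G"
    using finitely_generated[OF assms(1) Y.stable_carrier[OF Z_sub]] assms(3) unfolding zfinite_def by blast
  have lin: "lin Z (fun_mod (carrier Y) X) (fun_mod S X) (mod_hom R Y X) (\<lambda>\<phi>. restrict \<phi> S)"
    unfolding lin_def using S(2) by (auto simp: fun_eq_iff mod_hom_def)
  have e: "len Z (fun_mod (carrier Y) X) (mod_hom R Y X) = len Z (fun_mod S X) ((\<lambda>\<phi>. restrict \<phi> S) ` mod_hom R Y X)"
  proof (rule len_inj[OF left_module_fun_mod[OF assms(2)] left_module_fun_mod[OF assms(2)] Z_sub lin mod_hom_stable[OF assms(1,2)]])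
    fix \<phi> assume p: "\<phi> \<in> mod_hom R Y X" and z: "restrict \<phi> S = \<zero>\<^bsub>fun_mod S X\<^esub>"
    have "stable_sub Z Y {y \<in> carrier Y. \<phi> y \<in> {\<zero>\<^bsub>X\<^esub>}}"
      by (rule lin_stable_image(4)[OF assms(1,2) Z_sub mod_hom_lin[OF p Z_sub] Y.stable_carrier[OF Z_sub] X.stable_zero[OF Z_sub]])
    moreover have "\<phi> y = \<zero>\<^bsub>X\<^esub>" if "y \<in> S" for y using fun_cong[OF z, of y] that by simp
    ultimately have "carrier Y \<subseteq> {y \<in> carrier Y. \<phi> y \<in> {\<zero>\<^bsub>X\<^esub>}}" using S(2) by (intro S(3)) auto
    then show "\<phi> = \<zero>\<^bsub>fun_mod (carrier Y) X\<^esub>" using mod_homD(4)[OF p] by (auto simp: fun_eq_iff)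
  qed
  have "restrict \<phi> S \<in> carrier (fun_mod S X)" if "\<phi> \<in> mod_hom R Y X" for \<phi>
    using mod_homD(1)[OF that] S(2) by auto
  then have "(\<lambda>\<phi>. restrict \<phi> S) ` mod_hom R Y X \<subseteq> carrier (fun_mod S X)" by blast
  from zfinite_sub[OF zfinite_fun_mod[OF S(1) assms(2,4)] this]
  show ?thesis unfolding hom_len_def e .
qed

text \<open>
  The left exactness of \<open>Hom(Y, -)\<close> on \<open>ker h \<rightarrow> P \<rightarrow> W\<close>, as an equation of lengths.
\<close>

lemma hom_len_exact:
  assumes lm: "left_module R Y" "left_module R P" "left_module R W" and h: "h \<in> mod_hom R P W"
  shows "hom_len Y P = hom_len Y (P\<lparr>carrier := {x \<in> carrier P. h x = \<zero>\<^bsub>W\<^esub>}\<rparr>)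
     + len Z (fun_mod (carrier Y) W) ((\<lambda>f. compose (carrier Y) h f) ` mod_hom R Y P)"
proof -
  interpret Y: left_module R Y by fact
  let ?C = "{x \<in> carrier P. h x = \<zero>\<^bsub>W\<^esub>}"
  have ker: "{f \<in> mod_hom R Y P. compose (carrier Y) h f = \<zero>\<^bsub>fun_mod (carrier Y) W\<^esub>} = mod_hom R Y (P\<lparr>carrier := ?C\<rparr>)"
  proof -
    have "compose (carrier Y) h f = \<zero>\<^bsub>fun_mod (carrier Y) W\<^esub> \<longleftrightarrow> (\<forall>y\<in>carrier Y. f y \<in> ?C)" if "f \<in> mod_hom R Y P" for f
      using mod_homD(1)[OF that] by (auto simp: compose_def fun_eq_iff)
    then show ?thesis by (subst set_eq_iff, subst restrict_hom_iff) auto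
  qed
  have e: "fun_mod (carrier Y) (P\<lparr>carrier := ?C\<rparr>) = (fun_mod (carrier Y) P)\<lparr>carrier := carrier Y \<rightarrow>\<^sub>E ?C\<rparr>"
    by (simp add: fun_mod_def)
  have "hom_len Y (P\<lparr>carrier := ?C\<rparr>) = len Z (fun_mod (carrier Y) P) (mod_hom R Y (P\<lparr>carrier := ?C\<rparr>))"
    unfolding hom_len_def e by (subst rlen_restrict) (auto simp: mod_hom_def PiE_iff extensional_def)
  then show ?thesis
    using rank_nullity[OF left_module_fun_mod[OF lm(2)] left_module_fun_mod[OF lm(3)] Z_sub postcomp_lin[OF lm(3) h] mod_hom_stable[OF lm(1,2)]]
    unfolding ker hom_len_def by simp
qed

text \<open>
  By exactness the length of the image of \<open>Hom(Y, P)\<close> in \<open>Hom(Y, W)\<close> depends only on Hom lengths out of \<open>Y\<close>;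
  so if the image is everything for \<open>Y = W'\<close>, it is everything for \<open>Y = W\<close>.
\<close>

lemma surjective_transfer:
  assumes lm: "left_module R W" "left_module R W'" "left_module R P" and fin: "zfinite W" "zfinite W'" "zfinite P"
    and h: "h \<in> mod_hom R P W"
    and eq: "hom_len W P = hom_len W' P" "hom_len W W = hom_len W' W"
      "hom_len W (P\<lparr>carrier := {x \<in> carrier P. h x = \<zero>\<^bsub>W\<^esub>}\<rparr>) = hom_len W' (P\<lparr>carrier := {x \<in> carrier P. h x = \<zero>\<^bsub>W\<^esub>}\<rparr>)"
    and surj: "(\<lambda>f. compose (carrier W') h f) ` mod_hom R W' P = mod_hom R W' W"
  shows "(\<lambda>f. compose (carrier W) h f) ` mod_hom R W P = mod_hom R W W"
proof -
  interpret W: left_module R W by fact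
  interpret F: left_module R "fun_mod (carrier W) W" by (rule left_module_fun_mod) fact
  let ?C = "P\<lparr>carrier := {x \<in> carrier P. h x = \<zero>\<^bsub>W\<^esub>}\<rparr>"
  let ?I = "(\<lambda>f. compose (carrier W) h f) ` mod_hom R W P"
  have e1: "hom_len W P = hom_len W ?C + len Z (fun_mod (carrier W) W) ?I"
    by (rule hom_len_exact[OF lm(1,3,1) h])
  have e2: "hom_len W' P = hom_len W' ?C + hom_len W' W"
    unfolding hom_len_exact[OF lm(2,3,1) h] surj by (simp add: hom_len_def)
  have f: "hom_len W P \<noteq> \<infinity>" by (rule hom_len_finite) fact+
  have f2: "hom_len W W \<noteq> \<infinity>" by (rule hom_len_finite) fact+
  have "hom_len W ?C + len Z (fun_mod (carrier W) W) ?I = hom_len W ?C + hom_len W W"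
    unfolding eq by (rule trans[OF e1[symmetric, unfolded eq] e2])
  moreover have "hom_len W ?C \<noteq> \<infinity>" using enat_summand_finite[OF e1 f] by blast
  ultimately have l: "len Z (fun_mod (carrier W) W) ?I = hom_len W W" by (simp add: enat_add_left_cancel)
  have sub: "?I \<subseteq> mod_hom R W W" using mod_hom_compose[OF lm(1) _ h] by blast
  have st: "stable_sub Z (fun_mod (carrier W) W) ?I"
    by (rule lin_stable_image(3)[OF left_module_fun_mod[OF lm(3)] left_module_fun_mod[OF lm(1)] Z_sub postcomp_lin[OF lm(1) h]
      mod_hom_stable[OF lm(1,3)] mod_hom_stable[OF lm(1,3)] subset_refl])
  show ?thesis
    by (rule F.rlen_eq_imp_eq[OF F.stable_zero[OF Z_sub] st mod_hom_stable[OF lm(1,1)] Z_sub _ sub])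
      (use stableD(2)[OF st] l f2 in \<open>simp_all only: hom_len_def not_False_eq_True simp_thms insert_subset empty_subsetI\<close>)
qed

text \<open>
  The power of \<open>W'\<close> is indexed by a finite generating set \<open>S\<close> of \<open>Hom(W', W)\<close> itself, and \<open>h\<close> applies
  each \<open>b \<in> S\<close> to its own coordinate. This is why the test module has elements of type
  \<open>('w1 \<Rightarrow> 'w) \<Rightarrow> 'w1\<close>.
\<close>

lemma sum_of_factorisations:
  fixes W :: "('a, 'w, 'wx) module_scheme" and W' :: "('a, 'w1, 'w1x) module_scheme"
  assumes lm: "left_module R W" "left_module R W'" and fin: "zfinite W" "zfinite W'"
    and eqW: "hom_len W W = hom_len W' W"
    and eq: "\<And>X :: ('a, ('w1 \<Rightarrow> 'w) \<Rightarrow> 'w1) module. left_module R X \<Longrightarrow> zfinite X \<Longrightarrow> hom_len W X = hom_len W' X"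
  obtains S c where "finite S" "S \<subseteq> mod_hom R W' W" "\<And>b. b \<in> S \<Longrightarrow> c b \<in> mod_hom R W W'"
    "\<And>w. w \<in> carrier W \<Longrightarrow> w = (\<Oplus>\<^bsub>W\<^esub>b\<in>S. b (c b w))"
proof -
  interpret W: left_module R W by fact
  interpret W': left_module R W' by fact
  have "len Z (fun_mod (carrier W') W) (mod_hom R W' W) \<noteq> \<infinity>"
    using hom_len_finite[OF lm(2,1) fin(2,1)] unfolding hom_len_def .
  from finitely_generated[OF left_module_fun_mod[OF lm(1)] mod_hom_stable[OF lm(2,1)] this]
  obtain S where S: "finite S" "S \<subseteq> mod_hom R W' W"
    "\<And>G. stable_sub Z (fun_mod (carrier W') W) G \<Longrightarrow> S \<subseteq> G \<Longrightarrow> mod_hom R W' W \<subseteq> G" by metis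
  let ?P = "fun_mod S W'"
  interpret P: left_module R ?P by (rule left_module_fun_mod) fact
  have bW: "b y \<in> carrier W" if "b \<in> S" "y \<in> carrier W'" for b y using mod_homD(1)[of b R W' W] S(2) that by blast
  define h where "h = (\<lambda>p\<in>carrier ?P. \<Oplus>\<^bsub>W\<^esub>b\<in>S. b (p b))"
  have h: "h \<in> mod_hom R ?P W"
  proof (rule mod_homI)
    fix p assume "p \<in> carrier ?P"
    then show "h p \<in> carrier W" using bW by (auto simp: h_def PiE_iff intro!: W.M.finsum_closed)
  next
    fix p q assume pq: "p \<in> carrier ?P" "q \<in> carrier ?P"
    have "(\<Oplus>\<^bsub>W\<^esub>b\<in>S. b (p b \<oplus>\<^bsub>W'\<^esub> q b)) = (\<Oplus>\<^bsub>W\<^esub>b\<in>S. b (p b) \<oplus>\<^bsub>W\<^esub> b (q b))"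
      using pq S(2) bW by (intro W.M.finsum_cong') (auto simp: PiE_iff mod_homD(2)[where R = R and M = W' and N = W] subset_iff)
    also have "\<dots> = (\<Oplus>\<^bsub>W\<^esub>b\<in>S. b (p b)) \<oplus>\<^bsub>W\<^esub> (\<Oplus>\<^bsub>W\<^esub>b\<in>S. b (q b))"
      using pq bW by (intro W.M.finsum_addf) (auto simp: PiE_iff)
    moreover have "(\<Oplus>\<^bsub>W\<^esub>b\<in>S. b ((p \<oplus>\<^bsub>?P\<^esub> q) b)) = (\<Oplus>\<^bsub>W\<^esub>b\<in>S. b (p b \<oplus>\<^bsub>W'\<^esub> q b))"
      using pq bW by (intro W.M.finsum_cong') (auto simp: PiE_iff)
    ultimately show "h (p \<oplus>\<^bsub>?P\<^esub> q) = h p \<oplus>\<^bsub>W\<^esub> h q"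
      using P.M.a_closed[OF pq] pq unfolding h_def by simp
  next
    fix a p assume ap: "a \<in> carrier R" "p \<in> carrier ?P"
    have "(\<Oplus>\<^bsub>W\<^esub>b\<in>S. b ((a \<odot>\<^bsub>?P\<^esub> p) b)) = (\<Oplus>\<^bsub>W\<^esub>b\<in>S. a \<odot>\<^bsub>W\<^esub> b (p b))"
      using ap S(2) bW W.smult_closed by (intro W.M.finsum_cong') (auto simp: PiE_iff mod_homD(3)[where R = R and M = W' and N = W] subset_iff)
    also have "\<dots> = a \<odot>\<^bsub>W\<^esub> (\<Oplus>\<^bsub>W\<^esub>b\<in>S. b (p b))"
      using ap bW by (intro W.finsum_smult[symmetric]) (auto simp: PiE_iff)
    finally show "h (a \<odot>\<^bsub>?P\<^esub> p) = a \<odot>\<^bsub>W\<^esub> h p"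
      using P.smult_closed[OF ap] ap(2) unfolding h_def by simp
  qed (simp add: h_def)
  let ?I = "(\<lambda>f. compose (carrier W') h f) ` mod_hom R W' ?P"
  have st: "stable_sub Z (fun_mod (carrier W') W) ?I"
    by (rule lin_stable_image(3)[OF left_module_fun_mod[OF P.left_module_axioms] left_module_fun_mod[OF lm(1)] Z_sub postcomp_lin[OF lm(1) h]
      mod_hom_stable[OF lm(2) P.left_module_axioms] mod_hom_stable[OF lm(2) P.left_module_axioms] subset_refl])
  have "S \<subseteq> ?I"
  proof
    fix b assume b: "b \<in> S"
    then have bh: "b \<in> mod_hom R W' W" using S by auto
    define f where "f = (\<lambda>y\<in>carrier W'. \<lambda>d\<in>S. if d = b then y else \<zero>\<^bsub>W'\<^esub>)"
    have f: "f \<in> mod_hom R W' ?P"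
      by (rule mod_homI) (auto simp: f_def fun_eq_iff W'.smult_zero W'.smult_closed)
    have "compose (carrier W') h f = b"
    proof (rule mod_hom_eqI[OF mod_hom_compose[OF lm(2) f h] bh])
      fix y assume y: "y \<in> carrier W'"
      have d0: "d \<zero>\<^bsub>W'\<^esub> = \<zero>\<^bsub>W\<^esub>" if "d \<in> S" for d using mod_hom_arith(1)[OF lm(2,1)] that S(2) by blast
      have "h (f y) = (\<Oplus>\<^bsub>W\<^esub>d\<in>S. d (f y d))" using mod_homD(1)[OF f y] by (simp add: h_def)
      also have "\<dots> = (\<Oplus>\<^bsub>W\<^esub>d\<in>S. if b = d then d y else \<zero>\<^bsub>W\<^esub>)"
        using y bW d0 by (intro W.M.finsum_cong') (auto simp: f_def)
      also have "\<dots> = b y" using W.M.finsum_singleton[OF b S(1), of "\<lambda>d. d y"] bW y by auto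
      finally show "compose (carrier W') h f y = b y" using y by (simp add: compose_def)
    qed
    then show "b \<in> ?I" using f by blast
  qed
  then have "mod_hom R W' W \<subseteq> ?I" by (rule S(3)[OF st])
  moreover have "?I \<subseteq> mod_hom R W' W" using mod_hom_compose[OF lm(2) _ h] by blast
  ultimately have surj: "?I = mod_hom R W' W" by blast
  have finP: "zfinite ?P" by (rule zfinite_fun_mod) fact+
  have stC: "stable_sub (carrier R) ?P {x \<in> carrier ?P. h x \<in> {\<zero>\<^bsub>W\<^esub>}}"
    by (rule lin_stable_image(4)[OF P.left_module_axioms lm(1) _ mod_hom_lin[OF h]]) (auto intro!: P.stable_carrier W.stable_zero simp del: fun_mod_simps)
  have "left_module R (?P\<lparr>carrier := {x \<in> carrier ?P. h x = \<zero>\<^bsub>W\<^esub>}\<rparr>)"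
    using left_module_restrict[OF P.left_module_axioms stC] by simp
  moreover have "zfinite (?P\<lparr>carrier := {x \<in> carrier ?P. h x = \<zero>\<^bsub>W\<^esub>}\<rparr>)"
    by (rule zfinite_restrict[OF finP]) auto
  ultimately have "(\<lambda>f. compose (carrier W) h f) ` mod_hom R W ?P = mod_hom R W W"
    by (intro surjective_transfer[OF lm P.left_module_axioms fin finP h _ eqW _ surj] eq P.left_module_axioms finP)
  then obtain f where f: "f \<in> mod_hom R W ?P" "mod_id W = compose (carrier W) h f" using mod_id_hom[OF lm(1)] by blast
  define c where "c b = (\<lambda>w\<in>carrier W. f w b)" for b
  have fS: "f w b \<in> carrier W'" if "b \<in> S" "w \<in> carrier W" for b w using mod_homD(1)[OF f(1) that(2)] that(1) by auto
  show ?thesis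
  proof (rule that[OF S(1,2)])
    fix b assume b: "b \<in> S"
    show "c b \<in> mod_hom R W W'"
      by (rule mod_homI) (use b fS in \<open>auto simp: c_def mod_homD(2,3)[OF f(1)] W.smult_closed\<close>)
  next
    fix w assume w: "w \<in> carrier W"
    have "w = h (f w)" using fun_cong[OF f(2), of w] w by (simp add: mod_id_def compose_def)
    also have "\<dots> = (\<Oplus>\<^bsub>W\<^esub>b\<in>S. b (f w b))" using mod_homD(1)[OF f(1) w] by (simp add: h_def)
    also have "\<dots> = (\<Oplus>\<^bsub>W\<^esub>b\<in>S. b (c b w))" using w bW fS by (intro W.M.finsum_cong') (auto simp: c_def)
    finally show "w = (\<Oplus>\<^bsub>W\<^esub>b\<in>S. b (c b w))" .
  qed
qed

end

lemma minus_hom: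
  assumes "left_module R W" "e \<in> mod_hom R W W"
  shows "(\<lambda>w\<in>carrier W. w \<ominus>\<^bsub>W\<^esub> e w) \<in> mod_hom R W W"
proof -
  interpret W: left_module R W by fact
  note e = mod_homD(1-3)[OF assms(2)]
  show ?thesis
    by (rule mod_homI)
       (auto simp: a_minus_def e W.smult_closed W.M.minus_add W.M.a_ac W.smult_r_distr W.smult_neg)
qed

lemma minus_eq_zero_imp:
  assumes "left_module R W" "x \<in> carrier W" "y \<in> carrier W" "x \<ominus>\<^bsub>W\<^esub> y = \<zero>\<^bsub>W\<^esub>"
  shows "x = y"
proof -
  interpret W: left_module R W by fact
  have "x = (x \<ominus>\<^bsub>W\<^esub> y) \<oplus>\<^bsub>W\<^esub> y" using assms(2,3) by (simp add: a_minus_def W.M.a_assoc W.M.l_neg)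
  then show ?thesis using assms by simp
qed

lemma inj_on_kernel:
  assumes "left_module R M" "left_module R N" "f \<in> mod_hom R M N"
    and "\<And>x. x \<in> carrier M \<Longrightarrow> f x = \<zero>\<^bsub>N\<^esub> \<Longrightarrow> x = \<zero>\<^bsub>M\<^esub>"
  shows "inj_on f (carrier M)"
proof (rule inj_onI)
  interpret M: left_module R M by fact
  interpret N: left_module R N by fact
  fix x y assume xy: "x \<in> carrier M" "y \<in> carrier M" "f x = f y"
  have "f (x \<ominus>\<^bsub>M\<^esub> y) = f y \<ominus>\<^bsub>N\<^esub> f y" using mod_hom_arith(3)[OF assms(1-3) xy(1,2)] xy(3) by simp
  also have "\<dots> = \<zero>\<^bsub>N\<^esub>" using mod_homD(1)[OF assms(3) xy(2)] by (simp add: a_minus_def N.M.r_neg)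
  finally have "f (x \<ominus>\<^bsub>M\<^esub> y) = \<zero>\<^bsub>N\<^esub>" .
  moreover have "x \<ominus>\<^bsub>M\<^esub> y \<in> carrier M" using xy by (simp add: a_minus_def)
  ultimately show "x = y" using assms(4) minus_eq_zero_imp[OF assms(1) xy(1,2)] by blast
qed

context central_ops begin

lemma injective_endo_bij:
  assumes "left_module R W" "zfinite W" "f \<in> mod_hom R W W"
    and inj: "\<And>x. x \<in> carrier W \<Longrightarrow> f x = \<zero>\<^bsub>W\<^esub> \<Longrightarrow> x = \<zero>\<^bsub>W\<^esub>"
  shows "bij_betw f (carrier W) (carrier W)"
proof -
  interpret W: left_module R W by fact
  note lin = mod_hom_lin[OF assms(3) Z_sub] and sc = W.stable_carrier[OF Z_sub]
  have eq: "len Z W (carrier W) = len Z W (f ` carrier W)"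
    by (rule len_inj[OF assms(1,1) Z_sub lin sc inj])
  have st: "stable_sub Z W (f ` carrier W)"
    by (rule lin_stable_image(3)[OF assms(1,1) Z_sub lin sc sc subset_refl])
  have "f ` carrier W = carrier W"
  proof (rule W.rlen_eq_imp_eq[OF W.stable_zero[OF Z_sub] st sc Z_sub _ stableD(1)[OF st] eq[symmetric]])
    show "{\<zero>\<^bsub>W\<^esub>} \<subseteq> f ` carrier W" using stableD(2)[OF st] by simp
    show "len Z W (carrier W) \<noteq> \<infinity>" using assms(2) unfolding zfinite_def .
  qed
  moreover have "inj_on f (carrier W)" by (rule inj_on_kernel[OF assms(1,1,3) inj])
  ultimately show ?thesis by (simp add: bij_betw_def)
qed

text \<open>
  The summands are removed one by one. If \<open>x = b c\<close> is nilpotent, then \<open>1 - x\<close> is invertible with inverse \<open>u\<close>,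
  and \<open>1 = \<Sum> b\<^sub>i c\<^sub>i u\<close> over the remaining summands; each \<open>b\<^sub>i (c\<^sub>i u)\<close> is again a factorisation through \<open>W'\<close>,
  hence nilpotent.
\<close>

lemma nilpotent_factorisations_imp_zero:
  assumes lm: "left_module R W" "left_module R W'" and fin: "zfinite W"
    and nil: "\<And>b c. b \<in> mod_hom R W' W \<Longrightarrow> c \<in> mod_hom R W W' \<Longrightarrow> \<exists>k. \<forall>w\<in>carrier W. ((\<lambda>w. b (c w)) ^^ k) w = \<zero>\<^bsub>W\<^esub>"
    and S: "finite S" "S \<subseteq> mod_hom R W' W" "\<And>b. b \<in> S \<Longrightarrow> c b \<in> mod_hom R W W'"
    and sum: "\<And>w. w \<in> carrier W \<Longrightarrow> w = (\<Oplus>\<^bsub>W\<^esub>b\<in>S. b (c b w))"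
  shows "carrier W = {\<zero>\<^bsub>W\<^esub>}"
  using S sum
proof (induction S arbitrary: c rule: finite_induct)
  interpret W: left_module R W by fact
  case empty
  have "w = \<zero>\<^bsub>W\<^esub>" if "w \<in> carrier W" for w using empty.prems(3)[OF that] W.M.finsum_empty by metis
  then show ?case by (intro equalityI subsetI) (simp_all del: W.M.zero_closed, simp)
next
  interpret W: left_module R W by fact
  case (insert b S)
  have bh: "b \<in> mod_hom R W' W" and ch: "c b \<in> mod_hom R W W'" using insert.prems by auto
  let ?x = "\<lambda>w. b (c b w)"
  obtain k where k: "\<And>w. w \<in> carrier W \<Longrightarrow> (?x ^^ k) w = \<zero>\<^bsub>W\<^esub>" using nil[OF bh ch] by blast
  have xh: "compose (carrier W) b (c b) \<in> mod_hom R W W" by (rule mod_hom_compose[OF lm(1) ch bh])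
  let ?d = "\<lambda>w\<in>carrier W. w \<ominus>\<^bsub>W\<^esub> compose (carrier W) b (c b) w"
  have dh: "?d \<in> mod_hom R W W" by (rule minus_hom[OF lm(1) xh])
  have xc: "?x w \<in> carrier W" if "w \<in> carrier W" for w using mod_homD(1)[OF xh that] that by (simp add: compose_def)
  have "bij_betw ?d (carrier W) (carrier W)"
  proof (rule injective_endo_bij[OF lm(1) fin dh])
    fix w assume w: "w \<in> carrier W" "?d w = \<zero>\<^bsub>W\<^esub>"
    then have "w = ?x w" using minus_eq_zero_imp[OF lm(1) w(1) xc[OF w(1)]] by (simp add: compose_def)
    then have "(?x ^^ j) w = w" for j by (induction j) auto
    then show "w = \<zero>\<^bsub>W\<^esub>" using k[OF w(1)] by metis
  qed
  from inverse_hom[OF lm(1) dh this] obtain u where u: "u \<in> mod_hom R W W" "\<And>w. w \<in> carrier W \<Longrightarrow> ?d (u w) = w" by metis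
  show ?case
  proof (rule insert.IH)
    show "S \<subseteq> mod_hom R W' W" using insert.prems by auto
    show "compose (carrier W) (c a) u \<in> mod_hom R W W'" if "a \<in> S" for a
      using mod_hom_compose[OF lm(1) u(1) insert.prems(2)] that by auto
  next
    fix w assume w: "w \<in> carrier W"
    have uw: "u w \<in> carrier W" using mod_homD(1)[OF u(1) w] .
    have cl: "a (c a v) \<in> carrier W" if "a \<in> insert b S" "v \<in> carrier W" for a v
      using mod_homD(1)[OF _ mod_homD(1)[OF insert.prems(2)[OF that(1)] that(2)], of a R W] insert.prems(1) that(1) by blast
    have clS: "(\<lambda>a. a (c a (u w))) \<in> S \<rightarrow> carrier W" using cl uw by auto
    let ?s = "\<Oplus>\<^bsub>W\<^esub>a\<in>S. a (c a (u w))"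
    have sc: "?s \<in> carrier W" using clS by simp
    have fs: "(\<Oplus>\<^bsub>W\<^esub>a\<in>insert b S. a (c a (u w))) = ?x (u w) \<oplus>\<^bsub>W\<^esub> ?s"
      by (rule W.M.finsum_insert) (use insert.hyps clS xc[OF uw] in auto)
    have "u w = ?x (u w) \<oplus>\<^bsub>W\<^esub> ?s" by (rule trans[OF insert.prems(3)[OF uw] fs])
    moreover have "w = u w \<ominus>\<^bsub>W\<^esub> ?x (u w)" using u(2)[OF w] uw by (simp add: compose_def)
    ultimately have "w = (?x (u w) \<oplus>\<^bsub>W\<^esub> ?s) \<oplus>\<^bsub>W\<^esub> \<ominus>\<^bsub>W\<^esub> ?x (u w)" by (simp add: a_minus_def)
    also have "\<dots> = ?s" using xc[OF uw] sc by (simp add: W.M.a_ac W.M.r_neg1 W.M.r_neg2)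
    also have "\<dots> = (\<Oplus>\<^bsub>W\<^esub>a\<in>S. a (compose (carrier W) (c a) u w))"
      using clS w by (intro W.M.finsum_cong') (auto simp: compose_def)
    finally show "w = (\<Oplus>\<^bsub>W\<^esub>a\<in>S. a (compose (carrier W) (c a) u w))" .
  qed
qed

text \<open>
  For large \<open>k\<close> the power \<open>y = x ^^ Suc k\<close> is bijective on its image \<open>M\<close>. The map \<open>z\<close> is the projection onto \<open>M\<close> along
  the kernel of \<open>y\<close>, followed by the inverse of \<open>y\<close> on \<open>M\<close>; it exists and is linear because \<open>z w\<close> is
  the only \<open>m \<in> M\<close> with \<open>y (y m) = y w\<close>. Then \<open>y z\<close> is a nonzero idempotent.
\<close>

lemma fitting:
  assumes lm: "left_module R W" and fin: "zfinite W" and x: "lin (carrier R) W W (carrier W) x"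
    and nn: "\<And>k. \<exists>w\<in>carrier W. (x ^^ k) w \<noteq> \<zero>\<^bsub>W\<^esub>"
  obtains k z where "z \<in> mod_hom R W W" "\<And>w. w \<in> carrier W \<Longrightarrow> z ((x ^^ Suc k) (z w)) = z w"
    "\<exists>w\<in>carrier W. z w \<noteq> \<zero>\<^bsub>W\<^esub>"
proof -
  interpret W: left_module R W by fact
  note scR = W.stable_carrier[OF subset_refl] and sc = W.stable_carrier[OF Z_sub]
  have imst: "stable_sub (carrier R) W ((x ^^ j) ` carrier W)" for j
    by (rule lin_stable_image(3)[OF lm lm subset_refl lin_funpow[OF x] scR scR subset_refl])
  define l where "l k = the_enat (len Z W ((x ^^ Suc k) ` carrier W))" for k
  obtain k where k: "\<And>j. l k \<le> l j" using ex_has_least_nat[of "\<lambda>_. True" 0 l] by auto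
  define y where "y = x ^^ Suc k"
  define M where "M = y ` carrier W"
  have yl: "lin (carrier R) W W (carrier W) y" unfolding y_def by (rule lin_funpow[OF x])
  have ycl: "\<And>w. w \<in> carrier W \<Longrightarrow> y w \<in> carrier W"
    and yad: "\<And>v w. v \<in> carrier W \<Longrightarrow> w \<in> carrier W \<Longrightarrow> y (v \<oplus>\<^bsub>W\<^esub> w) = y v \<oplus>\<^bsub>W\<^esub> y w"
    and ysm: "\<And>a w. a \<in> carrier R \<Longrightarrow> w \<in> carrier W \<Longrightarrow> y (a \<odot>\<^bsub>W\<^esub> w) = a \<odot>\<^bsub>W\<^esub> y w"
    using yl by (auto simp: lin_def)
  note y0 = lin_stable_image(1)[OF lm lm subset_refl yl scR] and yneg = lin_stable_image(2)[OF lm lm subset_refl yl scR]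
  have MR: "stable_sub (carrier R) W M" using imst[of "Suc k"] by (simp only: M_def y_def)
  have M: "stable_sub Z W M" by (rule stable_mono[OF MR Z_sub])
  have Mc: "\<And>m. m \<in> M \<Longrightarrow> m \<in> carrier W" using stableD(5)[OF M] .
  have ylM: "lin Z W W M y" using yl Z_sub Mc unfolding lin_def by blast
  have yM: "stable_sub Z W (y ` M)" by (rule lin_stable_image(3)[OF lm lm Z_sub ylM M M subset_refl])
  have yy: "y ` M = (x ^^ Suc (Suc (k + k))) ` carrier W"
  proof -
    have "y (y w) = (x ^^ Suc (Suc (k + k))) w" for w
      using fun_cong[OF funpow_add[of "Suc k" "Suc k" x], of w] by (simp add: y_def)
    then show ?thesis unfolding M_def by (simp only: image_image)
  qed
  have Mfin: "len Z W M \<noteq> \<infinity>" by (rule zfinite_sub[OF fin stableD(1)[OF M]])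
  have yMM: "y ` M = M"
  proof (rule ccontr)
    assume "y ` M \<noteq> M"
    moreover have "y ` M \<subseteq> M" using Mc unfolding M_def by auto
    ultimately have "len Z W (y ` M) < len Z W M" using len_strict[OF lm yM M _ Mfin] by blast
    then have "the_enat (len Z W (y ` M)) < the_enat (len Z W M)"
      using Mfin by (cases "len Z W (y ` M)"; cases "len Z W M") auto
    then show False using k[of "Suc (k + k)"] unfolding l_def yy[symmetric] by (simp add: M_def y_def)
  qed
  have "len Z W M = len Z W {m \<in> M. y m = \<zero>\<^bsub>W\<^esub>} + len Z W M"
    using rank_nullity[OF lm lm Z_sub ylM M] unfolding yMM .
  then have "len Z W {m \<in> M. y m = \<zero>\<^bsub>W\<^esub>} = 0"
    using Mfin by (cases "len Z W M"; cases "len Z W {m \<in> M. y m = \<zero>\<^bsub>W\<^esub>}") (auto simp: zero_enat_def)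
  moreover have "stable_sub Z W {m \<in> M. y m \<in> {\<zero>\<^bsub>W\<^esub>}}"
    by (rule lin_stable_image(4)[OF lm lm Z_sub ylM M W.stable_zero[OF Z_sub]])
  ultimately have "{m \<in> M. y m = \<zero>\<^bsub>W\<^esub>} = {\<zero>\<^bsub>W\<^esub>}" using len_zero_imp[OF lm] by simp
  then have ker: "m = \<zero>\<^bsub>W\<^esub>" if "m \<in> M" "y m = \<zero>\<^bsub>W\<^esub>" for m using that by blast
  have yMcl: "y m \<in> M" if "m \<in> M" for m using that yMM by blast
  have uniq: "m = n" if mn: "m \<in> M" "n \<in> M" and e: "y (y m) = y (y n)" for m n
  proof -
    have d: "m \<ominus>\<^bsub>W\<^esub> n \<in> M" by (rule W.stable_minus[OF M mn])
    have "y (y (m \<ominus>\<^bsub>W\<^esub> n)) = y (y m) \<oplus>\<^bsub>W\<^esub> \<ominus>\<^bsub>W\<^esub> y (y n)"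
      using mn Mc ycl by (simp add: a_minus_def yad yneg)
    also have "\<dots> = \<zero>\<^bsub>W\<^esub>" unfolding e using mn Mc ycl by (simp add: W.M.r_neg)
    finally have "m \<ominus>\<^bsub>W\<^esub> n = \<zero>\<^bsub>W\<^esub>" using ker d yMcl by blast
    then show ?thesis using minus_eq_zero_imp[OF lm] mn Mc by blast
  qed
  have ex: "\<exists>m. m \<in> M \<and> y (y m) = y w" if w: "w \<in> carrier W" for w
  proof -
    have "y w \<in> y ` (y ` M)" unfolding yMM using w by (simp add: M_def)
    then show ?thesis by auto
  qed
  define z where "z = (\<lambda>w\<in>carrier W. SOME m. m \<in> M \<and> y (y m) = y w)"
  have z: "z w \<in> M" "y (y (z w)) = y w" if "w \<in> carrier W" for w
    using someI_ex[OF ex[OF that]] that by (simp_all add: z_def)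
  have zI: "z w = m" if "w \<in> carrier W" "m \<in> M" "y (y m) = y w" for w m
    using uniq z that by simp
  have zh: "z \<in> mod_hom R W W"
  proof (rule mod_homI)
    show "\<And>w. w \<in> carrier W \<Longrightarrow> z w \<in> carrier W" using z Mc by blast
  next
    fix v w assume vw: "v \<in> carrier W" "w \<in> carrier W"
    note m = z(1)[OF vw(1)] z(1)[OF vw(2)]
    show "z (v \<oplus>\<^bsub>W\<^esub> w) = z v \<oplus>\<^bsub>W\<^esub> z w"
      by (rule zI) (use vw m Mc z(2) ycl in \<open>simp_all add: yad stableD(3)[OF M]\<close>)
  next
    fix a w assume aw: "a \<in> carrier R" "w \<in> carrier W"
    note m = z(1)[OF aw(2)]
    show "z (a \<odot>\<^bsub>W\<^esub> w) = a \<odot>\<^bsub>W\<^esub> z w"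
      by (rule zI) (use aw m Mc z(2) ycl in \<open>simp_all add: ysm W.smult_closed stableD(4)[OF MR]\<close>)
  qed (simp add: z_def)
  have zyz: "z (y (z w)) = z w" if w: "w \<in> carrier W" for w
    by (rule zI) (use z(1)[OF w] Mc ycl in auto)
  have nz: "\<exists>w\<in>carrier W. z w \<noteq> \<zero>\<^bsub>W\<^esub>"
  proof -
    obtain w where w: "w \<in> carrier W" "y w \<noteq> \<zero>\<^bsub>W\<^esub>" using nn[of "Suc k"] by (auto simp: y_def simp del: funpow.simps)
    then have "z w \<noteq> \<zero>\<^bsub>W\<^esub>" using z(2)[OF w(1)] y0 by auto
    then show ?thesis using w by blast
  qed
  show ?thesis using that[OF zh, of k] zyz nz unfolding y_def by blast
qed

text \<open>
  From \<open>q b q = q\<close> it follows that \<open>b q\<close> and \<open>q b\<close> are idempotents, and \<open>q\<close> and \<open>b\<close> identify the summands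
  onto which they project.
\<close>

lemma common_summand:
  assumes lm: "left_module R W" "left_module R W'" and fin: "zfinite W"
    and b: "b \<in> mod_hom R W' W" and c: "c \<in> mod_hom R W W'"
    and nn: "\<And>k. \<exists>w\<in>carrier W. ((\<lambda>w. b (c w)) ^^ k) w \<noteq> \<zero>\<^bsub>W\<^esub>"
  obtains q where "q \<in> mod_hom R W W'" "\<And>w. w \<in> carrier W \<Longrightarrow> q (b (q w)) = q w"
    "\<exists>w\<in>carrier W. b (q w) \<noteq> \<zero>\<^bsub>W\<^esub>"
proof -
  interpret W: left_module R W by fact
  let ?x = "\<lambda>w. b (c w)"
  have x: "lin (carrier R) W W (carrier W) ?x"
    unfolding lin_def using mod_homD(1-3)[OF b] mod_homD(1-3)[OF c] by auto
  from fitting[OF lm(1) fin x nn] obtain k z where z: "z \<in> mod_hom R W W"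
    "\<And>w. w \<in> carrier W \<Longrightarrow> z ((?x ^^ Suc k) (z w)) = z w" "\<exists>w\<in>carrier W. z w \<noteq> \<zero>\<^bsub>W\<^esub>" by metis
  have xk: "lin (carrier R) W W (carrier W) (?x ^^ k)" by (rule lin_funpow[OF x])
  define q where "q = (\<lambda>w\<in>carrier W. c ((?x ^^ k) (z w)))"
  have zc: "z w \<in> carrier W" if "w \<in> carrier W" for w using mod_homD(1)[OF z(1) that] .
  have xc: "(?x ^^ k) w \<in> carrier W" if "w \<in> carrier W" for w using xk that by (auto simp: lin_def)
  have q: "q \<in> mod_hom R W W'"
    using xk xc zc by (intro mod_homI) (auto simp: q_def lin_def mod_homD(1-3)[OF c] mod_homD(2,3)[OF z(1)] W.smult_closed)
  have bq: "b (q w) = (?x ^^ Suc k) (z w)" if "w \<in> carrier W" for w using that by (simp add: q_def)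
  have bqc: "b (q w) \<in> carrier W" if "w \<in> carrier W" for w using mod_homD(1)[OF b mod_homD(1)[OF q that]] .
  have zbq: "z (b (q w)) = z w" if "w \<in> carrier W" for w unfolding bq[OF that] by (rule z(2)[OF that])
  have "q (b (q w)) = q w" if w: "w \<in> carrier W" for w
    unfolding q_def using zbq[OF w] bqc[OF w] w unfolding q_def by simp
  moreover have "\<exists>w\<in>carrier W. b (q w) \<noteq> \<zero>\<^bsub>W\<^esub>"
    using z(3) zbq mod_hom_arith(1)[OF lm(1,1) z(1)] by metis
  ultimately show ?thesis using that q by blast
qed

lemma fixed_eq_image:
  assumes lm: "left_module R W" "left_module R X" and e: "e \<in> mod_hom R W W" "\<And>w. w \<in> carrier W \<Longrightarrow> e (e w) = e w"
  shows "{\<phi> \<in> mod_hom R W X. \<forall>w\<in>carrier W. \<phi> (e w) = \<phi> w} = (\<lambda>\<phi>. compose (carrier W) \<phi> e) ` mod_hom R W X"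
proof
  show "{\<phi> \<in> mod_hom R W X. \<forall>w\<in>carrier W. \<phi> (e w) = \<phi> w} \<subseteq> (\<lambda>\<phi>. compose (carrier W) \<phi> e) ` mod_hom R W X"
  proof
    fix \<phi> assume p: "\<phi> \<in> {\<phi> \<in> mod_hom R W X. \<forall>w\<in>carrier W. \<phi> (e w) = \<phi> w}"
    then have "\<phi> = compose (carrier W) \<phi> e"
      by (intro mod_hom_eqI[OF _ mod_hom_compose[OF lm(1) e(1)]]) (auto simp: compose_def)
    then show "\<phi> \<in> (\<lambda>\<phi>. compose (carrier W) \<phi> e) ` mod_hom R W X" using p by blast
  qed
  show "(\<lambda>\<phi>. compose (carrier W) \<phi> e) ` mod_hom R W X \<subseteq> {\<phi> \<in> mod_hom R W X. \<forall>w\<in>carrier W. \<phi> (e w) = \<phi> w}"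
    using mod_hom_compose[OF lm(1) e(1)] mod_homD(1)[OF e(1)] e(2) by (auto simp: compose_def)
qed

lemma fixed_stable:
  assumes lm: "left_module R W" "left_module R X" and e: "e \<in> mod_hom R W W" "\<And>w. w \<in> carrier W \<Longrightarrow> e (e w) = e w"
  shows "stable_sub Z (fun_mod (carrier W) X) {\<phi> \<in> mod_hom R W X. \<forall>w\<in>carrier W. \<phi> (e w) = \<phi> w}"
proof -
  have eq: "{\<phi> \<in> mod_hom R W X. \<forall>w\<in>carrier W. \<phi> (e w) = \<phi> w} = (\<lambda>\<phi>. compose (carrier W) \<phi> e) ` mod_hom R W X"
    by (rule fixed_eq_image) fact+
  show ?thesis unfolding eq
    by (rule lin_stable_image(3)[OF left_module_fun_mod[OF lm(2)] left_module_fun_mod[OF lm(2)] Z_sub precomp_lin[OF lm(1) e(1) lm(1)]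
        mod_hom_stable[OF lm] mod_hom_stable[OF lm] subset_refl])
qed

lemma kernel_module:
  assumes "left_module R W" "left_module R V" "e \<in> mod_hom R W V"
  shows "left_module R (W\<lparr>carrier := {w \<in> carrier W. e w = \<zero>\<^bsub>V\<^esub>}\<rparr>)"
proof -
  interpret W: left_module R W by fact
  interpret V: left_module R V by fact
  have "stable_sub (carrier R) W {w \<in> carrier W. e w \<in> {\<zero>\<^bsub>V\<^esub>}}"
    by (rule lin_stable_image(4)[OF assms(1,2) subset_refl mod_hom_lin[OF assms(3) subset_refl]
      W.stable_carrier[OF subset_refl] V.stable_zero[OF subset_refl]])
  from left_module_restrict[OF assms(1) this] show ?thesis by simp
qed

text \<open>
  The decomposition of \<open>W\<close> into the image and the kernel of \<open>e\<close>; maps out of the image are represented by the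
  maps \<open>\<phi>\<close> with \<open>\<phi> e = \<phi>\<close>.
\<close>

lemma hom_len_idempotent:
  assumes lm: "left_module R W" "left_module R X" and e: "e \<in> mod_hom R W W" "\<And>w. w \<in> carrier W \<Longrightarrow> e (e w) = e w"
  shows "hom_len W X = len Z (fun_mod (carrier W) X) {\<phi> \<in> mod_hom R W X. \<forall>w\<in>carrier W. \<phi> (e w) = \<phi> w}
     + hom_len (W\<lparr>carrier := {w \<in> carrier W. e w = \<zero>\<^bsub>W\<^esub>}\<rparr>) X"
proof -
  interpret W: left_module R W by fact
  interpret X: left_module R X by fact
  let ?N = "{w \<in> carrier W. e w = \<zero>\<^bsub>W\<^esub>}"
  let ?WN = "W\<lparr>carrier := ?N\<rparr>"
  have lN: "left_module R ?WN" by (rule kernel_module[OF lm(1,1) e(1)])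
  let ?d = "\<lambda>w\<in>carrier W. w \<ominus>\<^bsub>W\<^esub> e w"
  have ec: "e w \<in> carrier W" if "w \<in> carrier W" for w using mod_homD(1)[OF e(1) that] .
  have dN: "?d w \<in> ?N" if w: "w \<in> carrier W" for w
  proof -
    have "e (w \<ominus>\<^bsub>W\<^esub> e w) = e w \<ominus>\<^bsub>W\<^esub> e w" using mod_hom_arith(3)[OF lm(1,1) e(1) w ec[OF w]] e(2)[OF w] by simp
    also have "\<dots> = \<zero>\<^bsub>W\<^esub>" using ec[OF w] by (simp add: a_minus_def W.M.r_neg)
    finally show ?thesis using w ec[OF w] by (simp add: a_minus_def)
  qed
  have dh: "?d \<in> mod_hom R W ?WN"
    using minus_hom[OF lm(1) e(1)] dN by (subst restrict_hom_iff) auto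
  let ?\<rho> = "\<lambda>\<phi>. restrict \<phi> ?N"
  have lin: "lin Z (fun_mod (carrier W) X) (fun_mod ?N X) (mod_hom R W X) ?\<rho>"
    unfolding lin_def
  proof (intro conjI ballI funcsetI)
    fix \<phi> assume "\<phi> \<in> mod_hom R W X"
    then show "?\<rho> \<phi> \<in> carrier (fun_mod ?N X)" using mod_homD(1) by fastforce
  qed (auto simp: fun_eq_iff)
  have ker: "{\<phi> \<in> mod_hom R W X. ?\<rho> \<phi> = \<zero>\<^bsub>fun_mod ?N X\<^esub>} = {\<phi> \<in> mod_hom R W X. \<forall>w\<in>carrier W. \<phi> (e w) = \<phi> w}"
  proof -
    have "?\<rho> \<phi> = \<zero>\<^bsub>fun_mod ?N X\<^esub> \<longleftrightarrow> (\<forall>w\<in>carrier W. \<phi> (e w) = \<phi> w)" if p: "\<phi> \<in> mod_hom R W X" for \<phi>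
    proof
      assume z: "?\<rho> \<phi> = \<zero>\<^bsub>fun_mod ?N X\<^esub>"
      show "\<forall>w\<in>carrier W. \<phi> (e w) = \<phi> w"
      proof
        fix w assume w: "w \<in> carrier W"
        have "\<phi> w \<ominus>\<^bsub>X\<^esub> \<phi> (e w) = \<phi> (w \<ominus>\<^bsub>W\<^esub> e w)" using mod_hom_arith(3)[OF lm p w ec[OF w]] by simp
        also have "\<dots> = \<zero>\<^bsub>X\<^esub>" using fun_cong[OF z, of "w \<ominus>\<^bsub>W\<^esub> e w"] dN[OF w] w by simp
        finally show "\<phi> (e w) = \<phi> w"
          using minus_eq_zero_imp[OF lm(2)] mod_homD(1)[OF p] w ec[OF w] by metis
      qed
    next
      assume "\<forall>w\<in>carrier W. \<phi> (e w) = \<phi> w"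
      then have "\<phi> w = \<zero>\<^bsub>X\<^esub>" if "w \<in> ?N" for w using that mod_hom_arith(1)[OF lm p] by force
      then show "?\<rho> \<phi> = \<zero>\<^bsub>fun_mod ?N X\<^esub>" by (auto simp: fun_eq_iff)
    qed
    then show ?thesis by blast
  qed
  have im: "?\<rho> ` mod_hom R W X = mod_hom R ?WN X"
  proof
    show "?\<rho> ` mod_hom R W X \<subseteq> mod_hom R ?WN X" using restrict_dom_hom[OF _ _ lN] by blast
    show "mod_hom R ?WN X \<subseteq> ?\<rho> ` mod_hom R W X"
    proof
      fix \<psi> assume ps: "\<psi> \<in> mod_hom R ?WN X"
      have "compose (carrier W) \<psi> ?d \<in> mod_hom R W X" by (rule mod_hom_compose[OF lm(1) dh ps])
      moreover have "\<psi> = ?\<rho> (compose (carrier W) \<psi> ?d)"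
      proof (rule ext)
        fix w show "\<psi> w = ?\<rho> (compose (carrier W) \<psi> ?d) w"
          using mod_homD(4)[OF ps, of w] by (cases "w \<in> ?N") (auto simp: compose_def a_minus_def W.M.add.inv_one W.M.minus_equality[of "\<zero>\<^bsub>W\<^esub>" "\<zero>\<^bsub>W\<^esub>"])
      qed
      ultimately show "\<psi> \<in> ?\<rho> ` mod_hom R W X" by blast
    qed
  qed
  have "hom_len ?WN X = len Z (fun_mod ?N X) (mod_hom R ?WN X)" by (simp add: hom_len_def)
  moreover note rank_nullity[OF left_module_fun_mod[OF lm(2)] left_module_fun_mod[OF lm(2)] Z_sub lin mod_hom_stable[OF lm], unfolded ker im]
  ultimately show ?thesis unfolding hom_len_def[of W X] by (simp only:)
qed

text \<open>
  Composition with \<open>p\<close> and with \<open>q\<close> gives inverse bijections between maps fixed by \<open>p q\<close> and maps fixed by \<open>q p\<close>.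
\<close>

lemma fixed_len_swap:
  assumes lm: "left_module R W" "left_module R W'" "left_module R X"
    and p: "p \<in> mod_hom R W' W" and q: "q \<in> mod_hom R W W'" and qpq: "\<And>w. w \<in> carrier W \<Longrightarrow> q (p (q w)) = q w"
  shows "len Z (fun_mod (carrier W) X) {\<phi> \<in> mod_hom R W X. \<forall>w\<in>carrier W. \<phi> (compose (carrier W) p q w) = \<phi> w}
     = len Z (fun_mod (carrier W') X) {\<phi> \<in> mod_hom R W' X. \<forall>w\<in>carrier W'. \<phi> (compose (carrier W') q p w) = \<phi> w}"
    (is "len Z ?F ?A = len Z ?F' ?A'")
proof -
  interpret X: left_module R X by fact
  have pc: "\<And>w. w \<in> carrier W' \<Longrightarrow> p w \<in> carrier W" and qc: "\<And>w. w \<in> carrier W \<Longrightarrow> q w \<in> carrier W'"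
    using mod_homD(1)[OF p] mod_homD(1)[OF q] by auto
  have eh: "compose (carrier W) p q \<in> mod_hom R W W" by (rule mod_hom_compose[OF lm(1) q p])
  have st: "stable_sub Z ?F ?A"
    by (rule fixed_stable[OF lm(1,3) eh]) (simp add: compose_def pc qc qpq)
  have lin: "lin Z ?F ?F' ?A (\<lambda>\<phi>. compose (carrier W') \<phi> p)"
    by (rule lin_subset[OF precomp_lin[OF lm(2) p lm(1)]]) auto
  have "len Z ?F ?A = len Z ?F' ((\<lambda>\<phi>. compose (carrier W') \<phi> p) ` ?A)"
  proof (rule len_inj[OF left_module_fun_mod[OF lm(3)] left_module_fun_mod[OF lm(3)] Z_sub lin st])
    fix \<phi> assume f: "\<phi> \<in> ?A" and z: "compose (carrier W') \<phi> p = \<zero>\<^bsub>?F'\<^esub>"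
    have "\<phi> w = \<zero>\<^bsub>X\<^esub>" if w: "w \<in> carrier W" for w
      using f w fun_cong[OF z, of "q w"] qc[OF w] by (auto simp: compose_def)
    moreover have "\<phi> w = undefined" if "w \<notin> carrier W" for w using f mod_homD(4)[of \<phi> R W X] that by blast
    ultimately show "\<phi> = \<zero>\<^bsub>?F\<^esub>" by (auto simp: fun_eq_iff)
  qed
  also have "(\<lambda>\<phi>. compose (carrier W') \<phi> p) ` ?A = ?A'"
  proof
    show "(\<lambda>\<phi>. compose (carrier W') \<phi> p) ` ?A \<subseteq> ?A'"
      using mod_hom_compose[OF lm(2) p] by (auto simp: compose_def pc qc)
    show "?A' \<subseteq> (\<lambda>\<phi>. compose (carrier W') \<phi> p) ` ?A"
    proof
      fix \<psi> assume ps: "\<psi> \<in> ?A'"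
      then have ph: "\<psi> \<in> mod_hom R W' X" by simp
      have ch: "compose (carrier W) \<psi> q \<in> mod_hom R W X" by (rule mod_hom_compose[OF lm(1) q ph])
      have "compose (carrier W) \<psi> q \<in> ?A" using ch by (auto simp: compose_def pc qc qpq)
      moreover have "\<psi> = compose (carrier W') (compose (carrier W) \<psi> q) p"
        by (rule mod_hom_eqI[OF ph mod_hom_compose[OF lm(2) p ch]]) (use ps in \<open>auto simp: compose_def pc qc\<close>)
      ultimately show "\<psi> \<in> (\<lambda>\<phi>. compose (carrier W') \<phi> p) ` ?A" by blast
    qed
  qed
  finally show ?thesis .
qed

lemma hom_len_cancel:
  assumes lm: "left_module R W" "left_module R W'" "left_module R X" and fin: "zfinite W" "zfinite X"
    and p: "p \<in> mod_hom R W' W" and q: "q \<in> mod_hom R W W'" and qpq: "\<And>w. w \<in> carrier W \<Longrightarrow> q (p (q w)) = q w"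
    and eq: "hom_len W X = hom_len W' X"
  shows "hom_len (W\<lparr>carrier := {w \<in> carrier W. compose (carrier W) p q w = \<zero>\<^bsub>W\<^esub>}\<rparr>) X
    = hom_len (W'\<lparr>carrier := {w \<in> carrier W'. compose (carrier W') q p w = \<zero>\<^bsub>W'\<^esub>}\<rparr>) X"
proof -
  have pc: "\<And>w. w \<in> carrier W' \<Longrightarrow> p w \<in> carrier W" and qc: "\<And>w. w \<in> carrier W \<Longrightarrow> q w \<in> carrier W'"
    using mod_homD(1)[OF p] mod_homD(1)[OF q] by auto
  let ?e = "compose (carrier W) p q" and ?e' = "compose (carrier W') q p"
  have e: "?e (?e w) = ?e w" if "w \<in> carrier W" for w using that by (simp add: compose_def pc qc qpq)
  have e': "?e' (?e' w) = ?e' w" if "w \<in> carrier W'" for w using that by (simp add: compose_def pc qc qpq)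
  let ?A = "len Z (fun_mod (carrier W) X) {\<phi> \<in> mod_hom R W X. \<forall>w\<in>carrier W. \<phi> (?e w) = \<phi> w}"
  have d: "hom_len W X = ?A + hom_len (W\<lparr>carrier := {w \<in> carrier W. ?e w = \<zero>\<^bsub>W\<^esub>}\<rparr>) X"
    by (rule hom_len_idempotent[OF lm(1,3) mod_hom_compose[OF lm(1) q p]]) (rule e)
  have s: "?A = len Z (fun_mod (carrier W') X) {\<phi> \<in> mod_hom R W' X. \<forall>w\<in>carrier W'. \<phi> (?e' w) = \<phi> w}"
    by (rule fixed_len_swap[OF lm p q]) (rule qpq)
  have d': "hom_len W' X = ?A + hom_len (W'\<lparr>carrier := {w \<in> carrier W'. ?e' w = \<zero>\<^bsub>W'\<^esub>}\<rparr>) X"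
    unfolding s by (rule hom_len_idempotent[OF lm(2,3) mod_hom_compose[OF lm(2) p q]]) (rule e')
  have f: "hom_len W X \<noteq> \<infinity>" by (rule hom_len_finite) fact+
  have "?A \<noteq> \<infinity>" using enat_summand_finite[OF d f] by blast
  then show ?thesis using trans[OF trans[OF d[symmetric] eq] d'] by (simp only: enat_add_left_cancel) blast
qed

text \<open>
  The isomorphism is \<open>q\<close> on the image of \<open>p q\<close> and the given one on its kernel.
\<close>

lemma glue_isomorphism:
  assumes lm: "left_module R W" "left_module R W'"
    and p: "p \<in> mod_hom R W' W" and q: "q \<in> mod_hom R W W'" and qpq: "\<And>w. w \<in> carrier W \<Longrightarrow> q (p (q w)) = q w"
    and iso: "mod_isomorphic R (W\<lparr>carrier := {w \<in> carrier W. compose (carrier W) p q w = \<zero>\<^bsub>W\<^esub>}\<rparr>)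
      (W'\<lparr>carrier := {w \<in> carrier W'. compose (carrier W') q p w = \<zero>\<^bsub>W'\<^esub>}\<rparr>)"
  shows "mod_isomorphic R W W'"
proof -
  interpret W: left_module R W by fact
  interpret W': left_module R W' by fact
  have pc: "\<And>w. w \<in> carrier W' \<Longrightarrow> p w \<in> carrier W" and qc: "\<And>w. w \<in> carrier W \<Longrightarrow> q w \<in> carrier W'"
    using mod_homD(1)[OF p] mod_homD(1)[OF q] by auto
  let ?N = "{w \<in> carrier W. compose (carrier W) p q w = \<zero>\<^bsub>W\<^esub>}" and ?N' = "{w \<in> carrier W'. compose (carrier W') q p w = \<zero>\<^bsub>W'\<^esub>}"
  obtain \<psi> where ps: "\<psi> \<in> mod_hom R (W\<lparr>carrier := ?N\<rparr>) (W'\<lparr>carrier := ?N'\<rparr>)" and bij: "bij_betw \<psi> ?N ?N'"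
    using iso by (auto simp: mod_isomorphic_def)
  have psW: "\<psi> \<in> mod_hom R (W\<lparr>carrier := ?N\<rparr>) W'" using ps by (subst (asm) restrict_hom_iff) auto
  note q0 = mod_hom_arith(1)[OF lm q] and p0 = mod_hom_arith(1)[OF lm(2,1) p]
  have psc: "\<psi> w \<in> carrier W'" "q (p (\<psi> w)) = \<zero>\<^bsub>W'\<^esub>" if "w \<in> ?N" for w
    using mod_homD(1)[OF ps, of w] that by (auto simp: compose_def)
  have qN: "q w = \<zero>\<^bsub>W'\<^esub>" if "w \<in> ?N" for w
    using qpq[of w] that q0 by (auto simp: compose_def)
  let ?e = "compose (carrier W) p q"
  have eh: "?e \<in> mod_hom R W W" by (rule mod_hom_compose[OF lm(1) q p])
  define d where "d w = w \<ominus>\<^bsub>W\<^esub> p (q w)" for w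
  have dN: "d w \<in> ?N" if w: "w \<in> carrier W" for w
  proof -
    have "q (d w) = q w \<ominus>\<^bsub>W'\<^esub> q (p (q w))" unfolding d_def using mod_hom_arith(3)[OF lm q w] pc qc w by blast
    also have "\<dots> = \<zero>\<^bsub>W'\<^esub>" using qpq[OF w] qc[OF w] by (simp add: a_minus_def W'.M.r_neg)
    finally show ?thesis using p0 w pc qc by (simp add: compose_def d_def a_minus_def)
  qed
  have re: "restrict d (carrier W) = (\<lambda>w\<in>carrier W. w \<ominus>\<^bsub>W\<^esub> ?e w)" by (auto simp: fun_eq_iff d_def compose_def)
  have "restrict d (carrier W) y \<in> ?N" if "y \<in> carrier W" for y unfolding restrict_apply'[OF that] by (rule dN[OF that])
  moreover have "restrict d (carrier W) \<in> mod_hom R W W" unfolding re by (rule minus_hom[OF lm(1) eh])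
  moreover have "?N \<subseteq> carrier W" by blast
  ultimately have dh: "restrict d (carrier W) \<in> mod_hom R W (W\<lparr>carrier := ?N\<rparr>)" using restrict_hom_iff by blast
  define \<theta> where "\<theta> = (\<lambda>w\<in>carrier W. q w \<oplus>\<^bsub>W'\<^esub> \<psi> (d w))"
  have pd: "compose (carrier W) \<psi> (restrict d (carrier W)) \<in> mod_hom R W W'" by (rule mod_hom_compose[OF lm(1) dh psW])
  have th: "\<theta> \<in> mod_hom R W W'"
  proof (rule mod_homI)
    fix w assume "w \<in> carrier W" then show "\<theta> w \<in> carrier W'" using psc(1)[OF dN] qc by (simp add: \<theta>_def)
  next
    fix v w assume vw: "v \<in> carrier W" "w \<in> carrier W"
    then have "\<psi> (d (v \<oplus>\<^bsub>W\<^esub> w)) = \<psi> (d v) \<oplus>\<^bsub>W'\<^esub> \<psi> (d w)" using mod_homD(2)[OF pd vw] by (simp add: compose_def)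
    then show "\<theta> (v \<oplus>\<^bsub>W\<^esub> w) = \<theta> v \<oplus>\<^bsub>W'\<^esub> \<theta> w"
      using vw mod_homD(2)[OF q vw] psc(1)[OF dN] qc by (simp add: \<theta>_def W'.M.a_ac)
  next
    fix a w assume aw: "a \<in> carrier R" "w \<in> carrier W"
    then have "\<psi> (d (a \<odot>\<^bsub>W\<^esub> w)) = a \<odot>\<^bsub>W'\<^esub> \<psi> (d w)" using mod_homD(3)[OF pd aw] W.smult_closed by (simp add: compose_def)
    then show "\<theta> (a \<odot>\<^bsub>W\<^esub> w) = a \<odot>\<^bsub>W'\<^esub> \<theta> w"
      using aw mod_homD(3)[OF q aw] psc(1)[OF dN] qc W.smult_closed by (simp add: \<theta>_def W'.smult_r_distr)
  qed (simp add: \<theta>_def)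
  have "inj_on \<theta> (carrier W)"
  proof (rule inj_on_kernel[OF lm th])
    fix w assume w: "w \<in> carrier W" and z: "\<theta> w = \<zero>\<^bsub>W'\<^esub>"
    have "q (p (\<theta> w)) = q (p (q w)) \<oplus>\<^bsub>W'\<^esub> q (p (\<psi> (d w)))"
      using w psc(1)[OF dN[OF w]] pc qc mod_homD(2)[OF p] mod_homD(2)[OF q] by (simp add: \<theta>_def)
    then have qw: "q w = \<zero>\<^bsub>W'\<^esub>" using z p0 q0 psc(2)[OF dN[OF w]] qpq[OF w] qc[OF w] by simp
    then have dw: "d w = w" using p0 w by (simp add: d_def a_minus_def W.M.minus_equality[of "\<zero>\<^bsub>W\<^esub>" "\<zero>\<^bsub>W\<^esub>"])
    then have a: "\<psi> w = \<zero>\<^bsub>W'\<^esub>" using z qw w psc(1)[OF dN[OF w]] by (simp add: \<theta>_def)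
    have b: "\<psi> \<zero>\<^bsub>W\<^esub> = \<zero>\<^bsub>W'\<^esub>"
      using mod_hom_arith(1)[OF kernel_module[OF lm(1,1) eh] lm(2) psW] by simp
    have c: "w \<in> ?N" using dN[OF w] unfolding dw .
    have "\<zero>\<^bsub>W\<^esub> \<in> ?N" using p0 q0 by (auto simp: compose_def)
    from inj_onD[OF bij_betw_imp_inj_on[OF bij] trans[OF a b[symmetric]] c this] show "w = \<zero>\<^bsub>W\<^esub>" .
  qed
  moreover have "\<theta> ` carrier W = carrier W'"
  proof
    show "\<theta> ` carrier W \<subseteq> carrier W'" using mod_homD(1)[OF th] by blast
    show "carrier W' \<subseteq> \<theta> ` carrier W"
    proof
      fix y assume y: "y \<in> carrier W'"
      let ?f = "q (p y)"
      have fc: "?f \<in> carrier W'" using y pc qc by blast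
      have qpf: "q (p ?f) = ?f" using qpq[OF pc[OF y]] .
      have "q (p (y \<ominus>\<^bsub>W'\<^esub> ?f)) = ?f \<ominus>\<^bsub>W'\<^esub> ?f"
        using mod_hom_arith(3)[OF lm(2,1) p y fc] mod_hom_arith(3)[OF lm q pc[OF y] pc[OF fc]] qpf by simp
      also have "\<dots> = \<zero>\<^bsub>W'\<^esub>" using fc by (simp add: a_minus_def W'.M.r_neg)
      finally have "y \<ominus>\<^bsub>W'\<^esub> ?f \<in> ?N'" using y fc by (simp add: compose_def a_minus_def)
      then obtain n where n: "n \<in> ?N" "\<psi> n = y \<ominus>\<^bsub>W'\<^esub> ?f" using bij_betw_imp_surj_on[OF bij] by (metis (no_types, lifting) imageE)
      have nc: "n \<in> carrier W" using n by simp
      let ?w = "p ?f \<oplus>\<^bsub>W\<^esub> n"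
      have wc: "?w \<in> carrier W" using nc pc[OF fc] by simp
      have qw: "q ?w = ?f" using mod_homD(2)[OF q pc[OF fc] nc] qN[OF n(1)] qpf fc by simp
      have "d ?w = n"
        unfolding d_def qw using pc[OF fc] nc by (simp add: a_minus_def W.M.a_ac W.M.r_neg1 W.M.r_neg2 W.M.r_neg)
      then have "\<theta> ?w = ?f \<oplus>\<^bsub>W'\<^esub> (y \<ominus>\<^bsub>W'\<^esub> ?f)" using wc qw n(2) by (simp add: \<theta>_def)
      also have "\<dots> = y" using y fc by (simp add: a_minus_def W'.M.a_ac W'.M.r_neg1 W'.M.r_neg2 W'.M.r_neg)
      finally show "y \<in> \<theta> ` carrier W" using wc by (metis imageI)
    qed
  qed
  ultimately show ?thesis unfolding mod_isomorphic_def using th by (auto simp: bij_betw_def)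
qed

lemma zero_module_hom:
  assumes lm: "left_module R W" "left_module R X" and z: "carrier W = {\<zero>\<^bsub>W\<^esub>}"
  shows "hom_len W X = 0"
proof -
  interpret F: left_module R "fun_mod (carrier W) X" by (rule left_module_fun_mod[OF lm(2)])
  have "mod_hom R W X \<subseteq> {\<zero>\<^bsub>fun_mod (carrier W) X\<^esub>}"
  proof
    fix \<phi> assume p: "\<phi> \<in> mod_hom R W X"
    then have "\<phi> w = \<zero>\<^bsub>fun_mod (carrier W) X\<^esub> w" for w using mod_hom_arith(1)[OF lm p] mod_homD(4)[OF p, of w] z by (cases "w \<in> carrier W") auto
    then show "\<phi> \<in> {\<zero>\<^bsub>fun_mod (carrier W) X\<^esub>}" by blast
  qed
  then have "mod_hom R W X = {\<zero>\<^bsub>fun_mod (carrier W) X\<^esub>}" using stableD(2)[OF mod_hom_stable[OF lm]] by blast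
  then show ?thesis unfolding hom_len_def by (simp only: F.rlen_self)
qed

lemma hom_len_zero_imp:
  assumes lm: "left_module R W" and z: "hom_len W W = 0"
  shows "carrier W = {\<zero>\<^bsub>W\<^esub>}"
proof -
  interpret W: left_module R W by fact
  have "mod_hom R W W = {\<zero>\<^bsub>fun_mod (carrier W) W\<^esub>}"
    using len_zero_imp[OF left_module_fun_mod[OF lm] mod_hom_stable[OF lm lm]] z unfolding hom_len_def by blast
  then have i: "mod_id W = \<zero>\<^bsub>fun_mod (carrier W) W\<^esub>" using mod_id_hom[OF lm] by blast
  have "w = \<zero>\<^bsub>W\<^esub>" if "w \<in> carrier W" for w using fun_cong[OF i, of w] that by (simp add: mod_id_def)
  then show ?thesis by auto
qed

text \<open>
  The three families of test modules are what the induction uses: the complements of summands inside \<open>W\<close> and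
  \<open>W'\<close> keep their types, and the kernel of a map from a power of \<open>W'\<close> has the third type.
\<close>

theorem isomorphic_if_hom_len_eq:
  fixes W :: "('a, 'w, 'wx) module_scheme" and W' :: "('a, 'w1, 'w1x) module_scheme"
  assumes "left_module R W" "left_module R W'" "zfinite W" "zfinite W'"
    and "\<And>X :: ('a, 'w, 'wx) module_scheme. left_module R X \<Longrightarrow> zfinite X \<Longrightarrow> hom_len W X = hom_len W' X"
    and "\<And>X :: ('a, 'w1, 'w1x) module_scheme. left_module R X \<Longrightarrow> zfinite X \<Longrightarrow> hom_len W X = hom_len W' X"
    and "\<And>X :: ('a, ('w1 \<Rightarrow> 'w) \<Rightarrow> 'w1) module. left_module R X \<Longrightarrow> zfinite X \<Longrightarrow> hom_len W X = hom_len W' X"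
  shows "mod_isomorphic R W W'"
  using assms
proof (induction "the_enat (len Z W (carrier W))" arbitrary: W W' rule: less_induct)
  case less
  note lm = less.prems(1,2) and fin = less.prems(3,4) and H1 = less.prems(5) and H2 = less.prems(6) and H3 = less.prems(7)
  interpret W: left_module R W by fact
  interpret W': left_module R W' by fact
  show ?case
  proof (cases "carrier W = {\<zero>\<^bsub>W\<^esub>}")
    case True
    have "hom_len W' W' = 0" using zero_module_hom[OF lm True] H2[OF lm(2) fin(2)] by simp
    then have z': "carrier W' = {\<zero>\<^bsub>W'\<^esub>}" by (rule hom_len_zero_imp[OF lm(2)])
    have "(\<lambda>w\<in>carrier W. \<zero>\<^bsub>W'\<^esub>) \<in> mod_hom R W W'"
      by (rule mod_homI) (auto simp: W'.smult_zero W.smult_closed)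
    moreover have "bij_betw (\<lambda>w\<in>carrier W. \<zero>\<^bsub>W'\<^esub>) (carrier W) (carrier W')"
      unfolding True z' by (simp add: bij_betw_def)
    ultimately show ?thesis unfolding mod_isomorphic_def by blast
  next
    case False
    have "\<exists>S c. finite S \<and> S \<subseteq> mod_hom R W' W \<and> (\<forall>b\<in>S. c b \<in> mod_hom R W W') \<and>
      (\<forall>w\<in>carrier W. w = (\<Oplus>\<^bsub>W\<^esub>b\<in>S. b (c b w)))"
      by (rule sum_of_factorisations[OF lm fin H1[OF lm(1) fin(1)] H3]; (assumption | blast))
    then obtain S c where S: "finite S" "S \<subseteq> mod_hom R W' W" "\<forall>b\<in>S. c b \<in> mod_hom R W W'"
      "\<forall>w\<in>carrier W. w = (\<Oplus>\<^bsub>W\<^esub>b\<in>S. b (c b w))" by (elim exE conjE)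
    \<comment> \<open>Otherwise all factorisations through \<open>W'\<close> would be nilpotent, although they sum up to the identity of \<open>W \<noteq> 0\<close>.\<close>
    have "\<exists>p\<in>mod_hom R W' W. \<exists>c\<in>mod_hom R W W'. \<forall>k. \<exists>w\<in>carrier W. ((\<lambda>w. p (c w)) ^^ k) w \<noteq> \<zero>\<^bsub>W\<^esub>"
    proof (rule ccontr)
      assume *: "\<not> ?thesis"
      have nil: "\<exists>k. \<forall>w\<in>carrier W. ((\<lambda>w. b (c w)) ^^ k) w = \<zero>\<^bsub>W\<^esub>"
        if "b \<in> mod_hom R W' W" "c \<in> mod_hom R W W'" for b c using * that by blast
      have "carrier W = {\<zero>\<^bsub>W\<^esub>}"
        by (rule nilpotent_factorisations_imp_zero[OF lm fin(1) nil S(1,2) S(3)[rule_format] S(4)[rule_format]])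
      then show False using False by simp
    qed
    then obtain p c where p: "p \<in> mod_hom R W' W" and c: "c \<in> mod_hom R W W'"
      and nn: "\<forall>k. \<exists>w\<in>carrier W. ((\<lambda>w. p (c w)) ^^ k) w \<noteq> \<zero>\<^bsub>W\<^esub>" by (elim bexE)
    have "\<exists>q\<in>mod_hom R W W'. (\<forall>w\<in>carrier W. q (p (q w)) = q w) \<and> (\<exists>w\<in>carrier W. p (q w) \<noteq> \<zero>\<^bsub>W\<^esub>)"
      by (rule common_summand[OF lm fin(1) p c nn[rule_format]]) blast
    then obtain q where q: "q \<in> mod_hom R W W'" and qpq': "\<forall>w\<in>carrier W. q (p (q w)) = q w"
      and nz: "\<exists>w\<in>carrier W. p (q w) \<noteq> \<zero>\<^bsub>W\<^esub>" by blast
    note qpq = bspec[OF qpq']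
    let ?N = "{w \<in> carrier W. compose (carrier W) p q w = \<zero>\<^bsub>W\<^esub>}" and ?N' = "{w \<in> carrier W'. compose (carrier W') q p w = \<zero>\<^bsub>W'\<^esub>}"
    have eh: "compose (carrier W) p q \<in> mod_hom R W W" "compose (carrier W') q p \<in> mod_hom R W' W'"
      using mod_hom_compose[OF lm(1) q p] mod_hom_compose[OF lm(2) p q] .
    have lN: "left_module R (W\<lparr>carrier := ?N\<rparr>)" "left_module R (W'\<lparr>carrier := ?N'\<rparr>)"
      by (rule kernel_module[OF lm(1,1) eh(1)], rule kernel_module[OF lm(2,2) eh(2)])
    have fN: "zfinite (W\<lparr>carrier := ?N\<rparr>)" "zfinite (W'\<lparr>carrier := ?N'\<rparr>)"
      by (rule zfinite_restrict[OF fin(1)], blast, rule zfinite_restrict[OF fin(2)], blast)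
    have st: "stable_sub Z W {w \<in> carrier W. compose (carrier W) p q w \<in> {\<zero>\<^bsub>W\<^esub>}}"
      by (rule lin_stable_image(4)[OF lm(1,1) Z_sub mod_hom_lin[OF eh(1) Z_sub] W.stable_carrier[OF Z_sub] W.stable_zero[OF Z_sub]])
    have "?N \<subset> carrier W" using nz by (auto simp: compose_def)
    then have "len Z W ?N < len Z W (carrier W)"
      using len_strict[OF lm(1) _ W.stable_carrier[OF Z_sub]] st fin(1) unfolding zfinite_def by simp
    then have "the_enat (len Z W ?N) < the_enat (len Z W (carrier W))"
      using fin(1) unfolding zfinite_def by (cases "len Z W ?N"; cases "len Z W (carrier W)") auto
    moreover have "len Z (W\<lparr>carrier := ?N\<rparr>) (carrier (W\<lparr>carrier := ?N\<rparr>)) = len Z W ?N"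
      using rlen_restrict[of ?N W ?N Z "{\<zero>\<^bsub>W\<^esub>}"] by auto
    ultimately have lt: "the_enat (len Z (W\<lparr>carrier := ?N\<rparr>) (carrier (W\<lparr>carrier := ?N\<rparr>))) < the_enat (len Z W (carrier W))" by simp
    note cancel = hom_len_cancel[OF lm _ fin(1) _ p q qpq]
    have iso: "mod_isomorphic R (W\<lparr>carrier := ?N\<rparr>) (W'\<lparr>carrier := ?N'\<rparr>)"
    proof (rule less.hyps[OF lt lN fN])
      fix X :: "('a, 'w, 'wx) module_scheme" assume "left_module R X" "zfinite X"
      then show "hom_len (W\<lparr>carrier := ?N\<rparr>) X = hom_len (W'\<lparr>carrier := ?N'\<rparr>) X" by (intro cancel H1)
    next
      fix X :: "('a, 'w1, 'w1x) module_scheme" assume "left_module R X" "zfinite X"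
      then show "hom_len (W\<lparr>carrier := ?N\<rparr>) X = hom_len (W'\<lparr>carrier := ?N'\<rparr>) X" by (intro cancel H2)
    next
      fix X :: "('a, ('w1 \<Rightarrow> 'w) \<Rightarrow> 'w1) module" assume "left_module R X" "zfinite X"
      then show "hom_len (W\<lparr>carrier := ?N\<rparr>) X = hom_len (W'\<lparr>carrier := ?N'\<rparr>) X" by (intro cancel H3)
    qed
    show ?thesis by (rule glue_isomorphism[OF lm p q qpq iso])
  qed
qed

end

section \<open>Cosets, simple quotients and cokernels\<close>

context left_module begin

lemma coset_iff: "x \<in> A +>\<^bsub>M\<^esub> v \<longleftrightarrow> (\<exists>a\<in>A. x = a \<oplus>\<^bsub>M\<^esub> v)"
  unfolding a_r_coset_def' by auto

lemma coset_mem_iff: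
  assumes "stable_sub (carrier R) M A" "x \<in> carrier M" "v \<in> carrier M"
  shows "x \<in> A +>\<^bsub>M\<^esub> v \<longleftrightarrow> x \<ominus>\<^bsub>M\<^esub> v \<in> A"
proof
  assume "x \<in> A +>\<^bsub>M\<^esub> v"
  then obtain a where a: "a \<in> A" "x = a \<oplus>\<^bsub>M\<^esub> v" unfolding coset_iff by blast
  then have "x \<ominus>\<^bsub>M\<^esub> v = a" using assms(3) stableD(5)[OF assms(1) a(1)] by (simp add: a_minus_def M.a_assoc M.r_neg)
  then show "x \<ominus>\<^bsub>M\<^esub> v \<in> A" using a by simp
next
  assume *: "x \<ominus>\<^bsub>M\<^esub> v \<in> A"
  have "x = (x \<ominus>\<^bsub>M\<^esub> v) \<oplus>\<^bsub>M\<^esub> v" using assms(2,3) by (simp add: a_minus_def M.a_assoc M.l_neg)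
  then show "x \<in> A +>\<^bsub>M\<^esub> v" unfolding coset_iff using * by blast
qed

lemma coset_sub: "stable_sub (carrier R) M A \<Longrightarrow> v \<in> carrier M \<Longrightarrow> A +>\<^bsub>M\<^esub> v \<subseteq> carrier M"
  using stableD(5)[of "carrier R" M A] by (auto simp: coset_iff)

lemma coset_eq_iff:
  assumes A: "stable_sub (carrier R) M A" and c: "x \<in> carrier M" "y \<in> carrier M"
  shows "A +>\<^bsub>M\<^esub> x = A +>\<^bsub>M\<^esub> y \<longleftrightarrow> x \<ominus>\<^bsub>M\<^esub> y \<in> A"
proof
  assume "A +>\<^bsub>M\<^esub> x = A +>\<^bsub>M\<^esub> y"
  moreover have "x \<in> A +>\<^bsub>M\<^esub> x" unfolding coset_mem_iff[OF A c(1) c(1)] using stableD(2)[OF A] c by (simp add: a_minus_def M.r_neg)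
  ultimately show "x \<ominus>\<^bsub>M\<^esub> y \<in> A" using coset_mem_iff[OF A c] by simp
next
  assume d: "x \<ominus>\<^bsub>M\<^esub> y \<in> A"
  have "z \<in> A +>\<^bsub>M\<^esub> x \<longleftrightarrow> z \<in> A +>\<^bsub>M\<^esub> y" if z: "z \<in> carrier M" for z
  proof -
    have 1: "z \<ominus>\<^bsub>M\<^esub> y = (z \<ominus>\<^bsub>M\<^esub> x) \<oplus>\<^bsub>M\<^esub> (x \<ominus>\<^bsub>M\<^esub> y)"
      using z c by (simp add: a_minus_def M.minus_add M.a_ac M.r_neg1 M.r_neg2)
    have "t \<in> carrier M \<Longrightarrow> s \<in> carrier M \<Longrightarrow> t = (t \<oplus>\<^bsub>M\<^esub> s) \<ominus>\<^bsub>M\<^esub> s" for t s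
      by (simp add: a_minus_def M.a_assoc M.r_neg)
    then have 2: "z \<ominus>\<^bsub>M\<^esub> x = (z \<ominus>\<^bsub>M\<^esub> y) \<ominus>\<^bsub>M\<^esub> (x \<ominus>\<^bsub>M\<^esub> y)" unfolding 1 using z c by simp
    show ?thesis unfolding coset_mem_iff[OF A z c(1)] coset_mem_iff[OF A z c(2)]
      using 1 2 stableD(3)[OF A _ d] stable_minus[OF A _ d] by metis
  qed
  then show "A +>\<^bsub>M\<^esub> x = A +>\<^bsub>M\<^esub> y" using coset_sub[OF A c(1)] coset_sub[OF A c(2)] by blast
qed

lemma coset_zero: "stable_sub (carrier R) M A \<Longrightarrow> A +>\<^bsub>M\<^esub> \<zero>\<^bsub>M\<^esub> = A"
  using stableD(5)[of "carrier R" M A] by (auto simp: coset_iff)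

lemma coset_eq_self_iff: "stable_sub (carrier R) M A \<Longrightarrow> x \<in> carrier M \<Longrightarrow> A +>\<^bsub>M\<^esub> x = A \<longleftrightarrow> x \<in> A"
  using coset_eq_iff[of A x "\<zero>\<^bsub>M\<^esub>"] coset_zero[of A] by (simp add: a_minus_def M.minus_equality[of "\<zero>\<^bsub>M\<^esub>" "\<zero>\<^bsub>M\<^esub>"])

lemma coset_add:
  assumes A: "stable_sub (carrier R) M A" and c: "x \<in> carrier M" "y \<in> carrier M"
  shows "(A +>\<^bsub>M\<^esub> x) <+>\<^bsub>M\<^esub> (A +>\<^bsub>M\<^esub> y) = A +>\<^bsub>M\<^esub> (x \<oplus>\<^bsub>M\<^esub> y)"
proof (intro equalityI subsetI)
  fix z assume "z \<in> (A +>\<^bsub>M\<^esub> x) <+>\<^bsub>M\<^esub> (A +>\<^bsub>M\<^esub> y)"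
  then obtain h g where "h \<in> A +>\<^bsub>M\<^esub> x" "g \<in> A +>\<^bsub>M\<^esub> y" "z = h \<oplus>\<^bsub>M\<^esub> g" unfolding set_add_iff by blast
  then obtain a b where ab: "a \<in> A" "b \<in> A" "z = (a \<oplus>\<^bsub>M\<^esub> x) \<oplus>\<^bsub>M\<^esub> (b \<oplus>\<^bsub>M\<^esub> y)"
    unfolding coset_iff by blast
  have "z = (a \<oplus>\<^bsub>M\<^esub> b) \<oplus>\<^bsub>M\<^esub> (x \<oplus>\<^bsub>M\<^esub> y)"
    unfolding ab using c stableD(5)[OF A ab(1)] stableD(5)[OF A ab(2)] by (simp add: M.a_ac)
  then show "z \<in> A +>\<^bsub>M\<^esub> (x \<oplus>\<^bsub>M\<^esub> y)" unfolding coset_iff using stableD(3)[OF A ab(1,2)] by blast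
next
  fix z assume "z \<in> A +>\<^bsub>M\<^esub> (x \<oplus>\<^bsub>M\<^esub> y)"
  then obtain a where a: "a \<in> A" "z = a \<oplus>\<^bsub>M\<^esub> (x \<oplus>\<^bsub>M\<^esub> y)" unfolding coset_iff by blast
  have "z = (a \<oplus>\<^bsub>M\<^esub> x) \<oplus>\<^bsub>M\<^esub> (\<zero>\<^bsub>M\<^esub> \<oplus>\<^bsub>M\<^esub> y)" unfolding a using c stableD(5)[OF A a(1)] by (simp add: M.a_ac)
  moreover have "a \<oplus>\<^bsub>M\<^esub> x \<in> A +>\<^bsub>M\<^esub> x" "\<zero>\<^bsub>M\<^esub> \<oplus>\<^bsub>M\<^esub> y \<in> A +>\<^bsub>M\<^esub> y"
    unfolding coset_iff using a(1) stableD(2)[OF A] by blast+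
  ultimately show "z \<in> (A +>\<^bsub>M\<^esub> x) <+>\<^bsub>M\<^esub> (A +>\<^bsub>M\<^esub> y)" unfolding set_add_iff by blast
qed

lemma coset_smult:
  assumes A: "stable_sub (carrier R) M A" and c: "a \<in> carrier R" "x \<in> carrier M"
  shows "(\<Union>z\<in>A +>\<^bsub>M\<^esub> x. A +>\<^bsub>M\<^esub> (a \<odot>\<^bsub>M\<^esub> z)) = A +>\<^bsub>M\<^esub> (a \<odot>\<^bsub>M\<^esub> x)"
proof -
  have "A +>\<^bsub>M\<^esub> (a \<odot>\<^bsub>M\<^esub> z) = A +>\<^bsub>M\<^esub> (a \<odot>\<^bsub>M\<^esub> x)" if z: "z \<in> A +>\<^bsub>M\<^esub> x" for z
  proof -
    have zc: "z \<in> carrier M" using coset_sub[OF A c(2)] z by blast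
    have "a \<odot>\<^bsub>M\<^esub> z \<ominus>\<^bsub>M\<^esub> a \<odot>\<^bsub>M\<^esub> x = a \<odot>\<^bsub>M\<^esub> (z \<ominus>\<^bsub>M\<^esub> x)"
      using zc c by (simp add: a_minus_def smult_r_distr smult_neg)
    also have "\<dots> \<in> A" using z stableD(4)[OF A c(1)] unfolding coset_mem_iff[OF A zc c(2)] by blast
    finally show ?thesis using coset_eq_iff[OF A] smult_closed[OF c(1)] zc c(2) by blast
  qed
  moreover have "x \<in> A +>\<^bsub>M\<^esub> x" using coset_mem_iff[OF A c(2,2)] stableD(2)[OF A] c by (simp add: a_minus_def M.r_neg)
  ultimately show ?thesis by blast
qed

lemma finsum_smult_ring:
  assumes "x \<in> carrier M" "g \<in> S \<rightarrow> carrier R"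
  shows "finsum R g S \<odot>\<^bsub>M\<^esub> x = (\<Oplus>\<^bsub>M\<^esub>i\<in>S. g i \<odot>\<^bsub>M\<^esub> x)"
  using assms(2)
proof (induction S rule: infinite_finite_induct)
  case (insert i S)
  have g: "g \<in> S \<rightarrow> carrier R" "g i \<in> carrier R" "(\<lambda>i. g i \<odot>\<^bsub>M\<^esub> x) \<in> S \<rightarrow> carrier M"
    using insert.prems smult_closed[OF _ assms(1)] by auto
  then show ?case using insert.hyps insert.IH smult_closed[OF _ assms(1)] smult_l_distr[OF _ _ assms(1)] by simp
qed (simp_all add: zero_smult assms(1))

lemma submodule_stable: "submodule H R M \<Longrightarrow> stable_sub (carrier R) M H"
proof -
  assume H: "submodule H R M"
  interpret H: subgroup H "add_monoid M" using H by (simp add: submodule_def)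
  show ?thesis
    using H.subset H.one_closed H.m_closed H.m_inv_closed submodule.smult_closed[OF H]
    by (intro stableI) (auto simp: a_inv_def)
qed

lemma stable_submodule: "stable_sub (carrier R) M H \<Longrightarrow> submodule H R M"
proof -
  assume H: "stable_sub (carrier R) M H"
  show ?thesis
    unfolding submodule_def submodule_axioms_def
    using stableD(1-4)[OF H] stable_neg[OF H] by (auto intro!: subgroup.intro simp: a_inv_def)
qed

end

lemma quot_module_simps [simp]:
  "carrier (quot_module M H) = (\<lambda>v. H +>\<^bsub>M\<^esub> v) ` carrier M" "\<zero>\<^bsub>quot_module M H\<^esub> = H"
  "x \<oplus>\<^bsub>quot_module M H\<^esub> y = x <+>\<^bsub>M\<^esub> y" "a \<odot>\<^bsub>quot_module M H\<^esub> x = (\<Union>z\<in>x. H +>\<^bsub>M\<^esub> (a \<odot>\<^bsub>M\<^esub> z))"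
  unfolding quot_module_def A_RCOSETS_def' by auto

text \<open>
  Simplicity of the quotient enters only as the absence of submodules strictly between, which is the form
  that fits relative lengths.
\<close>

lemma simple_quotient_no_between:
  assumes lm: "left_module R B" and A: "stable_sub (carrier R) B A"
    and s: "simple_module R (quot_module B A)"
    and H: "stable_sub (carrier R) B H" "A \<subseteq> H"
  shows "H = A \<or> H = carrier B"
proof -
  interpret B: left_module R B by fact
  let ?Q = "quot_module B A"
  interpret Q: left_module R ?Q using s by (simp add: simple_module_def)
  note Hc = stableD(5)[OF H(1)]
  let ?H = "(\<lambda>v. A +>\<^bsub>B\<^esub> v) ` H"
  have "stable_sub (carrier R) ?Q ?H"
  proof (rule Q.stableI)
    show "?H \<subseteq> carrier ?Q" using stableD(1)[OF H(1)] by auto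
    show "\<zero>\<^bsub>?Q\<^esub> \<in> ?H" using B.coset_zero[OF A] stableD(2)[OF H(1)] by force
  next
    fix x y assume "x \<in> ?H" "y \<in> ?H"
    then show "x \<oplus>\<^bsub>?Q\<^esub> y \<in> ?H" using B.coset_add[OF A] Hc stableD(3)[OF H(1)] by auto
  next
    fix x assume "x \<in> ?H"
    then obtain v where v: "v \<in> H" "x = A +>\<^bsub>B\<^esub> v" by blast
    have vc: "v \<in> carrier B" using Hc[OF v(1)] .
    have "\<ominus>\<^bsub>?Q\<^esub> x = A +>\<^bsub>B\<^esub> (\<ominus>\<^bsub>B\<^esub> v)"
      by (rule Q.M.minus_equality) (use vc v(2) B.coset_add[OF A] B.coset_zero[OF A] in \<open>auto simp: B.M.l_neg\<close>)
    then show "\<ominus>\<^bsub>?Q\<^esub> x \<in> ?H" using B.stable_neg[OF H(1) v(1)] by blast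
  next
    fix a x assume "a \<in> carrier R" "x \<in> ?H"
    then show "a \<odot>\<^bsub>?Q\<^esub> x \<in> ?H" using B.coset_smult[OF A] Hc stableD(4)[OF H(1)] by auto
  qed
  from Q.stable_submodule[OF this] s
  consider "?H = {A}" | "?H = carrier ?Q" unfolding simple_module_def by auto
  then show ?thesis
  proof cases
    case 1
    then have "v \<in> A" if "v \<in> H" for v using B.coset_eq_self_iff[OF A Hc[OF that]] that by blast
    then show ?thesis using H(2) by blast
  next
    case 2
    have "x \<in> H" if x: "x \<in> carrier B" for x
    proof -
      have "A +>\<^bsub>B\<^esub> x \<in> ?H" using 2 x by auto
      then obtain h where h: "h \<in> H" "A +>\<^bsub>B\<^esub> x = A +>\<^bsub>B\<^esub> h" by blast
      then have "x \<ominus>\<^bsub>B\<^esub> h \<in> H" using B.coset_eq_iff[OF A x Hc[OF h(1)]] H(2) by blast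
      then have "(x \<ominus>\<^bsub>B\<^esub> h) \<oplus>\<^bsub>B\<^esub> h \<in> H" using stableD(3)[OF H(1) _ h(1)] by blast
      then show "x \<in> H" using x Hc[OF h(1)] by (simp add: a_minus_def B.M.a_assoc B.M.l_neg)
    qed
    then show ?thesis using stableD(1)[OF H(1)] by blast
  qed
qed

lemma cokernel_projection:
  assumes lm: "left_module R U" "left_module R V" and f: "f \<in> mod_hom R U V" and c: "is_cokernel R U V f W"
  obtains \<pi> where "\<pi> \<in> mod_hom R V W" "\<pi> ` carrier V = carrier W"
    "\<And>v. v \<in> carrier V \<Longrightarrow> \<pi> v = \<zero>\<^bsub>W\<^esub> \<longleftrightarrow> v \<in> f ` carrier U"
proof -
  interpret U: left_module R U by fact
  interpret V: left_module R V by fact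
  interpret W: left_module R W using c by (simp add: is_cokernel_def)
  let ?H = "f ` carrier U"
  have H: "stable_sub (carrier R) V ?H"
    by (rule lin_stable_image(3)[OF lm subset_refl mod_hom_lin[OF f subset_refl] U.stable_carrier[OF subset_refl] U.stable_carrier[OF subset_refl] subset_refl])
  let ?Q = "quot_module V ?H"
  obtain \<theta> where th: "\<theta> \<in> mod_hom R ?Q W" and bij: "bij_betw \<theta> (carrier ?Q) (carrier W)"
    using c unfolding is_cokernel_def mod_isomorphic_def coker_def by blast
  define \<pi> where "\<pi> = (\<lambda>v\<in>carrier V. \<theta> (?H +>\<^bsub>V\<^esub> v))"
  have Q: "?H +>\<^bsub>V\<^esub> v \<in> carrier ?Q" if "v \<in> carrier V" for v using that by simp
  have ph: "\<pi> \<in> mod_hom R V W"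
  proof (rule mod_homI)
    fix v assume "v \<in> carrier V"
    then show "\<pi> v \<in> carrier W" using mod_homD(1)[OF th Q] by (simp add: \<pi>_def)
  next
    fix v w assume vw: "v \<in> carrier V" "w \<in> carrier V"
    then show "\<pi> (v \<oplus>\<^bsub>V\<^esub> w) = \<pi> v \<oplus>\<^bsub>W\<^esub> \<pi> w"
      using mod_homD(2)[OF th Q[OF vw(1)] Q[OF vw(2)]] V.coset_add[OF H vw] by (simp add: \<pi>_def)
  next
    fix a v assume av: "a \<in> carrier R" "v \<in> carrier V"
    then show "\<pi> (a \<odot>\<^bsub>V\<^esub> v) = a \<odot>\<^bsub>W\<^esub> \<pi> v"
      using mod_homD(3)[OF th av(1) Q[OF av(2)]] V.coset_smult[OF H av] V.smult_closed by (simp add: \<pi>_def)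
  qed (simp add: \<pi>_def)
  have "\<pi> ` carrier V = \<theta> ` carrier ?Q" by (auto simp: \<pi>_def)
  then have surj: "\<pi> ` carrier V = carrier W" using bij_betw_imp_surj_on[OF bij] by simp
  have p0: "\<pi> \<zero>\<^bsub>V\<^esub> = \<zero>\<^bsub>W\<^esub>" by (rule mod_hom_arith(1)[OF lm(2) W.left_module_axioms ph])
  have "\<pi> v = \<zero>\<^bsub>W\<^esub> \<longleftrightarrow> v \<in> ?H" if v: "v \<in> carrier V" for v
  proof -
    have "\<pi> v = \<zero>\<^bsub>W\<^esub> \<longleftrightarrow> \<pi> v = \<pi> \<zero>\<^bsub>V\<^esub>" unfolding p0 ..
    also have "\<dots> \<longleftrightarrow> \<theta> (?H +>\<^bsub>V\<^esub> v) = \<theta> (?H +>\<^bsub>V\<^esub> \<zero>\<^bsub>V\<^esub>)" using v by (simp add: \<pi>_def)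
    also have "\<dots> \<longleftrightarrow> ?H +>\<^bsub>V\<^esub> v = ?H +>\<^bsub>V\<^esub> \<zero>\<^bsub>V\<^esub>"
      using inj_on_eq_iff[OF bij_betw_imp_inj_on[OF bij] Q[OF v] Q[OF V.M.zero_closed]] .
    also have "\<dots> \<longleftrightarrow> v \<in> ?H" unfolding V.coset_zero[OF H] by (rule V.coset_eq_self_iff[OF H v])
    finally show ?thesis .
  qed
  then show ?thesis using that ph surj by blast
qed

section \<open>Free modules and the vanishing of the first extension group\<close>

lemma free_module_simps [simp]:
  "carrier (free_module R S) = {c \<in> UNIV \<rightarrow> carrier R. finite {s. c s \<noteq> \<zero>\<^bsub>R\<^esub>} \<and> {s. c s \<noteq> \<zero>\<^bsub>R\<^esub>} \<subseteq> S}"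
  "\<zero>\<^bsub>free_module R S\<^esub> = (\<lambda>s. \<zero>\<^bsub>R\<^esub>)" "c \<oplus>\<^bsub>free_module R S\<^esub> d = (\<lambda>s. c s \<oplus>\<^bsub>R\<^esub> d s)"
  "a \<odot>\<^bsub>free_module R S\<^esub> c = (\<lambda>s. a \<otimes>\<^bsub>R\<^esub> c s)"
  unfolding free_module_def by simp_all

lemma left_module_free:
  assumes "ring R"
  shows "left_module R (free_module R S)"
proof -
  interpret ring R by fact
  have supp: "finite {s. f s \<noteq> \<zero>\<^bsub>R\<^esub>} \<and> {s. f s \<noteq> \<zero>\<^bsub>R\<^esub>} \<subseteq> S"
    if "c \<in> carrier (free_module R S)" "d \<in> carrier (free_module R S)" "\<And>s. c s = \<zero>\<^bsub>R\<^esub> \<Longrightarrow> d s = \<zero>\<^bsub>R\<^esub> \<Longrightarrow> f s = \<zero>\<^bsub>R\<^esub>" for c d f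
  proof -
    have "{s. f s \<noteq> \<zero>\<^bsub>R\<^esub>} \<subseteq> {s. c s \<noteq> \<zero>\<^bsub>R\<^esub>} \<union> {s. d s \<noteq> \<zero>\<^bsub>R\<^esub>}" using that(3) by blast
    moreover have "finite ({s. c s \<noteq> \<zero>\<^bsub>R\<^esub>} \<union> {s. d s \<noteq> \<zero>\<^bsub>R\<^esub>})" "{s. c s \<noteq> \<zero>\<^bsub>R\<^esub>} \<union> {s. d s \<noteq> \<zero>\<^bsub>R\<^esub>} \<subseteq> S"
      using that(1,2) by auto
    ultimately show ?thesis by (meson finite_subset subset_trans)
  qed
  show ?thesis
  proof (rule left_moduleI)
    fix x y assume "x \<in> carrier (free_module R S)" "y \<in> carrier (free_module R S)"
    then show "x \<oplus>\<^bsub>free_module R S\<^esub> y \<in> carrier (free_module R S)"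
      using supp[of x y "\<lambda>s. x s \<oplus>\<^bsub>R\<^esub> y s"] by auto
  next
    fix a x assume "a \<in> carrier R" "x \<in> carrier (free_module R S)"
    then show "a \<odot>\<^bsub>free_module R S\<^esub> x \<in> carrier (free_module R S)"
      using supp[of x x "\<lambda>s. a \<otimes>\<^bsub>R\<^esub> x s"] by auto
  next
    fix x assume x: "x \<in> carrier (free_module R S)"
    show "\<exists>y\<in>carrier (free_module R S). y \<oplus>\<^bsub>free_module R S\<^esub> x = \<zero>\<^bsub>free_module R S\<^esub>"
      by (rule bexI[of _ "\<lambda>s. \<ominus>\<^bsub>R\<^esub> x s"]) (use x supp[of x x "\<lambda>s. \<ominus>\<^bsub>R\<^esub> x s"] in \<open>auto simp: Pi_iff l_neg\<close>)
  qed (auto simp: assms Pi_iff a_ac l_distr r_distr m_assoc)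
qed

text \<open>
  The linear extension of \<open>\<sigma>\<close> to the free module. It is not restricted to the carrier, in accordance with
  \<open>lin_comb\<close>, which is the case where \<open>\<sigma>\<close> is the identity.
\<close>

definition linext :: "('a, 'r) ring_scheme \<Rightarrow> ('a, 'b, 'm) module_scheme \<Rightarrow> ('s \<Rightarrow> 'b) \<Rightarrow> ('s \<Rightarrow> 'a) \<Rightarrow> 'b" where
  "linext R N \<sigma> c = (\<Oplus>\<^bsub>N\<^esub>s\<in>{s. c s \<noteq> \<zero>\<^bsub>R\<^esub>}. c s \<odot>\<^bsub>N\<^esub> \<sigma> s)"

lemma lin_comb_eq_linext: "lin_comb R M = linext R M (\<lambda>s. s)"
  unfolding lin_comb_def linext_def by auto

definition basis :: "('a, 'r) ring_scheme \<Rightarrow> 's \<Rightarrow> 's \<Rightarrow> 'a" where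
  "basis R s = (\<lambda>t. if t = s then \<one>\<^bsub>R\<^esub> else \<zero>\<^bsub>R\<^esub>)"

lemma basis_carrier:
  assumes "ring R" "s \<in> S"
  shows "basis R s \<in> carrier (free_module R S)"
proof -
  interpret ring R by fact
  have "{t. basis R s t \<noteq> \<zero>\<^bsub>R\<^esub>} \<subseteq> {s}" by (auto simp: basis_def)
  then show ?thesis using assms(2) finite_subset by (fastforce simp: basis_def)
qed

context left_module begin

lemma linext_superset:
  assumes "\<sigma> \<in> A \<rightarrow> carrier M" "c \<in> UNIV \<rightarrow> carrier R" "finite A" "{s. c s \<noteq> \<zero>} \<subseteq> A"
  shows "linext R M \<sigma> c = (\<Oplus>\<^bsub>M\<^esub>s\<in>A. c s \<odot>\<^bsub>M\<^esub> \<sigma> s)"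
  unfolding linext_def using assms
  by (intro M.add.finprod_mono_neutral_cong_left) (auto simp: zero_smult smult_closed Pi_iff)

lemma linext_hom:
  assumes s: "\<sigma> \<in> S \<rightarrow> carrier M"
  shows "restrict (linext R M \<sigma>) (carrier (free_module R S)) \<in> mod_hom R (free_module R S) M"
proof -
  interpret F: left_module R "free_module R S" by (rule left_module_free[OF R.ring_axioms])
  show ?thesis
  proof (rule mod_homI)
    fix c assume c: "c \<in> carrier (free_module R S)"
    have "linext R M \<sigma> c \<in> carrier M" unfolding linext_def
      using c s by (intro M.finsum_closed) (auto simp: smult_closed Pi_iff subset_iff)
    then show "restrict (linext R M \<sigma>) (carrier (free_module R S)) c \<in> carrier M" using c by (simp only: restrict_apply')
  next
    fix c d assume cd: "c \<in> carrier (free_module R S)" "d \<in> carrier (free_module R S)"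
    let ?A = "{s. c s \<noteq> \<zero>} \<union> {s. d s \<noteq> \<zero>}"
    have A: "finite ?A" "\<sigma> \<in> ?A \<rightarrow> carrier M" "c \<in> UNIV \<rightarrow> carrier R" "d \<in> UNIV \<rightarrow> carrier R" using cd s by auto
    have sub: "{s. c s \<oplus> d s \<noteq> \<zero>} \<subseteq> ?A" by auto
    have "linext R M \<sigma> (\<lambda>s. c s \<oplus> d s) = (\<Oplus>\<^bsub>M\<^esub>s\<in>?A. (c s \<oplus> d s) \<odot>\<^bsub>M\<^esub> \<sigma> s)"
      by (rule linext_superset) (use A sub in auto)
    also have "\<dots> = (\<Oplus>\<^bsub>M\<^esub>s\<in>?A. c s \<odot>\<^bsub>M\<^esub> \<sigma> s \<oplus>\<^bsub>M\<^esub> d s \<odot>\<^bsub>M\<^esub> \<sigma> s)"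
      using A by (intro M.finsum_cong') (auto simp: smult_l_distr smult_closed Pi_iff)
    also have "\<dots> = (\<Oplus>\<^bsub>M\<^esub>s\<in>?A. c s \<odot>\<^bsub>M\<^esub> \<sigma> s) \<oplus>\<^bsub>M\<^esub> (\<Oplus>\<^bsub>M\<^esub>s\<in>?A. d s \<odot>\<^bsub>M\<^esub> \<sigma> s)"
      using A by (intro M.finsum_addf) (auto simp: smult_closed Pi_iff)
    also have "(\<Oplus>\<^bsub>M\<^esub>s\<in>?A. c s \<odot>\<^bsub>M\<^esub> \<sigma> s) = linext R M \<sigma> c" by (rule linext_superset[symmetric]) (use A in auto)
    also have "(\<Oplus>\<^bsub>M\<^esub>s\<in>?A. d s \<odot>\<^bsub>M\<^esub> \<sigma> s) = linext R M \<sigma> d" by (rule linext_superset[symmetric]) (use A in auto)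
    finally show "restrict (linext R M \<sigma>) (carrier (free_module R S)) (c \<oplus>\<^bsub>free_module R S\<^esub> d)
      = restrict (linext R M \<sigma>) (carrier (free_module R S)) c \<oplus>\<^bsub>M\<^esub> restrict (linext R M \<sigma>) (carrier (free_module R S)) d"
      using F.M.a_closed[OF cd] cd by (simp only: restrict_apply' free_module_simps(3))
  next
    fix a c assume ac: "a \<in> carrier R" "c \<in> carrier (free_module R S)"
    let ?A = "{s. c s \<noteq> \<zero>}"
    have A: "finite ?A" "\<sigma> \<in> ?A \<rightarrow> carrier M" "c \<in> UNIV \<rightarrow> carrier R" using ac s by auto
    have sub: "{s. a \<otimes> c s \<noteq> \<zero>} \<subseteq> ?A" using ac by auto
    have "linext R M \<sigma> (\<lambda>s. a \<otimes> c s) = (\<Oplus>\<^bsub>M\<^esub>s\<in>?A. (a \<otimes> c s) \<odot>\<^bsub>M\<^esub> \<sigma> s)"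
      by (rule linext_superset) (use A sub ac in auto)
    also have "\<dots> = (\<Oplus>\<^bsub>M\<^esub>s\<in>?A. a \<odot>\<^bsub>M\<^esub> (c s \<odot>\<^bsub>M\<^esub> \<sigma> s))"
      using A ac by (intro M.finsum_cong') (auto simp: smult_assoc smult_closed Pi_iff)
    also have "\<dots> = a \<odot>\<^bsub>M\<^esub> (\<Oplus>\<^bsub>M\<^esub>s\<in>?A. c s \<odot>\<^bsub>M\<^esub> \<sigma> s)"
      using A ac by (intro finsum_smult[symmetric]) (auto simp: smult_closed Pi_iff)
    finally show "restrict (linext R M \<sigma>) (carrier (free_module R S)) (a \<odot>\<^bsub>free_module R S\<^esub> c)
      = a \<odot>\<^bsub>M\<^esub> restrict (linext R M \<sigma>) (carrier (free_module R S)) c"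
      using F.smult_closed[OF ac] ac(2) unfolding linext_def[of R M \<sigma> c] by (simp only: restrict_apply' free_module_simps(4) linext_def[of R M \<sigma> c])
  qed (simp only: restrict_def if_False)
qed

lemma linext_basis:
  assumes "\<sigma> s \<in> carrier M"
  shows "linext R M \<sigma> (basis R s) = \<sigma> s"
proof -
  have "linext R M \<sigma> (basis R s) = (\<Oplus>\<^bsub>M\<^esub>t\<in>{s}. basis R s t \<odot>\<^bsub>M\<^esub> \<sigma> t)"
    by (rule linext_superset) (use assms in \<open>auto simp: basis_def\<close>)
  also have "\<dots> = \<sigma> s" using assms by (simp add: basis_def smult_one)
  finally show ?thesis .
qed

end

lemma hom_linext:
  assumes lm: "left_module R M" "left_module R N" and g: "g \<in> mod_hom R M N"
    and s: "\<sigma> \<in> S \<rightarrow> carrier M" and c: "c \<in> carrier (free_module R S)"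
  shows "g (linext R M \<sigma> c) = linext R N (\<lambda>s. g (\<sigma> s)) c"
proof -
  interpret M: left_module R M by fact
  interpret N: left_module R N by fact
  have "g (\<Oplus>\<^bsub>M\<^esub>s\<in>A. c s \<odot>\<^bsub>M\<^esub> \<sigma> s) = (\<Oplus>\<^bsub>N\<^esub>s\<in>A. c s \<odot>\<^bsub>N\<^esub> g (\<sigma> s))" if "finite A" "A \<subseteq> S" for A
    using that
  proof (induction A rule: finite_induct)
    case empty
    then show ?case using mod_hom_arith(1)[OF lm g] by simp
  next
    case (insert a A)
    have cc: "c s \<in> carrier R" for s using c by auto
    have sc: "\<sigma> s \<in> carrier M" "g (\<sigma> s) \<in> carrier N" if "s \<in> insert a A" for s
      using s that insert.prems mod_homD(1)[OF g] by auto
    have "(\<Oplus>\<^bsub>M\<^esub>s\<in>insert a A. c s \<odot>\<^bsub>M\<^esub> \<sigma> s) = c a \<odot>\<^bsub>M\<^esub> \<sigma> a \<oplus>\<^bsub>M\<^esub> (\<Oplus>\<^bsub>M\<^esub>s\<in>A. c s \<odot>\<^bsub>M\<^esub> \<sigma> s)"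
      by (rule M.M.finsum_insert) (use insert.hyps sc cc M.smult_closed in auto)
    moreover have "(\<Oplus>\<^bsub>N\<^esub>s\<in>insert a A. c s \<odot>\<^bsub>N\<^esub> g (\<sigma> s)) = c a \<odot>\<^bsub>N\<^esub> g (\<sigma> a) \<oplus>\<^bsub>N\<^esub> (\<Oplus>\<^bsub>N\<^esub>s\<in>A. c s \<odot>\<^bsub>N\<^esub> g (\<sigma> s))"
      by (rule N.M.finsum_insert) (use insert.hyps sc cc N.smult_closed in auto)
    moreover have "(\<Oplus>\<^bsub>M\<^esub>s\<in>A. c s \<odot>\<^bsub>M\<^esub> \<sigma> s) \<in> carrier M"
      by (rule M.M.finsum_closed) (use sc cc M.smult_closed in auto)
    ultimately show ?case
      using insert.IH insert.prems sc[of a] cc M.smult_closed by (simp add: mod_homD(2,3)[OF g])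
  qed
  then show ?thesis unfolding linext_def using c by auto
qed

text \<open>
  Consecutive maps of the standard resolution compose to zero; this serves both the augmentation and the
  first differential.
\<close>

lemma lin_comb_lin_comb_zero:
  assumes lm: "left_module R M" "left_module R N" and g: "restrict g (carrier M) \<in> mod_hom R M N"
    and c: "c \<in> carrier (free_module R {x \<in> carrier M. g x = \<zero>\<^bsub>N\<^esub>})"
  shows "lin_comb R M c \<in> carrier M" "g (lin_comb R M c) = \<zero>\<^bsub>N\<^esub>"
proof -
  interpret M: left_module R M by fact
  interpret N: left_module R N by fact
  let ?S = "{x \<in> carrier M. g x = \<zero>\<^bsub>N\<^esub>}"
  have id: "(\<lambda>s. s) \<in> ?S \<rightarrow> carrier M" by auto
  show cl: "lin_comb R M c \<in> carrier M"
    using mod_homD(1)[OF M.linext_hom[OF id] c] c unfolding lin_comb_eq_linext by (simp only: restrict_apply')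
  have "restrict g (carrier M) (linext R M (\<lambda>s. s) c) = linext R N (\<lambda>s. restrict g (carrier M) s) c"
    by (rule hom_linext[OF lm g id c])
  also have "\<dots> = (\<Oplus>\<^bsub>N\<^esub>s\<in>{s. c s \<noteq> \<zero>\<^bsub>R\<^esub>}. \<zero>\<^bsub>N\<^esub>)"
    unfolding linext_def using c by (intro N.M.finsum_cong') (auto simp: N.smult_zero Pi_iff)
  finally show "g (lin_comb R M c) = \<zero>\<^bsub>N\<^esub>" using cl unfolding lin_comb_eq_linext by simp
qed

lemma a_kernel_eq: "a_kernel M N g = {x \<in> carrier M. g x = \<zero>\<^bsub>N\<^esub>}"
  unfolding a_kernel_def kernel_def by simp

text \<open>
  The quotient group is trivial, so the coset of a cocycle is the subgroup itself; the cocycle belongs to it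
  since the zero map is a coboundary.
\<close>

lemma Ext1_trivial_cocycle:
  assumes "left_module R N" "trivial_group (Ext1 R M N)" "g \<in> ext1_cocycles R M N"
  shows "g \<in> ext1_coboundaries R M N"
proof -
  interpret N: left_module R N by fact
  let ?G = "(hom_group R (res1 R M) N)\<lparr>carrier := ext1_cocycles R M N\<rparr>"
  let ?B = "ext1_coboundaries R M N"
  interpret P0: left_module R "res0 R M" unfolding res0_def by (rule left_module_free[OF N.R.ring_axioms])
  have "?B #>\<^bsub>?G\<^esub> g \<in> carrier (Ext1 R M N)"
    using assms(3) by (auto simp: Ext1_def FactGroup_def RCOSETS_def)
  then have eq: "?B #>\<^bsub>?G\<^esub> g = ?B" using assms(2) by (simp add: trivial_group_def Ext1_def FactGroup_def)
  let ?z = "\<lambda>x\<in>carrier (res0 R M). \<zero>\<^bsub>N\<^esub>"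
  have z: "?z \<in> mod_hom R (res0 R M) N"
    by (rule mod_homI) (auto simp: N.smult_zero P0.smult_closed)
  let ?w = "compose (carrier (res1 R M)) ?z (lin_comb R (res0 R M))"
  have w: "?w \<in> ?B" using z unfolding ext1_coboundaries_def by blast
  have gh: "g \<in> mod_hom R (res1 R M) N" using assms(3) by (simp add: ext1_cocycles_def)
  have cl: "lin_comb R (res0 R M) c \<in> carrier (res0 R M)" if "c \<in> carrier (res1 R M)" for c
  proof -
    have c: "c \<in> carrier (free_module R (a_kernel (res0 R M) M (lin_comb R M)))" using that by (simp only: res1_def)
    have id: "(\<lambda>s. s) \<in> a_kernel (res0 R M) M (lin_comb R M) \<rightarrow> carrier (res0 R M)" unfolding a_kernel_eq by auto
    show ?thesis using mod_homD(1)[OF P0.linext_hom[OF id] c] c unfolding lin_comb_eq_linext[of R "res0 R M"] by (simp only: restrict_apply')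
  qed
  have "?w \<otimes>\<^bsub>?G\<^esub> g = g"
    using mod_homD(1)[OF gh] mod_homD(4)[OF gh] cl by (auto simp: hom_group_def fun_eq_iff compose_def)
  then have "g \<in> ?B #>\<^bsub>?G\<^esub> g" using w unfolding r_coset_def by force
  then show ?thesis using eq by simp
qed

lemma factor_through_surjection:
  assumes lm: "left_module R P" "left_module R V" "left_module R N" and F: "F \<in> mod_hom R P V" "F ` carrier P = carrier V"
    and G: "G \<in> mod_hom R P N" and ker: "\<And>p. p \<in> carrier P \<Longrightarrow> F p = \<zero>\<^bsub>V\<^esub> \<Longrightarrow> G p = \<zero>\<^bsub>N\<^esub>"
  obtains h where "h \<in> mod_hom R V N" "\<And>p. p \<in> carrier P \<Longrightarrow> h (F p) = G p"
proof -
  interpret P: left_module R P by fact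
  interpret V: left_module R V by fact
  interpret N: left_module R N by fact
  have eq: "G p = G q" if pq: "p \<in> carrier P" "q \<in> carrier P" and e: "F p = F q" for p q
  proof -
    have "F (p \<ominus>\<^bsub>P\<^esub> q) = F q \<ominus>\<^bsub>V\<^esub> F q" using mod_hom_arith(3)[OF lm(1,2) F(1) pq] e by simp
    also have "\<dots> = \<zero>\<^bsub>V\<^esub>" using mod_homD(1)[OF F(1) pq(2)] by (simp add: a_minus_def V.M.r_neg)
    finally have "G (p \<ominus>\<^bsub>P\<^esub> q) = \<zero>\<^bsub>N\<^esub>" using ker pq by (simp add: a_minus_def)
    then show ?thesis
      using mod_hom_arith(3)[OF lm(1,3) G pq] minus_eq_zero_imp[OF lm(3) mod_homD(1)[OF G pq(1)] mod_homD(1)[OF G pq(2)]] by simp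
  qed
  define h where "h = (\<lambda>v\<in>carrier V. G (SOME p. p \<in> carrier P \<and> F p = v))"
  have hF: "h (F p) = G p" if p: "p \<in> carrier P" for p
  proof -
    have "\<exists>q. q \<in> carrier P \<and> F q = F p" using p by blast
    from someI_ex[OF this] show ?thesis
      using eq[OF _ p] mod_homD(1)[OF F(1) p] by (simp add: h_def)
  qed
  have pre: "\<exists>p\<in>carrier P. v = F p" if "v \<in> carrier V" for v using F(2) that by blast
  have "h \<in> mod_hom R V N"
  proof (rule mod_homI)
    fix v assume "v \<in> carrier V"
    then obtain p where "p \<in> carrier P" "v = F p" using pre by blast
    then show "h v \<in> carrier N" using hF mod_homD(1)[OF G] by simp
  next
    fix v w assume "v \<in> carrier V" "w \<in> carrier V"
    then obtain p q where pq: "p \<in> carrier P" "v = F p" "q \<in> carrier P" "w = F q" using pre by metis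
    then have "v \<oplus>\<^bsub>V\<^esub> w = F (p \<oplus>\<^bsub>P\<^esub> q)" using mod_homD(2)[OF F(1)] by simp
    then show "h (v \<oplus>\<^bsub>V\<^esub> w) = h v \<oplus>\<^bsub>N\<^esub> h w" using hF pq mod_homD(2)[OF G] by simp
  next
    fix a v assume a: "a \<in> carrier R" and "v \<in> carrier V"
    then obtain p where p: "p \<in> carrier P" "v = F p" using pre by blast
    then have "a \<odot>\<^bsub>V\<^esub> v = F (a \<odot>\<^bsub>P\<^esub> p)" using mod_homD(3)[OF F(1) a] by simp
    then show "h (a \<odot>\<^bsub>V\<^esub> v) = a \<odot>\<^bsub>N\<^esub> h v" using hF p a P.smult_closed mod_homD(3)[OF G a] by simp
  qed (simp add: h_def)
  then show ?thesis using that hF by blast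
qed

lemma lift_through_mono:
  assumes lm: "left_module R P" "left_module R U" and f: "f \<in> mod_mono R U V" and r: "r \<in> mod_hom R P V"
    and im: "\<And>c. c \<in> carrier P \<Longrightarrow> r c \<in> f ` carrier U"
  obtains s where "s \<in> mod_hom R P U" "\<And>c. c \<in> carrier P \<Longrightarrow> f (s c) = r c"
proof -
  interpret P: left_module R P by fact
  interpret U: left_module R U by fact
  have fh: "f \<in> mod_hom R U V" and inj: "inj_on f (carrier U)" using f by (auto simp: mod_mono_def)
  define s where "s = (\<lambda>c\<in>carrier P. the_inv_into (carrier U) f (r c))"
  have s: "f (s c) = r c" "s c \<in> carrier U" if "c \<in> carrier P" for c
    using f_the_inv_into_f[OF inj im[OF that]] the_inv_into_into[OF inj im[OF that] subset_refl] that by (simp_all add: s_def)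
  have "s \<in> mod_hom R P U"
  proof (rule mod_homI)
    show "\<And>c. c \<in> carrier P \<Longrightarrow> s c \<in> carrier U" by (rule s(2))
  next
    fix c d assume cd: "c \<in> carrier P" "d \<in> carrier P"
    show "s (c \<oplus>\<^bsub>P\<^esub> d) = s c \<oplus>\<^bsub>U\<^esub> s d"
      by (rule inj_onD[OF inj]) (use cd s mod_homD(2)[OF fh] mod_homD(2)[OF r] in simp_all)
  next
    fix a c assume ac: "a \<in> carrier R" "c \<in> carrier P"
    show "s (a \<odot>\<^bsub>P\<^esub> c) = a \<odot>\<^bsub>U\<^esub> s c"
      by (rule inj_onD[OF inj]) (use ac s mod_homD(3)[OF fh] mod_homD(3)[OF r] P.smult_closed U.smult_closed in simp_all)
  qed (simp add: s_def)
  then show ?thesis using that s(1) by blast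
qed

definition prod_mod :: "('a, 'b, 'm) module_scheme \<Rightarrow> ('a, 'c, 'n) module_scheme \<Rightarrow> ('a, 'b \<times> 'c) module" where
  "prod_mod M N = \<lparr>carrier = carrier M \<times> carrier N, mult = undefined, one = undefined, zero = (\<zero>\<^bsub>M\<^esub>, \<zero>\<^bsub>N\<^esub>),
     add = (\<lambda>x y. (fst x \<oplus>\<^bsub>M\<^esub> fst y, snd x \<oplus>\<^bsub>N\<^esub> snd y)), smult = (\<lambda>a x. (a \<odot>\<^bsub>M\<^esub> fst x, a \<odot>\<^bsub>N\<^esub> snd x))\<rparr>"

lemma prod_mod_simps [simp]:
  "carrier (prod_mod M N) = carrier M \<times> carrier N" "\<zero>\<^bsub>prod_mod M N\<^esub> = (\<zero>\<^bsub>M\<^esub>, \<zero>\<^bsub>N\<^esub>)"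
  "x \<oplus>\<^bsub>prod_mod M N\<^esub> y = (fst x \<oplus>\<^bsub>M\<^esub> fst y, snd x \<oplus>\<^bsub>N\<^esub> snd y)" "a \<odot>\<^bsub>prod_mod M N\<^esub> x = (a \<odot>\<^bsub>M\<^esub> fst x, a \<odot>\<^bsub>N\<^esub> snd x)"
  by (simp_all add: prod_mod_def)

lemma left_module_prod:
  assumes "left_module R M" "left_module R N"
  shows "left_module R (prod_mod M N)"
proof -
  interpret M: left_module R M by fact
  interpret N: left_module R N by fact
  have "\<exists>y\<in>carrier M \<times> carrier N. fst y \<oplus>\<^bsub>M\<^esub> fst x = \<zero>\<^bsub>M\<^esub> \<and> snd y \<oplus>\<^bsub>N\<^esub> snd x = \<zero>\<^bsub>N\<^esub>" if "x \<in> carrier M \<times> carrier N" for x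
    by (rule bexI[of _ "(\<ominus>\<^bsub>M\<^esub> fst x, \<ominus>\<^bsub>N\<^esub> snd x)"]) (use that in \<open>auto simp: M.M.l_neg N.M.l_neg\<close>)
  then show ?thesis
    by (intro left_moduleI)
       (auto simp: M.R.ring_axioms M.M.a_ac N.M.a_ac M.smult_closed N.smult_closed M.smult_l_distr N.smult_l_distr
          M.smult_r_distr N.smult_r_distr M.smult_assoc N.smult_assoc M.smult_one N.smult_one)
qed

lemma sum_hom:
  assumes lm: "left_module R M" "left_module R N" "left_module R V" and f: "f \<in> mod_hom R M V" and g: "g \<in> mod_hom R N V"
  shows "(\<lambda>x\<in>carrier (prod_mod M N). f (fst x) \<oplus>\<^bsub>V\<^esub> g (snd x)) \<in> mod_hom R (prod_mod M N) V"
proof -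
  interpret M: left_module R M by fact
  interpret N: left_module R N by fact
  interpret V: left_module R V by fact
  show ?thesis
    by (rule mod_homI)
       (auto simp: mod_homD(1-3)[OF f] mod_homD(1-3)[OF g] V.M.a_ac V.smult_r_distr M.smult_closed N.smult_closed)
qed

text \<open>
  The vanishing of the class of the pushout extension along \<open>g\<close>, in terms of the resolution. Lifting the
  start of the free resolution of \<open>W\<close> along \<open>V \<rightarrow> W\<close> gives \<open>s\<^sub>0 : P\<^sub>0 \<rightarrow> V\<close> and \<open>s\<^sub>1 : P\<^sub>1 \<rightarrow> U\<close>. Then \<open>g s\<^sub>1\<close> is a
  cocycle, hence \<open>g s\<^sub>1 = t \<partial>\<close> for some \<open>t\<close> on \<open>P\<^sub>0\<close>. Since \<open>(u, p) \<mapsto> f u + s\<^sub>0 p\<close> maps \<open>U \<times> P\<^sub>0\<close> onto \<open>V\<close> and its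
  kernel consists of the pairs \<open>(- s\<^sub>1 c, \<partial> c)\<close>, the map \<open>(u, p) \<mapsto> g u + t p\<close> descends to \<open>V\<close>.
\<close>

lemma hom_extends:
  assumes lm: "left_module R U" "left_module R V" "left_module R W" "left_module R N"
    and f: "f \<in> mod_mono R U V"
    and p: "\<pi> \<in> mod_hom R V W" "\<pi> ` carrier V = carrier W"
      "\<And>v. v \<in> carrier V \<Longrightarrow> \<pi> v = \<zero>\<^bsub>W\<^esub> \<longleftrightarrow> v \<in> f ` carrier U"
    and ext: "trivial_group (Ext1 R W N)" and g: "g \<in> mod_hom R U N"
  obtains h where "h \<in> mod_hom R V N" "\<And>u. u \<in> carrier U \<Longrightarrow> h (f u) = g u"
proof -
  interpret U: left_module R U by fact
  interpret V: left_module R V by fact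
  interpret W: left_module R W by fact
  interpret N: left_module R N by fact
  have fh: "f \<in> mod_hom R U V" and finj: "inj_on f (carrier U)" using f by (auto simp: mod_mono_def)
  have rg: "ring R" by (rule U.R.ring_axioms)
  define P0 where "P0 = res0 R W"
  define P1 where "P1 = res1 R W"
  let ?aug = "lin_comb R W" and ?dd = "lin_comb R P0"
  have P0: "P0 = free_module R (carrier W)" by (simp only: P0_def res0_def)
  have P1: "P1 = free_module R {x \<in> carrier P0. ?aug x = \<zero>\<^bsub>W\<^esub>}" unfolding P1_def res1_def a_kernel_eq P0_def ..
  have P2: "res2 R W = free_module R {x \<in> carrier P1. ?dd x = \<zero>\<^bsub>P0\<^esub>}" unfolding res2_def a_kernel_eq P0_def P1_def ..
  interpret P0: left_module R P0 unfolding P0 by (rule left_module_free[OF rg])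
  interpret P1: left_module R P1 unfolding P1 by (rule left_module_free[OF rg])
  have eh: "restrict ?aug (carrier P0) \<in> mod_hom R P0 W"
    unfolding lin_comb_eq_linext P0 by (rule W.linext_hom) auto
  have dh: "restrict ?dd (carrier P1) \<in> mod_hom R P1 P0"
    unfolding lin_comb_eq_linext P1 by (rule P0.linext_hom) auto
  have d: "?dd c \<in> carrier P0" "?aug (?dd c) = \<zero>\<^bsub>W\<^esub>" if "c \<in> carrier P1" for c
    using lin_comb_lin_comb_zero[OF P0.left_module_axioms lm(3) eh] that unfolding P1 by blast+
  have d2: "lin_comb R P1 c \<in> carrier P1" "?dd (lin_comb R P1 c) = \<zero>\<^bsub>P0\<^esub>" if "c \<in> carrier (res2 R W)" for c
    using lin_comb_lin_comb_zero[OF P1.left_module_axioms P0.left_module_axioms dh] that unfolding P2 by blast+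
  define \<sigma> where "\<sigma> w = (SOME v. v \<in> carrier V \<and> \<pi> v = w)" for w
  have sg: "\<sigma> w \<in> carrier V" "\<pi> (\<sigma> w) = w" if "w \<in> carrier W" for w
  proof -
    from that have "w \<in> \<pi> ` carrier V" unfolding p(2) .
    then have "\<exists>v. v \<in> carrier V \<and> \<pi> v = w" by (elim imageE) blast
    from someI_ex[OF this] show "\<sigma> w \<in> carrier V" "\<pi> (\<sigma> w) = w" unfolding \<sigma>_def by (rule conjunct1, rule conjunct2)
  qed
  define s0 where "s0 = restrict (linext R V \<sigma>) (carrier P0)"
  have s0h: "s0 \<in> mod_hom R P0 V" unfolding s0_def P0 by (rule V.linext_hom) (use sg in auto)
  have ps0: "\<pi> (s0 c) = ?aug c" if c: "c \<in> carrier P0" for c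
  proof -
    have "\<pi> (s0 c) = linext R W (\<lambda>w. \<pi> (\<sigma> w)) c"
      using hom_linext[OF lm(2,3) p(1), of \<sigma> "carrier W" c] sg(1) c unfolding s0_def P0 by (simp only: restrict_apply' Pi_iff) blast
    also have "\<dots> = ?aug c" unfolding linext_def lin_comb_def
      using c sg(2) unfolding P0 by (intro W.M.finsum_cong') (auto simp: W.smult_closed Pi_iff subset_iff)
    finally show ?thesis .
  qed
  have r: "compose (carrier P1) s0 (restrict ?dd (carrier P1)) \<in> mod_hom R P1 V" by (rule mod_hom_compose[OF P1.left_module_axioms dh s0h])
  have rc: "compose (carrier P1) s0 (restrict ?dd (carrier P1)) c = s0 (?dd c)" if "c \<in> carrier P1" for c using that by (simp add: compose_def)
  have rim: "compose (carrier P1) s0 (restrict ?dd (carrier P1)) c \<in> f ` carrier U" if c: "c \<in> carrier P1" for c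
    unfolding rc[OF c] using p(3)[OF mod_homD(1)[OF s0h d(1)[OF c]]] ps0[OF d(1)[OF c]] d(2)[OF c] by simp
  obtain s1 where s1: "s1 \<in> mod_hom R P1 U" "\<And>c. c \<in> carrier P1 \<Longrightarrow> f (s1 c) = s0 (?dd c)"
    using lift_through_mono[OF P1.left_module_axioms lm(1) f r rim] rc by metis
  define \<gamma> where "\<gamma> = compose (carrier P1) g s1"
  have gh: "\<gamma> \<in> mod_hom R P1 N" unfolding \<gamma>_def by (rule mod_hom_compose[OF P1.left_module_axioms s1(1) g])
  have f0: "u = \<zero>\<^bsub>U\<^esub>" if "u \<in> carrier U" "f u = \<zero>\<^bsub>V\<^esub>" for u
    using inj_onD[OF finj _ that(1) U.M.zero_closed] that(2) mod_hom_arith(1)[OF lm(1,2) fh] by simp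
  have "\<gamma> \<in> ext1_cocycles R W N"
    unfolding ext1_cocycles_def P1_def[symmetric]
  proof (intro CollectI conjI ballI gh)
    fix c assume "c \<in> carrier (res2 R W)"
    note c = d2[OF this]
    have "f (s1 (lin_comb R P1 c)) = \<zero>\<^bsub>V\<^esub>"
      unfolding s1(2)[OF c(1)] c(2) by (rule mod_hom_arith(1)[OF P0.left_module_axioms lm(2) s0h])
    then have "s1 (lin_comb R P1 c) = \<zero>\<^bsub>U\<^esub>" using f0 mod_homD(1)[OF s1(1) c(1)] by blast
    then show "\<gamma> (lin_comb R P1 c) = \<zero>\<^bsub>N\<^esub>"
      using c(1) mod_hom_arith(1)[OF lm(1,4) g] by (simp add: \<gamma>_def compose_def)
  qed
  from Ext1_trivial_cocycle[OF lm(4) ext this]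
  obtain t where t: "t \<in> mod_hom R P0 N" "\<gamma> = compose (carrier P1) t ?dd"
    unfolding ext1_coboundaries_def P0_def P1_def by blast
  have tg: "t (?dd c) = g (s1 c)" if "c \<in> carrier P1" for c
    using fun_cong[OF t(2), of c] that by (simp add: \<gamma>_def compose_def)
  let ?Q = "prod_mod U P0"
  let ?F = "\<lambda>x\<in>carrier ?Q. f (fst x) \<oplus>\<^bsub>V\<^esub> s0 (snd x)" and ?G = "\<lambda>x\<in>carrier ?Q. g (fst x) \<oplus>\<^bsub>N\<^esub> t (snd x)"
  have Q: "left_module R ?Q" by (rule left_module_prod[OF lm(1) P0.left_module_axioms])
  have Fh: "?F \<in> mod_hom R ?Q V" by (rule sum_hom[OF lm(1) P0.left_module_axioms lm(2) fh s0h])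
  have Gh: "?G \<in> mod_hom R ?Q N" by (rule sum_hom[OF lm(1) P0.left_module_axioms lm(4) g t(1)])
  have Fs: "?F ` carrier ?Q = carrier V"
  proof
    show "?F ` carrier ?Q \<subseteq> carrier V" using mod_homD(1)[OF Fh] by blast
    show "carrier V \<subseteq> ?F ` carrier ?Q"
    proof
      fix v assume v: "v \<in> carrier V"
      have b: "basis R (\<pi> v) \<in> carrier P0" unfolding P0 by (rule basis_carrier[OF rg mod_homD(1)[OF p(1) v]])
      let ?b = "s0 (basis R (\<pi> v))"
      have bc: "?b \<in> carrier V" using mod_homD(1)[OF s0h b] .
      have "\<pi> ?b = \<pi> v"
        unfolding ps0[OF b] lin_comb_eq_linext by (rule W.linext_basis) (rule mod_homD(1)[OF p(1) v])
      then have "\<pi> (v \<ominus>\<^bsub>V\<^esub> ?b) = \<zero>\<^bsub>W\<^esub>"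
        unfolding mod_hom_arith(3)[OF lm(2,3) p(1) v bc] using mod_homD(1)[OF p(1) v] by (simp add: a_minus_def W.M.r_neg)
      moreover have "v \<ominus>\<^bsub>V\<^esub> ?b \<in> carrier V" using v bc by (simp add: a_minus_def)
      ultimately obtain u where u: "u \<in> carrier U" "v \<ominus>\<^bsub>V\<^esub> ?b = f u" using p(3) by blast
      have "v = f u \<oplus>\<^bsub>V\<^esub> ?b" unfolding u(2)[symmetric] using v bc by (simp add: a_minus_def V.M.a_assoc V.M.l_neg)
      then have "v = ?F (u, basis R (\<pi> v))" using u(1) b by simp
      then show "v \<in> ?F ` carrier ?Q" using u(1) b by (metis (no_types, lifting) image_eqI SigmaI prod_mod_simps(1))
    qed
  qed
  have ker: "?G x = \<zero>\<^bsub>N\<^esub>" if x: "x \<in> carrier ?Q" and z: "?F x = \<zero>\<^bsub>V\<^esub>" for x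
  proof -
    obtain u q where x': "x = (u, q)" by (cases x)
    have u: "u \<in> carrier U" and q: "q \<in> carrier P0" using x x' by auto
    have sq: "s0 q \<in> carrier V" and fu: "f u \<in> carrier V" using mod_homD(1)[OF s0h q] mod_homD(1)[OF fh u] .
    have z': "f u \<oplus>\<^bsub>V\<^esub> s0 q = \<zero>\<^bsub>V\<^esub>" using z x x' by simp
    have "s0 q = \<ominus>\<^bsub>V\<^esub> f u" using V.M.minus_equality[of "s0 q" "f u"] z' sq fu by (simp add: V.M.a_comm)
    then have sn: "s0 q = f (\<ominus>\<^bsub>U\<^esub> u)" using mod_hom_arith(2)[OF lm(1,2) fh u] by simp
    have "\<pi> (s0 q) = \<zero>\<^bsub>W\<^esub>" using p(3)[OF sq] sn u by blast
    then have qK: "q \<in> {x \<in> carrier P0. ?aug x = \<zero>\<^bsub>W\<^esub>}" using ps0[OF q] q by simp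
    have b: "basis R q \<in> carrier P1" unfolding P1 by (rule basis_carrier[OF rg qK])
    have db: "?dd (basis R q) = q" unfolding lin_comb_eq_linext by (rule P0.linext_basis) (rule q)
    have "f (s1 (basis R q)) = f (\<ominus>\<^bsub>U\<^esub> u)" using s1(2)[OF b] db sn by simp
    then have "s1 (basis R q) = \<ominus>\<^bsub>U\<^esub> u" using inj_onD[OF finj _ mod_homD(1)[OF s1(1) b]] u by simp
    then have "t q = \<ominus>\<^bsub>N\<^esub> g u" using tg[OF b] db mod_hom_arith(2)[OF lm(1,4) g u] by simp
    then show ?thesis using x x' u mod_homD(1)[OF g u] by (simp add: N.M.r_neg)
  qed
  have "\<exists>h\<in>mod_hom R V N. \<forall>x\<in>carrier ?Q. h (?F x) = ?G x"
    by (rule factor_through_surjection[OF Q lm(2,4) Fh Fs Gh ker]; (assumption | blast))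
  then obtain h where h: "h \<in> mod_hom R V N" and hx: "\<forall>x\<in>carrier ?Q. h (?F x) = ?G x" by (elim bexE)
  have "h (f u) = g u" if u: "u \<in> carrier U" for u
    using bspec[OF hx, of "(u, \<zero>\<^bsub>P0\<^esub>)"] u mod_hom_arith(1)[OF P0.left_module_axioms lm(2) s0h] mod_hom_arith(1)[OF P0.left_module_axioms lm(4) t(1)]
      mod_homD(1)[OF fh u] mod_homD(1)[OF g u] by simp
  then show ?thesis using that h by blast
qed

context central_ops begin

lemma annih_factor:
  assumes lm: "left_module R U" "left_module R V" "left_module R W" "left_module R X"
    and f: "f \<in> mod_hom R U V" and p: "\<pi> \<in> mod_hom R V W" "\<pi> ` carrier V = carrier W"
      "\<And>v. v \<in> carrier V \<Longrightarrow> \<pi> v = \<zero>\<^bsub>W\<^esub> \<longleftrightarrow> v \<in> f ` carrier U"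
  shows "annih U V X f = (\<lambda>\<psi>. compose (carrier V) \<psi> \<pi>) ` mod_hom R W X"
proof
  show "annih U V X f \<subseteq> (\<lambda>\<psi>. compose (carrier V) \<psi> \<pi>) ` mod_hom R W X"
  proof
    fix \<phi> assume ph: "\<phi> \<in> annih U V X f"
    then have h: "\<phi> \<in> mod_hom R V X" by (simp add: annih_def)
    have z: "\<phi> v = \<zero>\<^bsub>X\<^esub>" if "v \<in> carrier V" "\<pi> v = \<zero>\<^bsub>W\<^esub>" for v
      using ph p(3)[OF that(1)] that(2) by (auto simp: annih_def)
    have "\<exists>\<psi>\<in>mod_hom R W X. \<forall>v\<in>carrier V. \<psi> (\<pi> v) = \<phi> v"
      by (rule factor_through_surjection[OF lm(2-4) p(1,2) h z]; (assumption | blast))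
    then obtain \<psi> where ps: "\<psi> \<in> mod_hom R W X" "\<forall>v\<in>carrier V. \<psi> (\<pi> v) = \<phi> v" by (elim bexE)
    have "\<phi> = compose (carrier V) \<psi> \<pi>"
      by (rule mod_hom_eqI[OF h mod_hom_compose[OF lm(2) p(1) ps(1)]]) (simp add: compose_def bspec[OF ps(2)])
    then show "\<phi> \<in> (\<lambda>\<psi>. compose (carrier V) \<psi> \<pi>) ` mod_hom R W X" using ps(1) by blast
  qed
  show "(\<lambda>\<psi>. compose (carrier V) \<psi> \<pi>) ` mod_hom R W X \<subseteq> annih U V X f"
  proof
    fix \<phi> assume "\<phi> \<in> (\<lambda>\<psi>. compose (carrier V) \<psi> \<pi>) ` mod_hom R W X"
    then obtain \<psi> where ps: "\<psi> \<in> mod_hom R W X" "\<phi> = compose (carrier V) \<psi> \<pi>" by blast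
    have "\<phi> (f u) = \<zero>\<^bsub>X\<^esub>" if u: "u \<in> carrier U" for u
    proof -
      have fu: "f u \<in> carrier V" using mod_homD(1)[OF f u] .
      then have "\<pi> (f u) = \<zero>\<^bsub>W\<^esub>" using p(3) u by blast
      then show ?thesis using ps(2) fu mod_hom_arith(1)[OF lm(3,4) ps(1)] by (simp add: compose_def)
    qed
    then show "\<phi> \<in> annih U V X f" using mod_hom_compose[OF lm(2) p(1) ps(1)] ps(2) by (simp add: annih_def)
  qed
qed

lemma annih_len:
  assumes lm: "left_module R U" "left_module R V" "left_module R W" "left_module R X"
    and f: "f \<in> mod_hom R U V" and p: "\<pi> \<in> mod_hom R V W" "\<pi> ` carrier V = carrier W"
      "\<And>v. v \<in> carrier V \<Longrightarrow> \<pi> v = \<zero>\<^bsub>W\<^esub> \<longleftrightarrow> v \<in> f ` carrier U"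
  shows "hom_len W X = len Z (fun_mod (carrier V) X) (annih U V X f)"
proof -
  have im: "annih U V X f = (\<lambda>\<psi>. compose (carrier V) \<psi> \<pi>) ` mod_hom R W X" by (rule annih_factor) fact+
  show ?thesis unfolding hom_len_def im
  proof (rule len_inj[OF left_module_fun_mod[OF lm(4)] left_module_fun_mod[OF lm(4)] Z_sub precomp_lin[OF lm(2) p(1) lm(3)] mod_hom_stable[OF lm(3,4)]])
    fix \<psi> assume ps: "\<psi> \<in> mod_hom R W X" and z: "compose (carrier V) \<psi> \<pi> = \<zero>\<^bsub>fun_mod (carrier V) X\<^esub>"
    have z': "\<psi> (\<pi> v) = \<zero>\<^bsub>X\<^esub>" if "v \<in> carrier V" for v using fun_cong[OF z, of v] that by (simp add: compose_def)
    have "\<psi> w = \<zero>\<^bsub>X\<^esub>" if "w \<in> carrier W" for w using z' that unfolding p(2)[symmetric] by blast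
    then show "\<psi> = \<zero>\<^bsub>fun_mod (carrier W) X\<^esub>" using mod_homD(4)[OF ps] by (auto simp: fun_eq_iff)
  qed
qed

text \<open>
  It suffices to continue the projection \<open>\<pi>\<close> to a series over \<open>W\<close>, choosing each coefficient as an extension
  along \<open>f\<close> of a map determined by the previous one; a general \<open>\<psi>\<close> factors through \<open>\<pi>\<close>.
\<close>

lemma lifts_if_extends:
  assumes lm: "left_module R U" "left_module R V" "left_module R W" "left_module R X"
    and f: "f \<in> mod_hom R U V" "f' \<in> mod_hom R U V" and p: "\<pi> \<in> mod_hom R V W" "\<pi> ` carrier V = carrier W"
      "\<And>v. v \<in> carrier V \<Longrightarrow> \<pi> v = \<zero>\<^bsub>W\<^esub> \<longleftrightarrow> v \<in> f ` carrier U"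
    and ext: "\<And>g. g \<in> mod_hom R U W \<Longrightarrow> \<exists>h\<in>mod_hom R V W. \<forall>u\<in>carrier U. h (f u) = g u"
  shows "lifts U V X f f'"
  unfolding lifts_def
proof
  interpret U: left_module R U by fact
  interpret W: left_module R W by fact
  interpret X: left_module R X by fact
  have im: "annih U V X f = (\<lambda>\<psi>. compose (carrier V) \<psi> \<pi>) ` mod_hom R W X" by (rule annih_factor) fact+
  fix \<psi> assume "\<psi> \<in> annih U V X f"
  then obtain \<psi>' where ps: "\<psi>' \<in> mod_hom R W X" "\<psi> = compose (carrier V) \<psi>' \<pi>" unfolding im by blast
  have step: "\<exists>h'. h' \<in> mod_hom R V W \<and> (\<forall>u\<in>carrier U. h' (f u) = \<ominus>\<^bsub>W\<^esub> h (f' u))" if h: "h \<in> mod_hom R V W" for h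
  proof -
    have "(\<lambda>u\<in>carrier U. \<ominus>\<^bsub>W\<^esub> h (f' u)) \<in> mod_hom R U W"
      by (rule mod_homI) (auto simp: mod_homD(1-3)[OF h] mod_homD(1-3)[OF f(2)] W.M.minus_add W.M.a_ac U.smult_closed W.smult_neg)
    from ext[OF this] show ?thesis by auto
  qed
  define H where "H = rec_nat \<pi> (\<lambda>_ h. SOME h'. h' \<in> mod_hom R V W \<and> (\<forall>u\<in>carrier U. h' (f u) = \<ominus>\<^bsub>W\<^esub> h (f' u)))"
  have H0: "H 0 = \<pi>" by (simp add: H_def)
  have HS: "H (Suc i) = (SOME h'. h' \<in> mod_hom R V W \<and> (\<forall>u\<in>carrier U. h' (f u) = \<ominus>\<^bsub>W\<^esub> H i (f' u)))" for i by (simp add: H_def)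
  have Hh: "H i \<in> mod_hom R V W" for i
  proof (induction i)
    case 0 then show ?case using p(1) H0 by simp
  next
    case (Suc i)
    from someI_ex[OF step[OF Suc]] show ?case unfolding HS by blast
  qed
  have Hr: "H (Suc i) (f u) = \<ominus>\<^bsub>W\<^esub> H i (f' u)" if "u \<in> carrier U" for i u
    using someI_ex[OF step[OF Hh[of i]]] that unfolding HS by blast
  let ?\<chi> = "\<lambda>i. compose (carrier V) \<psi>' (H i)"
  have "?\<chi> (Suc i) (f u) \<oplus>\<^bsub>X\<^esub> ?\<chi> i (f' u) = \<zero>\<^bsub>X\<^esub>" if u: "u \<in> carrier U" for i u
  proof -
    have c: "f u \<in> carrier V" "f' u \<in> carrier V" using mod_homD(1)[OF f(1) u] mod_homD(1)[OF f(2) u] .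
    have w: "H i (f' u) \<in> carrier W" using mod_homD(1)[OF Hh c(2)] .
    have "\<psi>' (\<ominus>\<^bsub>W\<^esub> H i (f' u)) = \<ominus>\<^bsub>X\<^esub> \<psi>' (H i (f' u))" by (rule mod_hom_arith(2)[OF lm(3,4) ps(1) w])
    then show ?thesis using c Hr[OF u] mod_homD(1)[OF ps(1) w] by (simp add: compose_def X.M.l_neg)
  qed
  moreover have "?\<chi> i \<in> mod_hom R V X" for i by (rule mod_hom_compose[OF lm(2) Hh ps(1)])
  ultimately show "\<exists>\<chi>. \<chi> 0 = \<psi> \<and> (\<forall>i. \<chi> i \<in> mod_hom R V X) \<and> (\<forall>i. \<forall>u\<in>carrier U. \<chi> (Suc i) (f u) \<oplus>\<^bsub>X\<^esub> \<chi> i (f' u) = \<zero>\<^bsub>X\<^esub>)"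
    using ps(2) H0 by (intro exI[of _ ?\<chi>]) simp
qed

text \<open>
  The theorem in the generality in which the argument works: over any ring with a set \<open>Z\<close> of central elements
  for which \<open>V\<close> has finite length.
\<close>

theorem rigid_cokernels_isomorphic:
  assumes lm: "left_module R U" "left_module R V" and fin: "zfinite V"
    and f: "f \<in> mod_mono R U V" "f' \<in> mod_mono R U V"
    and W: "is_cokernel R U V f W" "is_cokernel R U V f' W'"
    and ext: "trivial_group (Ext1 R W W)" "trivial_group (Ext1 R W' W')"
  shows "mod_isomorphic R W W'"
proof -
  have lW: "left_module R W" "left_module R W'" using W by (auto simp: is_cokernel_def)
  have fh: "f \<in> mod_hom R U V" "f' \<in> mod_hom R U V" using f by (auto simp: mod_mono_def)
  obtain \<pi> where p: "\<pi> \<in> mod_hom R V W" "\<pi> ` carrier V = carrier W"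
    "\<And>v. v \<in> carrier V \<Longrightarrow> \<pi> v = \<zero>\<^bsub>W\<^esub> \<longleftrightarrow> v \<in> f ` carrier U"
    by (rule cokernel_projection[OF lm fh(1) W(1)]) blast
  obtain \<pi>' where p': "\<pi>' \<in> mod_hom R V W'" "\<pi>' ` carrier V = carrier W'"
    "\<And>v. v \<in> carrier V \<Longrightarrow> \<pi>' v = \<zero>\<^bsub>W'\<^esub> \<longleftrightarrow> v \<in> f' ` carrier U"
    by (rule cokernel_projection[OF lm fh(2) W(2)]) blast
  have finW: "zfinite W" "zfinite W'"
    using zfinite_image[OF lm(2) lW(1) fin p(1,2)] zfinite_image[OF lm(2) lW(2) fin p'(1,2)] .
  have e: "\<exists>h\<in>mod_hom R V W. \<forall>u\<in>carrier U. h (f u) = g u" if g: "g \<in> mod_hom R U W" for g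
    by (rule hom_extends[OF lm lW(1,1) f(1) p ext(1) g]) blast+
  have e': "\<exists>h\<in>mod_hom R V W'. \<forall>u\<in>carrier U. h (f' u) = g u" if g: "g \<in> mod_hom R U W'" for g
    by (rule hom_extends[OF lm lW(2,2) f(2) p' ext(2) g]) blast+
  have eq: "hom_len W X = hom_len W' X" if X: "left_module R X" "zfinite X" for X :: "('a, 'x, 'xx) module_scheme"
  proof -
    have "lifts U V X f f'" by (rule lifts_if_extends[OF lm lW(1) X(1) fh p e])
    moreover have "lifts U V X f' f" by (rule lifts_if_extends[OF lm lW(2) X(1) fh(2,1) p' e'])
    ultimately have "len Z (fun_mod (carrier V) X) (annih U V X f) = len Z (fun_mod (carrier V) X) (annih U V X f')"
      by (rule annih_len_eq[OF lm X(1) fh _ _ hom_len_finite[OF lm(2) X(1) fin X(2)]])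
    moreover have "hom_len W X = len Z (fun_mod (carrier V) X) (annih U V X f)" by (rule annih_len[OF lm lW(1) X(1) fh(1) p])
    moreover have "hom_len W' X = len Z (fun_mod (carrier V) X) (annih U V X f')" by (rule annih_len[OF lm lW(2) X(1) fh(2) p'])
    ultimately show ?thesis by simp
  qed
  show ?thesis by (rule isomorphic_if_hom_len_eq[OF lW finW]) (rule eq, assumption+)+
qed

end

section \<open>Finite length over an artin algebra\<close>

lemma (in left_module) cyclic_stable:
  assumes y: "y \<in> carrier M" and Y: "Y \<subseteq> carrier R" "\<zero> \<in> Y" "\<And>a b. a \<in> Y \<Longrightarrow> b \<in> Y \<Longrightarrow> a \<oplus> b \<in> Y"
    "\<And>a. a \<in> Y \<Longrightarrow> \<ominus> a \<in> Y" "\<And>a b. a \<in> Y \<Longrightarrow> b \<in> Y \<Longrightarrow> a \<otimes> b \<in> Y"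
  shows "stable_sub Y M {a \<odot>\<^bsub>M\<^esub> y |a. a \<in> Y}"
proof -
  have c: "a \<in> carrier R" if "a \<in> Y" for a using Y(1) that by blast
  show ?thesis
  proof (rule stableI)
    show "{a \<odot>\<^bsub>M\<^esub> y |a. a \<in> Y} \<subseteq> carrier M" using smult_closed[OF c y] by blast
    have "\<zero>\<^bsub>M\<^esub> = \<zero> \<odot>\<^bsub>M\<^esub> y" using zero_smult[OF y] by simp
    then show "\<zero>\<^bsub>M\<^esub> \<in> {a \<odot>\<^bsub>M\<^esub> y |a. a \<in> Y}" using Y(2) by blast
  next
    fix u v assume "u \<in> {a \<odot>\<^bsub>M\<^esub> y |a. a \<in> Y}" "v \<in> {a \<odot>\<^bsub>M\<^esub> y |a. a \<in> Y}"
    then obtain a b where ab: "a \<in> Y" "b \<in> Y" "u = a \<odot>\<^bsub>M\<^esub> y" "v = b \<odot>\<^bsub>M\<^esub> y" by blast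
    then have "u \<oplus>\<^bsub>M\<^esub> v = (a \<oplus> b) \<odot>\<^bsub>M\<^esub> y" using smult_l_distr[OF c c y] by simp
    then show "u \<oplus>\<^bsub>M\<^esub> v \<in> {a \<odot>\<^bsub>M\<^esub> y |a. a \<in> Y}" using Y(3)[OF ab(1,2)] by blast
  next
    fix u assume "u \<in> {a \<odot>\<^bsub>M\<^esub> y |a. a \<in> Y}"
    then obtain a where a: "a \<in> Y" "u = a \<odot>\<^bsub>M\<^esub> y" by blast
    then have "\<ominus>\<^bsub>M\<^esub> u = (\<ominus> a) \<odot>\<^bsub>M\<^esub> y" using neg_smult[OF c y] by simp
    then show "\<ominus>\<^bsub>M\<^esub> u \<in> {a \<odot>\<^bsub>M\<^esub> y |a. a \<in> Y}" using Y(4)[OF a(1)] by blast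
  next
    fix z u assume z: "z \<in> Y" and "u \<in> {a \<odot>\<^bsub>M\<^esub> y |a. a \<in> Y}"
    then obtain a where a: "a \<in> Y" "u = a \<odot>\<^bsub>M\<^esub> y" by blast
    then have "z \<odot>\<^bsub>M\<^esub> u = (z \<otimes> a) \<odot>\<^bsub>M\<^esub> y" using smult_assoc[OF c[OF z] c y] by simp
    then show "z \<odot>\<^bsub>M\<^esub> u \<in> {a \<odot>\<^bsub>M\<^esub> y |a. a \<in> Y}" using Y(5)[OF z a(1)] by blast
  qed
qed

context central_ops begin

text \<open>
  Let \<open>B\<close> modulo \<open>A\<close> be simple. A central element \<open>z\<close> acts on it as zero or injectively, and in the
  latter case the equation \<open>z\<^sup>n = z' z\<^sup>n\<^sup>+\<^sup>1\<close> makes \<open>z'\<close> an inverse of \<open>z\<close>. So \<open>Z\<close> acts through a field, and adjoining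
  one element to a subspace increases the length by at most one. As the ring is finitely generated over \<open>Z\<close>,
  finitely many elements lead from \<open>A\<close> to \<open>B\<close>.
\<close>

lemma simple_factor_finite:
  assumes lm: "left_module R V"
    and Z1: "\<one> \<in> Z" and Zadd: "\<And>y z. y \<in> Z \<Longrightarrow> z \<in> Z \<Longrightarrow> y \<oplus> z \<in> Z" and Zneg: "\<And>z. z \<in> Z \<Longrightarrow> \<ominus> z \<in> Z"
    and Zmult: "\<And>y z. y \<in> Z \<Longrightarrow> z \<in> Z \<Longrightarrow> y \<otimes> z \<in> Z"
    and dcc: "\<And>z. z \<in> Z \<Longrightarrow> \<exists>n. \<exists>z'\<in>Z. z [^] (n::nat) = z' \<otimes> z [^] Suc n"
    and fg: "finite S" "S \<subseteq> carrier R" "\<And>a. a \<in> carrier R \<Longrightarrow> \<exists>c\<in>S \<rightarrow> Z. a = (\<Oplus>s\<in>S. c s \<otimes> s)"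
    and A: "stable_sub (carrier R) V A" and B: "stable_sub (carrier R) V B" and AB: "A \<subseteq> B"
    and simple: "\<And>H. stable_sub (carrier R) V H \<Longrightarrow> A \<subseteq> H \<Longrightarrow> H \<subseteq> B \<Longrightarrow> H = A \<or> H = B"
  shows "rlen Z V A B \<noteq> \<infinity>"
proof (cases "A = B")
  case True
  interpret V: left_module R V by fact
  show ?thesis unfolding True V.rlen_self by simp
next
  case False
  interpret V: left_module R V by fact
  note Ac = stableD(5)[OF A] and Bc = stableD(5)[OF B]
  have AZ: "stable_sub Z V A" and BZ: "stable_sub Z V B" using stable_mono[OF A Z_sub] stable_mono[OF B Z_sub] .
  have comm: "z \<odot>\<^bsub>V\<^esub> (a \<odot>\<^bsub>V\<^esub> x) = a \<odot>\<^bsub>V\<^esub> (z \<odot>\<^bsub>V\<^esub> x)" if "z \<in> Z" "a \<in> carrier R" "x \<in> carrier V" for z a x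
    using V.smult_assoc[of z a x] V.smult_assoc[of a z x] Z_central[of z a] that ZR by simp
  have dich: "(\<forall>x\<in>B. z \<odot>\<^bsub>V\<^esub> x \<in> A) \<or> (\<exists>z'\<in>Z. \<forall>x\<in>B. x \<ominus>\<^bsub>V\<^esub> z' \<odot>\<^bsub>V\<^esub> (z \<odot>\<^bsub>V\<^esub> x) \<in> A)" if z: "z \<in> Z" for z
  proof -
    let ?T = "{x \<in> B. z \<odot>\<^bsub>V\<^esub> x \<in> A}"
    have zR: "z \<in> carrier R" using ZR[OF z] .
    have "stable_sub (carrier R) V ?T"
    proof (rule V.stableI)
      show "?T \<subseteq> carrier V" using Bc by blast
      show "\<zero>\<^bsub>V\<^esub> \<in> ?T" using stableD(2)[OF A] stableD(2)[OF B] V.smult_zero[OF zR] by simp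
    next
      fix x y assume "x \<in> ?T" "y \<in> ?T"
      then show "x \<oplus>\<^bsub>V\<^esub> y \<in> ?T" using stableD(3)[OF A] stableD(3)[OF B] V.smult_r_distr[OF zR] Bc by auto
    next
      fix x assume "x \<in> ?T"
      then show "\<ominus>\<^bsub>V\<^esub> x \<in> ?T" using V.stable_neg[OF A] V.stable_neg[OF B] V.smult_neg[OF zR] Bc by auto
    next
      fix a x assume "a \<in> carrier R" "x \<in> ?T"
      then show "a \<odot>\<^bsub>V\<^esub> x \<in> ?T" using stableD(4)[OF A] stableD(4)[OF B] comm[OF z] Bc by auto
    qed
    moreover have "A \<subseteq> ?T" using AB stableD(4)[OF A zR] by blast
    ultimately have "?T = A \<or> ?T = B" by (intro simple) auto
    then show ?thesis
    proof
      assume "?T = B" then show ?thesis by blast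
    next
      assume T: "?T = A"
      have pow: "x \<in> B \<Longrightarrow> z [^] n \<odot>\<^bsub>V\<^esub> x \<in> A \<Longrightarrow> x \<in> A" for n :: nat and x
      proof (induction n arbitrary: x)
        case 0 then show ?case using V.smult_one Bc by simp
      next
        case (Suc n)
        have "z \<odot>\<^bsub>V\<^esub> x \<in> B" using stableD(4)[OF B zR] Suc.prems(1) .
        moreover have "z [^] n \<odot>\<^bsub>V\<^esub> (z \<odot>\<^bsub>V\<^esub> x) \<in> A"
          using Suc.prems V.smult_assoc[of "z [^] n" z x] zR Bc by simp
        ultimately have "z \<odot>\<^bsub>V\<^esub> x \<in> A" by (rule Suc.IH)
        then show ?case using T Suc.prems(1) by blast
      qed
      obtain n z' where nz: "z' \<in> Z" "z [^] (n::nat) = z' \<otimes> z [^] Suc n" using dcc[OF z] by blast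
      have "x \<ominus>\<^bsub>V\<^esub> z' \<odot>\<^bsub>V\<^esub> (z \<odot>\<^bsub>V\<^esub> x) \<in> A" if x: "x \<in> B" for x
      proof -
        have z'R: "z' \<in> carrier R" using ZR[OF nz(1)] .
        have xc: "x \<in> carrier V" using Bc[OF x] .
        let ?y = "z' \<odot>\<^bsub>V\<^esub> (z \<odot>\<^bsub>V\<^esub> x)"
        have yB: "?y \<in> B" using stableD(4)[OF B z'R stableD(4)[OF B zR x]] .
        have xyB: "x \<ominus>\<^bsub>V\<^esub> ?y \<in> B" by (rule V.stable_minus[OF B x yB])
        have e: "z [^] n = (z' \<otimes> z [^] n) \<otimes> z" using nz(2) zR z'R by (simp add: m_assoc)
        have "z [^] n \<odot>\<^bsub>V\<^esub> ?y = z' \<odot>\<^bsub>V\<^esub> (z [^] n \<odot>\<^bsub>V\<^esub> (z \<odot>\<^bsub>V\<^esub> x))"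
          using comm[OF nz(1), of "z [^] n" "z \<odot>\<^bsub>V\<^esub> x"] zR V.smult_closed[OF zR xc] by simp
        also have "\<dots> = ((z' \<otimes> z [^] n) \<otimes> z) \<odot>\<^bsub>V\<^esub> x"
          using zR z'R xc V.smult_closed by (simp add: V.smult_assoc)
        also have "\<dots> = z [^] n \<odot>\<^bsub>V\<^esub> x" unfolding e[symmetric] ..
        finally have "z [^] n \<odot>\<^bsub>V\<^esub> (x \<ominus>\<^bsub>V\<^esub> ?y) = \<zero>\<^bsub>V\<^esub>"
          using zR xc Bc[OF yB] V.smult_closed by (simp add: a_minus_def V.smult_r_distr V.smult_neg V.M.r_neg)
        then have "z [^] n \<odot>\<^bsub>V\<^esub> (x \<ominus>\<^bsub>V\<^esub> ?y) \<in> A" using stableD(2)[OF A] by simp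
        then show ?thesis by (rule pow[OF xyB])
      qed
      then show ?thesis using nz(1) by blast
    qed
  qed
  have Z0: "\<zero> \<in> Z" using Zadd[OF Z1 Zneg[OF Z1]] by (simp add: r_neg)
  \<comment> \<open>A subspace strictly larger than \<open>G\<close> contains some \<open>g + z y\<close> with \<open>z\<close> nonzero in the field, hence \<open>y\<close>.\<close>
  have adjoin: "\<exists>G'. stable_sub Z V G' \<and> G \<subseteq> G' \<and> y \<in> G' \<and> G' \<subseteq> B \<and> rlen Z V G G' \<le> 1"
    if G: "stable_sub Z V G" "A \<subseteq> G" "G \<subseteq> B" and y: "y \<in> B" for G y
  proof -
    let ?C = "{z \<odot>\<^bsub>V\<^esub> y |z. z \<in> Z}"
    have yc: "y \<in> carrier V" using Bc[OF y] .
    have C: "stable_sub Z V ?C" by (rule V.cyclic_stable[OF yc Z_sub Z0 Zadd Zneg Zmult])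
    let ?G = "G <+>\<^bsub>V\<^esub> ?C"
    have stG: "stable_sub Z V ?G" by (rule V.stable_set_add[OF G(1) C Z_sub])
    note up = V.set_add_upper[OF G(1) C]
    have yG: "y \<in> ?G" using up(2) Z1 V.smult_one[OF yc] by force
    have zyB: "z \<odot>\<^bsub>V\<^esub> y \<in> B" if "z \<in> Z" for z using stableD(4)[OF B ZR[OF that] y] .
    have "?G \<subseteq> B"
    proof
      fix x assume "x \<in> ?G"
      then obtain g z where "g \<in> G" "z \<in> Z" "x = g \<oplus>\<^bsub>V\<^esub> z \<odot>\<^bsub>V\<^esub> y" unfolding V.set_add_iff by blast
      then show "x \<in> B" using stableD(3)[OF B, of g "z \<odot>\<^bsub>V\<^esub> y"] zyB G(3) by blast
    qed
    moreover have "rlen Z V G ?G \<le> 1"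
    proof (rule V.rlen_simple)
      fix H assume H: "stable_sub Z V H" "G \<subseteq> H" "H \<subseteq> ?G"
      show "H = G \<or> H = ?G"
      proof (cases "H = G")
        case False
        then obtain x where x: "x \<in> H" "x \<notin> G" using H(2) by blast
        then have "x \<in> ?G" using H(3) by blast
        then obtain g z where gz: "g \<in> G" "z \<in> Z" "x = g \<oplus>\<^bsub>V\<^esub> z \<odot>\<^bsub>V\<^esub> y" unfolding V.set_add_iff by blast
        have gc: "g \<in> carrier V" and zc: "z \<odot>\<^bsub>V\<^esub> y \<in> carrier V" using stableD(5)[OF G(1) gz(1)] V.smult_closed[OF ZR[OF gz(2)] yc] .
        have nA: "z \<odot>\<^bsub>V\<^esub> y \<notin> A" using x(2) stableD(3)[OF G(1) gz(1)] G(2) unfolding gz(3) by blast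
        then obtain z' where z': "z' \<in> Z" "y \<ominus>\<^bsub>V\<^esub> z' \<odot>\<^bsub>V\<^esub> (z \<odot>\<^bsub>V\<^esub> y) \<in> A" using dich[OF gz(2)] y by blast
        have "z \<odot>\<^bsub>V\<^esub> y = x \<ominus>\<^bsub>V\<^esub> g" unfolding gz(3) using gc zc by (simp add: a_minus_def V.M.a_ac V.M.r_neg1 V.M.r_neg2)
        then have "z \<odot>\<^bsub>V\<^esub> y \<in> H" using V.stable_minus[OF H(1) x(1)] gz(1) H(2) by auto
        then have m: "z' \<odot>\<^bsub>V\<^esub> (z \<odot>\<^bsub>V\<^esub> y) \<in> H" using stableD(4)[OF H(1) z'(1)] by blast
        have "(y \<ominus>\<^bsub>V\<^esub> z' \<odot>\<^bsub>V\<^esub> (z \<odot>\<^bsub>V\<^esub> y)) \<oplus>\<^bsub>V\<^esub> z' \<odot>\<^bsub>V\<^esub> (z \<odot>\<^bsub>V\<^esub> y) \<in> H"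
          using stableD(3)[OF H(1) _ m] z'(2) G(2) H(2) by blast
        then have yH: "y \<in> H" using yc stableD(5)[OF H(1) m] by (simp add: a_minus_def V.M.a_assoc V.M.l_neg)
        have "?G \<subseteq> H"
        proof
          fix w assume "w \<in> ?G"
          then obtain g' v where "g' \<in> G" "v \<in> Z" "w = g' \<oplus>\<^bsub>V\<^esub> v \<odot>\<^bsub>V\<^esub> y" unfolding V.set_add_iff by blast
          then show "w \<in> H" using stableD(3)[OF H(1), of g' "v \<odot>\<^bsub>V\<^esub> y"] stableD(4)[OF H(1) _ yH] H(2) by blast
        qed
        then show ?thesis using H(3) by blast
      qed simp
    qed
    ultimately show ?thesis using stG up(1) yG by blast
  qed
  have adjoin_fin: "\<exists>G. stable_sub Z V G \<and> A \<subseteq> G \<and> T \<subseteq> G \<and> G \<subseteq> B \<and> rlen Z V A G \<noteq> \<infinity>" if "finite T" "T \<subseteq> B" for T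
    using that
  proof (induction T rule: finite_induct)
    case empty
    show ?case by (rule exI[of _ A]) (use AZ AB V.rlen_self in auto)
  next
    case (insert y T)
    then obtain G where G: "stable_sub Z V G" "A \<subseteq> G" "T \<subseteq> G" "G \<subseteq> B" "rlen Z V A G \<noteq> \<infinity>" by auto
    have "y \<in> B" using insert.prems by simp
    from adjoin[OF G(1,2,4) this]
    obtain G' where G': "stable_sub Z V G'" "G \<subseteq> G'" "y \<in> G'" "G' \<subseteq> B" "rlen Z V G G' \<le> 1" by (elim exE conjE)
    have "rlen Z V G G' \<noteq> \<infinity>" by (rule enat_le_finite[OF G'(5)]) (simp add: one_enat_def)
    with G(5) have "rlen Z V A G' \<noteq> \<infinity>"
      by (intro enat_sum_finite[OF V.rlen_add[OF AZ G(1) Z_sub G(2) G'(2,1)]])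
    then show ?case using G G' by (intro exI[of _ G']) auto
  qed
  obtain b where b: "b \<in> B" "b \<notin> A" using False AB by blast
  have bc: "b \<in> carrier V" using Bc[OF b(1)] .
  let ?b = "{a \<odot>\<^bsub>V\<^esub> b |a. a \<in> carrier R}"
  have stb: "stable_sub (carrier R) V ?b" by (rule V.cyclic_stable[OF bc]) auto
  let ?H = "A <+>\<^bsub>V\<^esub> ?b"
  note up = V.set_add_upper[OF A stb]
  have bB: "a \<odot>\<^bsub>V\<^esub> b \<in> B" if "a \<in> carrier R" for a using stableD(4)[OF B that b(1)] .
  have HB: "?H \<subseteq> B"
  proof
    fix x assume "x \<in> ?H"
    then obtain u a where "u \<in> A" "a \<in> carrier R" "x = u \<oplus>\<^bsub>V\<^esub> a \<odot>\<^bsub>V\<^esub> b" unfolding V.set_add_iff by blast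
    then show "x \<in> B" using stableD(3)[OF B, of u "a \<odot>\<^bsub>V\<^esub> b"] bB AB by blast
  qed
  have "b \<in> ?b" using V.smult_one[OF bc] one_closed by force
  then have "?H \<noteq> A" using up(2) b(2) by blast
  then have HBe: "?H = B" using simple[OF V.stable_set_add[OF A stb subset_refl] up(1) HB] by blast
  let ?T = "(\<lambda>s. s \<odot>\<^bsub>V\<^esub> b) ` S"
  have "finite ?T" "?T \<subseteq> B" using fg(1,2) bB by auto
  from adjoin_fin[OF this] obtain G where G: "stable_sub Z V G" "A \<subseteq> G" "?T \<subseteq> G" "G \<subseteq> B" "rlen Z V A G \<noteq> \<infinity>" by blast
  have span: "a \<odot>\<^bsub>V\<^esub> b \<in> G" if a: "a \<in> carrier R" for a
  proof -
    obtain c where c: "c \<in> S \<rightarrow> Z" "a = (\<Oplus>s\<in>S. c s \<otimes> s)" using fg(3)[OF a] by blast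
    have cR: "c s \<in> carrier R" "c s \<in> Z" "s \<in> carrier R" if "s \<in> S" for s using c(1) fg(2) that ZR by auto
    have "a \<odot>\<^bsub>V\<^esub> b = (\<Oplus>\<^bsub>V\<^esub>s\<in>S. (c s \<otimes> s) \<odot>\<^bsub>V\<^esub> b)"
      unfolding c(2) by (rule V.finsum_smult_ring[OF bc]) (use cR in auto)
    also have "\<dots> \<in> G"
    proof (rule V.stable_finsum[OF G(1) fg(1)])
      fix s assume s: "s \<in> S"
      have "c s \<odot>\<^bsub>V\<^esub> (s \<odot>\<^bsub>V\<^esub> b) \<in> G" using stableD(4)[OF G(1) cR(2)[OF s]] G(3) s by blast
      then show "(c s \<otimes> s) \<odot>\<^bsub>V\<^esub> b \<in> G" using V.smult_assoc[OF cR(1)[OF s] cR(3)[OF s] bc] by simp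
    qed
    finally show ?thesis .
  qed
  have "B \<subseteq> G"
  proof
    fix x assume "x \<in> B"
    then obtain u a where "u \<in> A" "a \<in> carrier R" "x = u \<oplus>\<^bsub>V\<^esub> a \<odot>\<^bsub>V\<^esub> b" unfolding HBe[symmetric] V.set_add_iff by blast
    then show "x \<in> G" using stableD(3)[OF G(1), of u "a \<odot>\<^bsub>V\<^esub> b"] span G(2) by blast
  qed
  then have "G = B" using G(4) by blast
  then show ?thesis using G(5) by simp
qed

end

lemma composition_series_zfinite:
  assumes "central_ops R Z" and lm: "left_module R V" and cs: "composition_series R V C n"
    and fin: "\<And>A B. stable_sub (carrier R) V A \<Longrightarrow> stable_sub (carrier R) V B \<Longrightarrow> A \<subseteq> B \<Longrightarrow>
      (\<And>H. stable_sub (carrier R) V H \<Longrightarrow> A \<subseteq> H \<Longrightarrow> H \<subseteq> B \<Longrightarrow> H = A \<or> H = B) \<Longrightarrow> rlen Z V A B \<noteq> \<infinity>"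
  shows "central_ops.zfinite Z V"
proof -
  interpret central_ops R Z by fact
  interpret V: left_module R V by fact
  have st: "stable_sub (carrier R) V (C i)" if "i \<le> n" for i
    using cs that V.submodule_stable by (auto simp: composition_series_def)
  have stZ: "stable_sub Z V (C i)" if "i \<le> n" for i using stable_mono[OF st[OF that] Z_sub] .
  have C0: "C 0 = {\<zero>\<^bsub>V\<^esub>}" and Cn: "C n = carrier V" and sub: "\<And>i. i < n \<Longrightarrow> C i \<subseteq> C (Suc i)"
    and sim: "\<And>i. i < n \<Longrightarrow> simple_module R (quot_module (V\<lparr>carrier := C (Suc i)\<rparr>) (C i))"
    using cs by (auto simp: composition_series_def)
  have "len Z V (C i) \<noteq> \<infinity> \<and> {\<zero>\<^bsub>V\<^esub>} \<subseteq> C i" if "i \<le> n" for i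
    using that
  proof (induction i)
    case 0
    show ?case unfolding C0 V.rlen_self by simp
  next
    case (Suc i)
    let ?B = "C (Suc i)"
    have i: "i < n" "i \<le> n" and Bst: "stable_sub (carrier R) V ?B" and Ast: "stable_sub (carrier R) V (C i)"
      using Suc.prems st by auto
    note Bc = stableD(1)[OF Bst]
    have "rlen Z V (C i) ?B \<noteq> \<infinity>"
    proof (rule fin[OF Ast Bst sub[OF i(1)]])
      fix H assume H: "stable_sub (carrier R) V H" "C i \<subseteq> H" "H \<subseteq> ?B"
      have "H = C i \<or> H = carrier (V\<lparr>carrier := ?B\<rparr>)"
        by (rule simple_quotient_no_between[OF left_module_restrict[OF lm Bst] _ sim[OF i(1)] _ H(2)])
          (use H Ast sub[OF i(1)] stable_restrict[OF Bc] in auto)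
      then show "H = C i \<or> H = ?B" by simp
    qed
    moreover have IH: "len Z V (C i) \<noteq> \<infinity>" "{\<zero>\<^bsub>V\<^esub>} \<subseteq> C i" using Suc.IH[OF i(2)] by auto
    ultimately have "len Z V ?B \<noteq> \<infinity>"
      by (intro enat_sum_finite[OF V.rlen_add[OF V.stable_zero[OF Z_sub] stZ[OF i(2)] Z_sub IH(2) sub[OF i(1)] stZ[OF Suc.prems]]])
    then show ?case using IH(2) sub[OF i(1)] by blast
  qed
  from this[of n] show ?thesis unfolding zfinite_def Cn by simp
qed

text \<open>
  The descending chain condition, applied to the principal ideals of the powers of \<open>k\<close>.
\<close>

lemma artinian_power_stationary:
  assumes "artinian_cring K" "k \<in> carrier K"
  shows "\<exists>n. \<exists>c\<in>carrier K. k [^]\<^bsub>K\<^esub> (n::nat) = c \<otimes>\<^bsub>K\<^esub> k [^]\<^bsub>K\<^esub> Suc n"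
proof -
  interpret K: cring K using assms(1) by (simp add: artinian_cring_def)
  let ?I = "\<lambda>n::nat. PIdl\<^bsub>K\<^esub> (k [^]\<^bsub>K\<^esub> n)"
  have pc: "k [^]\<^bsub>K\<^esub> n \<in> carrier K" for n :: nat using assms(2) by simp
  have "?I (Suc n) \<subseteq> ?I n" for n
  proof
    fix x assume "x \<in> ?I (Suc n)"
    then obtain c where c: "c \<in> carrier K" "x = c \<otimes>\<^bsub>K\<^esub> k [^]\<^bsub>K\<^esub> Suc n" by (auto simp: cgenideal_def)
    then have "x = (c \<otimes>\<^bsub>K\<^esub> k) \<otimes>\<^bsub>K\<^esub> k [^]\<^bsub>K\<^esub> n" using assms(2) by (simp add: K.m_ac)
    then show "x \<in> ?I n" using c(1) assms(2) by (auto simp: cgenideal_def)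
  qed
  then have "\<forall>n. ideal (?I n) K \<and> ?I (Suc n) \<subseteq> ?I n" using K.cgenideal_ideal[OF pc] by blast
  then obtain N where "\<forall>n\<ge>N. ?I n = ?I N"
    using spec[OF conjunct2[OF assms(1)[unfolded artinian_cring_def]], of ?I] by (elim impE) (assumption, elim exE)
  then have "N \<le> Suc N \<longrightarrow> ?I (Suc N) = ?I N" by (rule spec)
  then have e: "?I (Suc N) = ?I N" by (rule mp) simp
  have "k [^]\<^bsub>K\<^esub> N \<in> ?I (Suc N)" unfolding e by (rule K.cgenideal_self[OF pc])
  then show ?thesis by (auto simp: cgenideal_def)
qed

definition scalars :: "('k, 'n) ring_scheme \<Rightarrow> ('k, 'a, 'm) module_scheme \<Rightarrow> 'a set" where
  "scalars K \<Lambda> = (\<lambda>k. k \<odot>\<^bsub>\<Lambda>\<^esub> \<one>\<^bsub>\<Lambda>\<^esub>) ` carrier K"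

lemma central_ops_scalars:
  assumes "artin_algebra K \<Lambda>"
  shows "central_ops \<Lambda> (scalars K \<Lambda>)"
proof -
  interpret L: ring \<Lambda> using assms by (simp add: artin_algebra_def)
  interpret KL: Module.module K \<Lambda> using assms by (simp add: artin_algebra_def)
  have al: "(a \<odot>\<^bsub>\<Lambda>\<^esub> x) \<otimes>\<^bsub>\<Lambda>\<^esub> y = a \<odot>\<^bsub>\<Lambda>\<^esub> (x \<otimes>\<^bsub>\<Lambda>\<^esub> y)" "x \<otimes>\<^bsub>\<Lambda>\<^esub> (a \<odot>\<^bsub>\<Lambda>\<^esub> y) = a \<odot>\<^bsub>\<Lambda>\<^esub> (x \<otimes>\<^bsub>\<Lambda>\<^esub> y)"
    if "a \<in> carrier K" "x \<in> carrier \<Lambda>" "y \<in> carrier \<Lambda>" for a x y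
    using assms that by (auto simp: artin_algebra_def)
  show ?thesis
    by unfold_locales (auto simp: scalars_def al)
qed

lemma artin_algebra_zfinite:
  assumes art: "artin_algebra K \<Lambda>" and lm: "left_module \<Lambda> V" and fl: "finite_length \<Lambda> V"
  shows "central_ops.zfinite (scalars K \<Lambda>) V"
proof -
  let ?Z = "scalars K \<Lambda>"
  interpret L: ring \<Lambda> using art by (simp add: artin_algebra_def)
  interpret KL: Module.module K \<Lambda> using art by (simp add: artin_algebra_def)
  have al: "(a \<odot>\<^bsub>\<Lambda>\<^esub> x) \<otimes>\<^bsub>\<Lambda>\<^esub> y = a \<odot>\<^bsub>\<Lambda>\<^esub> (x \<otimes>\<^bsub>\<Lambda>\<^esub> y)" "x \<otimes>\<^bsub>\<Lambda>\<^esub> (a \<odot>\<^bsub>\<Lambda>\<^esub> y) = a \<odot>\<^bsub>\<Lambda>\<^esub> (x \<otimes>\<^bsub>\<Lambda>\<^esub> y)"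
    if "a \<in> carrier K" "x \<in> carrier \<Lambda>" "y \<in> carrier \<Lambda>" for a x y
    using art that by (auto simp: artin_algebra_def)
  let ?i = "\<lambda>k. k \<odot>\<^bsub>\<Lambda>\<^esub> \<one>\<^bsub>\<Lambda>\<^esub>"
  have iZ: "?i k \<in> ?Z" if "k \<in> carrier K" for k using that by (simp add: scalars_def)
  have Zi: "\<exists>k\<in>carrier K. z = ?i k" if "z \<in> ?Z" for z using that by (auto simp: scalars_def)
  have imult: "?i k \<otimes>\<^bsub>\<Lambda>\<^esub> ?i l = ?i (k \<otimes>\<^bsub>K\<^esub> l)" if "k \<in> carrier K" "l \<in> carrier K" for k l
    using al(1)[of k "\<one>\<^bsub>\<Lambda>\<^esub>" "?i l"] that by (simp add: KL.smult_assoc1)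
  have one: "\<one>\<^bsub>\<Lambda>\<^esub> = ?i \<one>\<^bsub>K\<^esub>" by (simp add: KL.smult_one)
  have ipow: "?i k [^]\<^bsub>\<Lambda>\<^esub> n = ?i (k [^]\<^bsub>K\<^esub> n)" if k: "k \<in> carrier K" for k and n :: nat
  proof (induction n)
    case 0 then show ?case using one by simp
  next
    case (Suc n)
    have "?i k [^]\<^bsub>\<Lambda>\<^esub> Suc n = ?i (k [^]\<^bsub>K\<^esub> n) \<otimes>\<^bsub>\<Lambda>\<^esub> ?i k" using Suc by simp
    then show ?case using imult[of "k [^]\<^bsub>K\<^esub> n" k] k by simp
  qed
  interpret C: central_ops \<Lambda> ?Z by (rule central_ops_scalars[OF art])
  have "fin_gen_module K \<Lambda>" using art by (simp add: artin_algebra_def)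
  then obtain S where S: "finite S" "S \<subseteq> carrier \<Lambda>"
    "\<forall>x\<in>carrier \<Lambda>. \<exists>c\<in>S \<rightarrow> carrier K. x = (\<Oplus>\<^bsub>\<Lambda>\<^esub>s\<in>S. c s \<odot>\<^bsub>\<Lambda>\<^esub> s)"
    unfolding fin_gen_module_def by (elim exE conjE)
  obtain D n where D: "composition_series \<Lambda> V D n" using fl by (auto simp: finite_length_def)
  show ?thesis
  proof (rule composition_series_zfinite[OF C.central_ops_axioms lm D])
    fix A B assume AB: "stable_sub (carrier \<Lambda>) V A" "stable_sub (carrier \<Lambda>) V B" "A \<subseteq> B"
      "\<And>H. stable_sub (carrier \<Lambda>) V H \<Longrightarrow> A \<subseteq> H \<Longrightarrow> H \<subseteq> B \<Longrightarrow> H = A \<or> H = B"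
    show "rlen ?Z V A B \<noteq> \<infinity>"
    proof (rule C.simple_factor_finite[OF lm _ _ _ _ _ S(1,2) _ AB(1-3)])
      show "\<one>\<^bsub>\<Lambda>\<^esub> \<in> ?Z" by (subst one) (rule iZ, simp)
    next
      fix y z assume "y \<in> ?Z" "z \<in> ?Z"
      then obtain k l where kl: "k \<in> carrier K" "l \<in> carrier K" "y = ?i k" "z = ?i l" using Zi by metis
      then have "y \<oplus>\<^bsub>\<Lambda>\<^esub> z = ?i (k \<oplus>\<^bsub>K\<^esub> l)" by (simp add: KL.smult_l_distr)
      then show "y \<oplus>\<^bsub>\<Lambda>\<^esub> z \<in> ?Z" using iZ kl by simp
      have "y \<otimes>\<^bsub>\<Lambda>\<^esub> z = ?i (k \<otimes>\<^bsub>K\<^esub> l)" using kl imult by simp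
      then show "y \<otimes>\<^bsub>\<Lambda>\<^esub> z \<in> ?Z" using iZ kl by simp
    next
      fix z assume "z \<in> ?Z"
      then obtain k where k: "k \<in> carrier K" "z = ?i k" using Zi by blast
      then have "\<ominus>\<^bsub>\<Lambda>\<^esub> z = ?i (\<ominus>\<^bsub>K\<^esub> k)" by (simp add: KL.smult_l_minus)
      then show "\<ominus>\<^bsub>\<Lambda>\<^esub> z \<in> ?Z" using iZ k by simp
      obtain n c where nc: "c \<in> carrier K" "k [^]\<^bsub>K\<^esub> (n::nat) = c \<otimes>\<^bsub>K\<^esub> k [^]\<^bsub>K\<^esub> Suc n"
        using artinian_power_stationary[of K k] art k(1) by (auto simp: artin_algebra_def)
      have kp: "k [^]\<^bsub>K\<^esub> Suc n \<in> carrier K" using k(1) by simp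
      have "z [^]\<^bsub>\<Lambda>\<^esub> n = ?i c \<otimes>\<^bsub>\<Lambda>\<^esub> z [^]\<^bsub>\<Lambda>\<^esub> Suc n"
        unfolding k(2) ipow[OF k(1)] imult[OF nc(1) kp] nc(2)[symmetric] ..
      then show "\<exists>n. \<exists>z'\<in>?Z. z [^]\<^bsub>\<Lambda>\<^esub> (n::nat) = z' \<otimes>\<^bsub>\<Lambda>\<^esub> z [^]\<^bsub>\<Lambda>\<^esub> Suc n" using iZ[OF nc(1)] by blast
    next
      fix a assume "a \<in> carrier \<Lambda>"
      then obtain c where c: "c \<in> S \<rightarrow> carrier K" "a = (\<Oplus>\<^bsub>\<Lambda>\<^esub>s\<in>S. c s \<odot>\<^bsub>\<Lambda>\<^esub> s)" using bspec[OF S(3)] by blast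
      have "a = (\<Oplus>\<^bsub>\<Lambda>\<^esub>s\<in>S. ?i (c s) \<otimes>\<^bsub>\<Lambda>\<^esub> s)"
        unfolding c(2) using c(1) S(2) by (intro L.finsum_cong') (auto simp: al Pi_iff subset_iff)
      moreover have "(\<lambda>s. ?i (c s)) \<in> S \<rightarrow> ?Z" using c(1) iZ by blast
      ultimately show "\<exists>c\<in>S \<rightarrow> ?Z. a = (\<Oplus>\<^bsub>\<Lambda>\<^esub>s\<in>S. c s \<otimes>\<^bsub>\<Lambda>\<^esub> s)" by (intro bexI[of _ "\<lambda>s. ?i (c s)"])
    next
      fix H assume "stable_sub (carrier \<Lambda>) V H" "A \<subseteq> H" "H \<subseteq> B"
      then show "H = A \<or> H = B" by (rule AB(4))
    qed
  qed
qed

theorem mainTheorem10: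
  fixes K :: "('k, 'kx) ring_scheme"
    and \<Lambda> :: "('k, 'a, 'ax) module_scheme"
    and U :: "('a, 'u, 'ux) module_scheme"
    and V :: "('a, 'v, 'vx) module_scheme"
    and W :: "('a, 'w, 'wx) module_scheme"
    and W' :: "('a, 'w1, 'w1x) module_scheme"
    and f f' :: "'u \<Rightarrow> 'v"
  assumes "artin_algebra K \<Lambda>"
    and "left_module \<Lambda> U" and "finite_length \<Lambda> U"
    and "left_module \<Lambda> V" and "finite_length \<Lambda> V"
    and "f \<in> mod_mono \<Lambda> U V" and "is_cokernel \<Lambda> U V f W"
    and "f' \<in> mod_mono \<Lambda> U V" and "is_cokernel \<Lambda> U V f' W'"
    and "trivial_group (Ext1 \<Lambda> W W)"
    and "trivial_group (Ext1 \<Lambda> W' W')"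
  shows "mod_isomorphic \<Lambda> W W'"
proof -
  interpret central_ops \<Lambda> "scalars K \<Lambda>" by (rule central_ops_scalars) fact
  have "zfinite V" by (rule artin_algebra_zfinite) fact+
  from rigid_cokernels_isomorphic[OF assms(2,4) this assms(6,8,7,9,10,11)] show ?thesis .
qed

end
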